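(* Let $p$ be an even positive integer and let $H_k$, $k\in\mathbb N$, be separable Hilbert spaces. Let $a_k\in\mathcal S^p(H_k)$, $k=1,2,3,\dots$, be selfadjoint. Suppose that the limit $\alpha_n:=\lim_{k\to\infty}\mathrm{Tr}_{H_k}(a_k^n)\in\mathbb R$ exists for all integers $n\ge p$. Then there exist a separable Hilbert space $H$ and a selfadjoint operator $a\in\mathcal S^p(H)$ such that $a_k$ converges to $a$ in eigenvalues, and moreover $\alpha_n=\mathrm{Tr}_H(a^n)$ for all integers $n\ge p+1$.
   Context: $\mathcal S^p(H)$ is the set of $p$-Schatten class operators on $H$; $\mathrm{Tr}_H$ is the trace on $H$. Convergence in eigenvalues: for a selfadjoint compact operator $a$ on a separable Hilbert space, let $\lambda_1^+(a)\ge\lambda_2^+(a)\ge\cdots\ge0$ be its nonnegative eigenvalues (with multiplicity) in nonincreasing order and $\lambda_1^-(a)\le\lambda_2^-(a)\le\cdots\le0$ its nonpositive eigenvalues in nondecreasing order, finite lists being padded with infinitely many zeros. Then $a_k$ converges to $a$ in eigenvalues if $\lambda_i^{u}(a_k)\to\lambda_i^{u}(a)$ as $k\to\infty$ for all $i\ge1$, $u\in\{+,-\}$. *)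

theory Defs
  imports "HOL-Analysis.Analysis" "HOL-Library.Function_Algebras"
begin

section \<open>Complex Hilbert spaces\<close>

text \<open>
  A sequence of unrelated Hilbert spaces cannot be a sequence of types, so a Hilbert space is a
  value: a linear subspace \<^term>\<open>S\<close> of some complex vector space together with an inner product
  on \<^term>\<open>S\<close>.  The surrounding vector space carries no norm or topology, and the inner products
  of different spaces need not be related.  This is no restriction: the algebraic direct sum of the
  members of any family of Hilbert spaces contains all of them in this way.
\<close>

record 'a hspace =
  hcarrier :: "'a set"
  hscale :: "complex \<Rightarrow> 'a \<Rightarrow> 'a"
  hinner :: "'a \<Rightarrow> 'a \<Rightarrow> complex"

definition hnorm :: "'a hspace \<Rightarrow> 'a \<Rightarrow> real" where
  "hnorm H x = sqrt (Re (hinner H x x))"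

definition hdist :: "('a::ab_group_add) hspace \<Rightarrow> 'a \<Rightarrow> 'a \<Rightarrow> real" where
  "hdist H x y = hnorm H (x - y)"

locale hilbert_space = vector_space "hscale H" for H :: "('a::ab_group_add) hspace" +
  assumes subspace_carrier: "subspace (hcarrier H)"
    and inner_commute:
      "\<And>x y. x \<in> hcarrier H \<Longrightarrow> y \<in> hcarrier H \<Longrightarrow> hinner H x y = cnj (hinner H y x)"
    and inner_add_left:
      "\<And>x y z. x \<in> hcarrier H \<Longrightarrow> y \<in> hcarrier H \<Longrightarrow> z \<in> hcarrier H \<Longrightarrow>
        hinner H (x + y) z = hinner H x z + hinner H y z"
    and inner_scale_left:
      "\<And>c x y. x \<in> hcarrier H \<Longrightarrow> y \<in> hcarrier H \<Longrightarrow>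
        hinner H (hscale H c x) y = c * hinner H x y"
    and inner_nonneg: "\<And>x. x \<in> hcarrier H \<Longrightarrow> hinner H x x \<in> \<real>\<^sub>\<ge>\<^sub>0"
    and inner_definite: "\<And>x. x \<in> hcarrier H \<Longrightarrow> hinner H x x = 0 \<Longrightarrow> x = 0"
    and complete: "Metric_space.mcomplete (hcarrier H) (hdist H)"

locale separable_hilbert_space = hilbert_space +
  assumes separable: "separable_space (Metric_space.mtopology (hcarrier H) (hdist H))"


section \<open>Bounded operators\<close>

text \<open>
  Operators on \<^term>\<open>H\<close> are functions of which only the values on the carrier of \<^term>\<open>H\<close> matter.
\<close>

definition bounded_operator :: "('a::ab_group_add) hspace \<Rightarrow> ('a \<Rightarrow> 'a) \<Rightarrow> bool" where
  "bounded_operator H T \<longleftrightarrow>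
     (\<forall>x\<in>hcarrier H. T x \<in> hcarrier H) \<and>
     (\<forall>x\<in>hcarrier H. \<forall>y\<in>hcarrier H. T (x + y) = T x + T y) \<and>
     (\<forall>c. \<forall>x\<in>hcarrier H. T (hscale H c x) = hscale H c (T x)) \<and>
     (\<exists>B. \<forall>x\<in>hcarrier H. hnorm H (T x) \<le> B * hnorm H x)"

definition is_adjoint :: "('a::ab_group_add) hspace \<Rightarrow> ('a \<Rightarrow> 'a) \<Rightarrow> ('a \<Rightarrow> 'a) \<Rightarrow> bool" where
  "is_adjoint H T S \<longleftrightarrow> bounded_operator H T \<and> bounded_operator H S \<and>
     (\<forall>x\<in>hcarrier H. \<forall>y\<in>hcarrier H. hinner H (T x) y = hinner H x (S y))"

definition selfadjoint :: "('a::ab_group_add) hspace \<Rightarrow> ('a \<Rightarrow> 'a) \<Rightarrow> bool" where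
  "selfadjoint H T \<longleftrightarrow> is_adjoint H T T"

definition positive_operator :: "('a::ab_group_add) hspace \<Rightarrow> ('a \<Rightarrow> 'a) \<Rightarrow> bool" where
  "positive_operator H T \<longleftrightarrow> bounded_operator H T \<and> (\<forall>x\<in>hcarrier H. hinner H (T x) x \<in> \<real>\<^sub>\<ge>\<^sub>0)"

text \<open>
  The absolute value of \<open>T\<close> is the positive square root of \<open>T\<^sup>* T\<close>.
\<close>

definition is_absolute_value :: "('a::ab_group_add) hspace \<Rightarrow> ('a \<Rightarrow> 'a) \<Rightarrow> ('a \<Rightarrow> 'a) \<Rightarrow> bool" where
  "is_absolute_value H T P \<longleftrightarrow> positive_operator H P \<and>
     (\<exists>S. is_adjoint H T S \<and> (\<forall>x\<in>hcarrier H. P (P x) = S (T x)))"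


section \<open>Trace and Schatten classes\<close>

definition orthonormal_basis :: "('a::ab_group_add) hspace \<Rightarrow> 'a set \<Rightarrow> bool" where
  "orthonormal_basis H E \<longleftrightarrow> E \<subseteq> hcarrier H \<and>
     (\<forall>e\<in>E. \<forall>f\<in>E. hinner H e f = (if e = f then 1 else 0)) \<and>
     (\<forall>x\<in>hcarrier H. (\<forall>e\<in>E. hinner H x e = 0) \<longrightarrow> x = 0)"

definition has_trace :: "('a::ab_group_add) hspace \<Rightarrow> ('a \<Rightarrow> 'a) \<Rightarrow> complex \<Rightarrow> bool" where
  "has_trace H T t \<longleftrightarrow> (\<forall>E. orthonormal_basis H E \<longrightarrow> ((\<lambda>e. hinner H (T e) e) has_sum t) E)"

definition operator_trace :: "('a::ab_group_add) hspace \<Rightarrow> ('a \<Rightarrow> 'a) \<Rightarrow> complex" where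
  "operator_trace H T = (THE t. has_trace H T t)"

text \<open>
  The operators \<open>T\<close> such that \<open>|T|\<^sup>p\<close> has finite trace.  Restricting to integer
  exponents \<open>p \<ge> 1\<close> makes \<open>|T|\<^sup>p\<close> an iterate of \<open>|T|\<close>.
\<close>

definition schatten_class :: "('a::ab_group_add) hspace \<Rightarrow> nat \<Rightarrow> ('a \<Rightarrow> 'a) set" where
  "schatten_class H p = {T. bounded_operator H T \<and>
     (\<exists>P t. is_absolute_value H T P \<and> has_trace H (P ^^ p) t)}"


section \<open>Convergence in eigenvalues\<close>

definition eigenspace :: "('a::ab_group_add) hspace \<Rightarrow> ('a \<Rightarrow> 'a) \<Rightarrow> real \<Rightarrow> 'a set" where
  "eigenspace H T t = {x \<in> hcarrier H. T x = hscale H (complex_of_real t) x}"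

definition eigenvalue_multiplicity :: "('a::ab_group_add) hspace \<Rightarrow> ('a \<Rightarrow> 'a) \<Rightarrow> real \<Rightarrow> nat" where
  "eigenvalue_multiplicity H T t = vector_space.dim (hscale H) (eigenspace H T t)"

text \<open>
  The lists of nonnegative and nonpositive eigenvalues of a selfadjoint compact operator, with
  multiplicity and padded with zeros, are indexed from 0.  Every nonzero value occurs as often as
  its multiplicity (in particular not at all if it is no eigenvalue).  Nothing is prescribed for
  the number of zeros: an eigenvalue 0 and a padding zero look alike, and if there are infinitely
  many positive eigenvalues then a nonincreasing list never reaches 0.  The lists are unique for
  compact operators, whose eigenspaces for nonzero eigenvalues are finite-dimensional.
\<close>

definition nonneg_eigenvalue_list ::
    "('a::ab_group_add) hspace \<Rightarrow> ('a \<Rightarrow> 'a) \<Rightarrow> (nat \<Rightarrow> real) \<Rightarrow> bool" where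
  "nonneg_eigenvalue_list H T l \<longleftrightarrow> decseq l \<and> (\<forall>i. l i \<ge> 0) \<and>
     (\<forall>t>0. finite {i. l i = t} \<and> card {i. l i = t} = eigenvalue_multiplicity H T t)"

definition nonpos_eigenvalue_list ::
    "('a::ab_group_add) hspace \<Rightarrow> ('a \<Rightarrow> 'a) \<Rightarrow> (nat \<Rightarrow> real) \<Rightarrow> bool" where
  "nonpos_eigenvalue_list H T l \<longleftrightarrow> incseq l \<and> (\<forall>i. l i \<le> 0) \<and>
     (\<forall>t<0. finite {i. l i = t} \<and> card {i. l i = t} = eigenvalue_multiplicity H T t)"

definition eigenvalue_plus :: "('a::ab_group_add) hspace \<Rightarrow> ('a \<Rightarrow> 'a) \<Rightarrow> nat \<Rightarrow> real" where
  "eigenvalue_plus H T = (THE l. nonneg_eigenvalue_list H T l)"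

definition eigenvalue_minus :: "('a::ab_group_add) hspace \<Rightarrow> ('a \<Rightarrow> 'a) \<Rightarrow> nat \<Rightarrow> real" where
  "eigenvalue_minus H T = (THE l. nonpos_eigenvalue_list H T l)"

definition converges_in_eigenvalues ::
    "(nat \<Rightarrow> ('a::ab_group_add) hspace) \<Rightarrow> (nat \<Rightarrow> 'a \<Rightarrow> 'a) \<Rightarrow>
     ('b::ab_group_add) hspace \<Rightarrow> ('b \<Rightarrow> 'b) \<Rightarrow> bool" where
  "converges_in_eigenvalues H a K b \<longleftrightarrow>
     (\<forall>i. (\<lambda>k. eigenvalue_plus (H k) (a k) i) \<longlonglongrightarrow> eigenvalue_plus K b i) \<and>
     (\<forall>i. (\<lambda>k. eigenvalue_minus (H k) (a k) i) \<longlonglongrightarrow> eigenvalue_minus K b i)"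

end

theory Submission
  imports Defs
begin

text \<open>
  The spectral theorem turns each \<open>a\<^sub>k\<close> into a list of eigenvalues, and \<open>Tr (a\<^sub>k\<^sup>n)\<close> into a power
  sum.  The power sums are the moments of the measures \<open>\<Sum> \<lambda>\<^sup>p \<delta>\<^sub>\<lambda>\<close>, which have bounded mass and
  support, so by Weierstrass approximation these measures converge against continuous functions.
  Testing with bump functions bounds the number of eigenvalues above any level from both sides; hence each
  \<open>\<lambda>\<^sub>i\<^sup>\<plusminus>(a\<^sub>k)\<close> converges.  As \<open>i |\<lambda>\<^sub>i\<^sup>\<plusminus>(a\<^sub>k)|\<^sup>p\<close> is bounded uniformly in \<open>k\<close>, the sums of \<open>n\<close>-th
  powers converge termwise by dominated convergence for \<open>n > p\<close>, and the limit operator is a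
  diagonal operator on \<open>\<ell>\<^sup>2\<close>.
\<close>

section \<open>Orthonormal systems\<close>

text \<open>The weight is a p-th power so that the given traces, of exponents n \<ge> p, are all the
  moments from order 0 on; evenness of p makes it positive for both signs. It says little about the
  number of eigenvalues near 0, so the test functions vanish there and only positive levels are
  controlled. Mass can indeed escape to 0: for k^(-1/p) times the identity of C^k the p-th power
  always has trace 1, yet all eigenvalues tend to 0. This is why traces are recovered only for n >
  p, where the dominating terms i^(-n/p) are summable.

  On the operator side the data are traces over orthonormal bases, not compactness. With p = 2m,
  finiteness of the trace says that the squared norms of T^m on a basis are summable; Parseval's
  identity on the range of T^m, convergence there and the eigenvectors are all drawn from this. The
  inner product facts form a locale of their own, which applies to \<open>l2\<close> before its
  completeness is shown.\<close>

locale inner_product_space = vector_space "hscale H" for H :: "('a::ab_group_add) hspace" +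
  assumes subspace_carrier: "subspace (hcarrier H)"
    and inner_commute:
      "\<And>x y. x \<in> hcarrier H \<Longrightarrow> y \<in> hcarrier H \<Longrightarrow> hinner H x y = cnj (hinner H y x)"
    and inner_add_left:
      "\<And>x y z. x \<in> hcarrier H \<Longrightarrow> y \<in> hcarrier H \<Longrightarrow> z \<in> hcarrier H \<Longrightarrow>
        hinner H (x + y) z = hinner H x z + hinner H y z"
    and inner_scale_left:
      "\<And>c x y. x \<in> hcarrier H \<Longrightarrow> y \<in> hcarrier H \<Longrightarrow>
        hinner H (hscale H c x) y = c * hinner H x y"
    and inner_nonneg: "\<And>x. x \<in> hcarrier H \<Longrightarrow> hinner H x x \<in> \<real>\<^sub>\<ge>\<^sub>0"
    and inner_definite: "\<And>x. x \<in> hcarrier H \<Longrightarrow> hinner H x x = 0 \<Longrightarrow> x = 0"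
begin

lemma carrier_simps [simp]:
  "0 \<in> hcarrier H"
  "x \<in> hcarrier H \<Longrightarrow> y \<in> hcarrier H \<Longrightarrow> x + y \<in> hcarrier H"
  "x \<in> hcarrier H \<Longrightarrow> y \<in> hcarrier H \<Longrightarrow> x - y \<in> hcarrier H"
  "x \<in> hcarrier H \<Longrightarrow> - x \<in> hcarrier H"
  "x \<in> hcarrier H \<Longrightarrow> hscale H c x \<in> hcarrier H"
  using subspace_carrier
  by (simp_all add: subspace_0 subspace_add subspace_diff subspace_neg subspace_scale)

lemma carrier_sum [simp]: "(\<And>i. i \<in> I \<Longrightarrow> f i \<in> hcarrier H) \<Longrightarrow> sum f I \<in> hcarrier H"
  by (rule subspace_sum[OF subspace_carrier])

lemma inner_add_right:
  "x \<in> hcarrier H \<Longrightarrow> y \<in> hcarrier H \<Longrightarrow> z \<in> hcarrier H \<Longrightarrow>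
    hinner H x (y + z) = hinner H x y + hinner H x z"
  by (metis carrier_simps(2) complex_cnj_add inner_add_left inner_commute)

lemma inner_scale_right:
  "x \<in> hcarrier H \<Longrightarrow> y \<in> hcarrier H \<Longrightarrow> hinner H x (hscale H c y) = cnj c * hinner H x y"
  by (metis carrier_simps(5) complex_cnj_mult inner_commute inner_scale_left)

lemma inner_zero_left [simp]: "y \<in> hcarrier H \<Longrightarrow> hinner H 0 y = 0"
  using inner_add_left[of 0 0 y] by simp

lemma inner_zero_right [simp]: "y \<in> hcarrier H \<Longrightarrow> hinner H y 0 = 0"
  using inner_add_right[of y 0 0] by simp

lemma inner_minus_left: "x \<in> hcarrier H \<Longrightarrow> y \<in> hcarrier H \<Longrightarrow> hinner H (- x) y = - hinner H x y"
  using inner_add_left[of x "- x" y] by (simp add: add_eq_0_iff)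

lemma inner_minus_right: "x \<in> hcarrier H \<Longrightarrow> y \<in> hcarrier H \<Longrightarrow> hinner H x (- y) = - hinner H x y"
  using inner_add_right[of x y "- y"] by (simp add: add_eq_0_iff)

lemma inner_diff_left:
  "x \<in> hcarrier H \<Longrightarrow> y \<in> hcarrier H \<Longrightarrow> z \<in> hcarrier H \<Longrightarrow>
    hinner H (x - y) z = hinner H x z - hinner H y z"
  using inner_add_left[of x "- y" z] by (simp add: inner_minus_left)

lemma inner_diff_right:
  "x \<in> hcarrier H \<Longrightarrow> y \<in> hcarrier H \<Longrightarrow> z \<in> hcarrier H \<Longrightarrow>
    hinner H x (y - z) = hinner H x y - hinner H x z"
  using inner_add_right[of x y "- z"] by (simp add: inner_minus_right)

lemma inner_sum_left:
  "(\<And>i. i \<in> I \<Longrightarrow> f i \<in> hcarrier H) \<Longrightarrow> y \<in> hcarrier H \<Longrightarrow>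
    hinner H (sum f I) y = (\<Sum>i\<in>I. hinner H (f i) y)"
  by (induction I rule: infinite_finite_induct) (simp_all add: inner_add_left)

lemma inner_sum_right:
  "(\<And>i. i \<in> I \<Longrightarrow> f i \<in> hcarrier H) \<Longrightarrow> y \<in> hcarrier H \<Longrightarrow>
    hinner H y (sum f I) = (\<Sum>i\<in>I. hinner H y (f i))"
  by (induction I rule: infinite_finite_induct) (simp_all add: inner_add_right)

lemma inner_same: "x \<in> hcarrier H \<Longrightarrow> hinner H x x = complex_of_real ((hnorm H x)\<^sup>2)"
  using inner_nonneg[of x] by (auto simp: hnorm_def nonneg_Reals_def simp flip: of_real_power)

lemma hnorm_sq: "x \<in> hcarrier H \<Longrightarrow> (hnorm H x)\<^sup>2 = Re (hinner H x x)"
  by (simp add: inner_same)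

lemma hnorm_nonneg [simp]: "x \<in> hcarrier H \<Longrightarrow> 0 \<le> hnorm H x"
  using inner_nonneg[of x] by (auto simp: hnorm_def nonneg_Reals_def)

lemma hnorm_eq_0: "x \<in> hcarrier H \<Longrightarrow> hnorm H x = 0 \<longleftrightarrow> x = 0"
  using inner_definite[of x] inner_same[of x] by auto

lemma hnorm_zero [simp]: "hnorm H 0 = 0"
  by (simp add: hnorm_eq_0)

lemma hnorm_pos: "x \<in> hcarrier H \<Longrightarrow> x \<noteq> 0 \<Longrightarrow> 0 < hnorm H x"
  using hnorm_nonneg[of x] hnorm_eq_0[of x] by linarith

lemma hnorm_scale: "x \<in> hcarrier H \<Longrightarrow> hnorm H (hscale H c x) = cmod c * hnorm H x"
proof -
  assume x: "x \<in> hcarrier H"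
  have "hinner H (hscale H c x) (hscale H c x) = (c * cnj c) * hinner H x x"
    using x by (simp add: inner_scale_left inner_scale_right)
  also have "\<dots> = of_real ((cmod c * hnorm H x)\<^sup>2)"
    using x complex_norm_square[of c] by (simp add: inner_same power_mult_distrib)
  finally have "(hnorm H (hscale H c x))\<^sup>2 = (cmod c * hnorm H x)\<^sup>2"
    using x by (simp add: hnorm_sq del: of_real_power of_real_mult)
  then show ?thesis using x by simp
qed

lemma hnorm_minus: "x \<in> hcarrier H \<Longrightarrow> hnorm H (- x) = hnorm H x"
  by (simp add: hnorm_def inner_minus_left inner_minus_right)

lemma hnorm_diff_commute: "x \<in> hcarrier H \<Longrightarrow> y \<in> hcarrier H \<Longrightarrow> hnorm H (x - y) = hnorm H (y - x)"
  using hnorm_minus[of "x - y"] by simp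

lemma hnorm_diff_sq:
  assumes "x \<in> hcarrier H" "y \<in> hcarrier H"
  shows "(hnorm H (x - y))\<^sup>2 = (hnorm H x)\<^sup>2 - 2 * Re (hinner H x y) + (hnorm H y)\<^sup>2"
proof -
  have "Re (hinner H y x) = Re (hinner H x y)"
    using inner_commute[OF assms] by simp
  then show ?thesis
    using assms by (simp add: hnorm_sq inner_diff_left inner_diff_right)
qed

lemma hnorm_add_sq:
  assumes "x \<in> hcarrier H" "y \<in> hcarrier H"
  shows "(hnorm H (x + y))\<^sup>2 = (hnorm H x)\<^sup>2 + 2 * Re (hinner H x y) + (hnorm H y)\<^sup>2"
  using hnorm_diff_sq[of x "- y"] assms by (simp add: inner_minus_right hnorm_minus)

lemma Cauchy_Schwarz:
  assumes x: "x \<in> hcarrier H" and y: "y \<in> hcarrier H"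
  shows "cmod (hinner H x y) \<le> hnorm H x * hnorm H y"
proof (cases "y = 0")
  case True
  then show ?thesis using x by simp
next
  case False
  define r where "r = hnorm H y"
  have r: "r > 0" using hnorm_pos[OF y False] by (simp add: r_def)
  \<comment> \<open>\<open>hscale H c y\<close> is the orthogonal projection of \<open>x\<close>
    onto the line through \<open>y\<close>; the inequality is the nonnegativity of the squared
    length of what remains.\<close>
  define c where "c = hinner H x y / of_real (r\<^sup>2)"
  have "hinner H x (hscale H c y) = cnj c * (c * of_real (r\<^sup>2))"
    using x y r by (simp add: inner_scale_right c_def)
  also have "\<dots> = of_real ((cmod c)\<^sup>2 * r\<^sup>2)"
    using complex_norm_square[of c] by (simp add: mult_ac)
  finally have "(hnorm H (x - hscale H c y))\<^sup>2 = (hnorm H x)\<^sup>2 - (cmod c)\<^sup>2 * r\<^sup>2"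
    using x y by (simp add: hnorm_diff_sq hnorm_scale r_def power_mult_distrib
        del: of_real_power of_real_mult)
  then have "(cmod c * r)\<^sup>2 \<le> (hnorm H x)\<^sup>2"
    using zero_le_power2[of "hnorm H (x - hscale H c y)"] by (simp add: power_mult_distrib)
  then have "cmod c * r \<le> hnorm H x"
    using x power2_le_imp_le hnorm_nonneg by blast
  moreover have "cmod c * r * r = cmod (hinner H x y)"
    using r by (simp add: c_def norm_divide norm_mult power2_eq_square)
  ultimately show ?thesis
    using mult_right_mono[of "cmod c * r" "hnorm H x" r] r by (simp add: r_def)
qed

lemma hnorm_triangle:
  assumes "x \<in> hcarrier H" "y \<in> hcarrier H"
  shows "hnorm H (x + y) \<le> hnorm H x + hnorm H y"
proof (rule power2_le_imp_le)
  have "Re (hinner H x y) \<le> hnorm H x * hnorm H y"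
    using Cauchy_Schwarz[OF assms] complex_Re_le_cmod order_trans by blast
  then show "(hnorm H (x + y))\<^sup>2 \<le> (hnorm H x + hnorm H y)\<^sup>2"
    using assms by (simp add: hnorm_add_sq power2_sum)
qed (use assms in simp)

lemma hnorm_triangle_diff:
  assumes "x \<in> hcarrier H" "y \<in> hcarrier H"
  shows "hnorm H (x - y) \<le> hnorm H x + hnorm H y"
  using hnorm_triangle[of x "- y"] assms by (simp add: hnorm_minus)

section \<open>Orthonormal systems and their maximal extensions\<close>

definition orthonormal :: "'a set \<Rightarrow> bool" where
  "orthonormal E \<longleftrightarrow> E \<subseteq> hcarrier H \<and>
     (\<forall>e\<in>E. \<forall>f\<in>E. hinner H e f = (if e = f then 1 else 0))"

lemma orthonormalD:
  assumes "orthonormal E" "e \<in> E"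
  shows "e \<in> hcarrier H" "hinner H e e = 1" "\<And>f. f \<in> E \<Longrightarrow> f \<noteq> e \<Longrightarrow> hinner H e f = 0"
    "hnorm H e = 1"
  using assms by (auto simp: orthonormal_def hnorm_def)

lemma orthonormal_subset: "orthonormal E \<Longrightarrow> F \<subseteq> E \<Longrightarrow> orthonormal F"
  unfolding orthonormal_def by (meson subsetD subset_trans)

lemma orthonormal_basis_iff:
  "orthonormal_basis H E \<longleftrightarrow>
    orthonormal E \<and> (\<forall>x\<in>hcarrier H. (\<forall>e\<in>E. hinner H x e = 0) \<longrightarrow> x = 0)"
  by (simp add: orthonormal_basis_def orthonormal_def)

lemma inner_eq_0_commute:
  "x \<in> hcarrier H \<Longrightarrow> y \<in> hcarrier H \<Longrightarrow> hinner H x y = 0 \<longleftrightarrow> hinner H y x = 0"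
  using inner_commute by (metis complex_cnj_zero)

lemma orthonormal_insert:
  assumes "orthonormal E" "x \<in> hcarrier H" "hnorm H x = 1" "\<And>e. e \<in> E \<Longrightarrow> hinner H x e = 0"
  shows "orthonormal (insert x E)"
proof -
  have "hinner H x x = 1" using inner_same[of x] assms by simp
  moreover have "\<And>e. e \<in> E \<Longrightarrow> hinner H e x = 0"
    using assms inner_eq_0_commute orthonormalD(1) by blast
  ultimately show ?thesis
    using assms unfolding orthonormal_def by (metis insert_iff insert_subset zero_neq_one)
qed

lemma normalize:
  assumes "x \<in> hcarrier H" "x \<noteq> 0"
  shows "hnorm H (hscale H (complex_of_real (inverse (hnorm H x))) x) = 1"
  using hnorm_pos[OF assms] assms by (simp add: hnorm_scale norm_inverse)

text \<open>Zorn's lemma between \<open>E0\<close> and \<open>S\<close>. A nonzero vector of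
  \<open>S\<close> orthogonal to a maximal set could be normalised and added, so closure under
  scalars is the property of \<open>S\<close> that matters; this admits the set of all eigenvectors,
  in general not a subspace.\<close>

lemma maximal_orthonormal:
  assumes "orthonormal E0" "E0 \<subseteq> S"
    and S: "S \<subseteq> hcarrier H" "\<And>c x. x \<in> S \<Longrightarrow> hscale H c x \<in> S"
  obtains E where "E0 \<subseteq> E" "E \<subseteq> S" "orthonormal E"
    "\<And>x. x \<in> S \<Longrightarrow> (\<And>e. e \<in> E \<Longrightarrow> hinner H x e = 0) \<Longrightarrow> x = 0"
proof -
  define \<A> where "\<A> = {E. E0 \<subseteq> E \<and> E \<subseteq> S \<and> orthonormal E}"
  have "\<exists>M\<in>\<A>. \<forall>X\<in>\<A>. M \<subseteq> X \<longrightarrow> X = M"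
  proof (rule subset_Zorn_nonempty)
    show "\<A> \<noteq> {}" using assms by (auto simp: \<A>_def)
    fix \<C> assume C: "\<C> \<noteq> {}" "subset.chain \<A> \<C>"
    then have sub: "\<C> \<subseteq> \<A>" and lin: "\<And>X Y. X \<in> \<C> \<Longrightarrow> Y \<in> \<C> \<Longrightarrow> X \<subseteq> Y \<or> Y \<subseteq> X"
      by (auto simp: subset.chain_def)
    have "hinner H e f = (if e = f then 1 else 0)" if "e \<in> \<Union>\<C>" and "f \<in> \<Union>\<C>" for e f
    proof -
      obtain X Y where XY: "X \<in> \<C>" "e \<in> X" "Y \<in> \<C>" "f \<in> Y" using \<open>e \<in> \<Union>\<C>\<close> \<open>f \<in> \<Union>\<C>\<close> by blast
      then obtain Z where "Z \<in> \<C>" "e \<in> Z" "f \<in> Z" using lin[OF XY(1,3)] by blast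
      then show ?thesis using sub by (auto simp: \<A>_def orthonormal_def)
    qed
    moreover have "\<Union>\<C> \<subseteq> hcarrier H" "\<Union>\<C> \<subseteq> S"
      using sub by (auto simp: \<A>_def orthonormal_def)
    moreover have "E0 \<subseteq> \<Union>\<C>"
      using sub C(1) unfolding \<A>_def by blast
    ultimately show "\<Union>\<C> \<in> \<A>" by (simp add: \<A>_def orthonormal_def)
  qed
  then obtain E where E: "E \<in> \<A>" and max: "\<And>X. X \<in> \<A> \<Longrightarrow> E \<subseteq> X \<Longrightarrow> X = E" by blast
  have "x = 0" if x: "x \<in> S" "\<And>e. e \<in> E \<Longrightarrow> hinner H x e = 0" for x
  proof (rule ccontr)
    assume nz: "x \<noteq> 0"
    define u where "u = hscale H (complex_of_real (inverse (hnorm H x))) x"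
    have xc: "x \<in> hcarrier H" using x S by auto
    have nu: "hnorm H u = 1" unfolding u_def by (rule normalize[OF xc nz])
    have uS: "u \<in> S" "u \<in> hcarrier H" using x S xc by (auto simp: u_def)
    have EE: "orthonormal E" "E \<subseteq> S" "E0 \<subseteq> E" using E by (auto simp: \<A>_def)
    have ux: "hinner H u e = 0" if "e \<in> E" for e
      using x(2)[OF that] xc orthonormalD(1)[OF EE(1) that] by (simp add: u_def inner_scale_left)
    have "insert u E \<in> \<A>"
      using orthonormal_insert[OF EE(1) uS(2) nu ux] EE uS by (auto simp: \<A>_def)
    then have "u \<in> E" using max[of "insert u E"] by auto
    then show False using ux[of u] orthonormalD(2)[OF EE(1)] by auto
  qed
  then show thesis using that E by (auto simp: \<A>_def)
qed

lemma orthonormal_basis_extension: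
  assumes "orthonormal E0"
  obtains E where "E0 \<subseteq> E" "orthonormal_basis H E"
proof -
  have "E0 \<subseteq> hcarrier H" using assms by (simp add: orthonormal_def)
  then obtain E where "E0 \<subseteq> E" "E \<subseteq> hcarrier H" "orthonormal E"
    "\<And>x. x \<in> hcarrier H \<Longrightarrow> (\<And>e. e \<in> E \<Longrightarrow> hinner H x e = 0) \<Longrightarrow> x = 0"
    using maximal_orthonormal[OF assms, of "hcarrier H"] by auto
  then show thesis using that[of E] by (auto simp: orthonormal_basis_iff)
qed

section \<open>Projections onto finite orthonormal systems and Bessel's inequality\<close>

definition proj :: "'a set \<Rightarrow> 'a \<Rightarrow> 'a" where
  "proj F x = (\<Sum>e\<in>F. hscale H (hinner H x e) e)"

text \<open>For infinite \<open>F\<close> the sum defaults to 0, which is in the carrier too; only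
  for finite \<open>F\<close> is it the projection onto the span.\<close>

lemma proj_carrier [simp]: "orthonormal F \<Longrightarrow> proj F x \<in> hcarrier H"
  unfolding proj_def by (intro carrier_sum carrier_simps) (auto dest: orthonormalD)

lemma inner_proj_right:
  assumes "orthonormal F" "y \<in> hcarrier H"
  shows "hinner H y (proj F x) = (\<Sum>e\<in>F. cnj (hinner H x e) * hinner H y e)"
  unfolding proj_def using assms
  by (subst inner_sum_right) (auto dest: orthonormalD simp: inner_scale_right intro!: sum.cong)

lemma inner_proj_left:
  assumes "orthonormal F" "y \<in> hcarrier H"
  shows "hinner H (proj F x) y = (\<Sum>e\<in>F. hinner H x e * hinner H e y)"
  unfolding proj_def using assms
  by (subst inner_sum_left) (auto dest: orthonormalD simp: inner_scale_left intro!: sum.cong)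

lemma inner_proj_member:
  assumes "orthonormal F" "finite F" "e \<in> F"
  shows "hinner H (proj F x) e = hinner H x e"
proof -
  have "hinner H (proj F x) e = (\<Sum>f\<in>F. if f = e then hinner H x e else 0)"
    unfolding inner_proj_left[OF assms(1) orthonormalD(1)[OF assms(1,3)]]
    using assms orthonormalD[OF assms(1)] by (intro sum.cong) auto
  then show ?thesis using assms by simp
qed

lemma residual_orthogonal:
  assumes "orthonormal F" "finite F" "e \<in> F" "x \<in> hcarrier H"
  shows "hinner H (x - proj F x) e = 0"
  using assms orthonormalD(1)[OF assms(1,3)]
  by (simp add: inner_diff_left inner_proj_member)

lemma hnorm_proj_sq:
  assumes "orthonormal F" "finite F" "x \<in> hcarrier H"
  shows "(hnorm H (proj F x))\<^sup>2 = (\<Sum>e\<in>F. (cmod (hinner H x e))\<^sup>2)"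
    and "Re (hinner H x (proj F x)) = (\<Sum>e\<in>F. (cmod (hinner H x e))\<^sup>2)"
proof -
  have 1: "hinner H x (proj F x) = of_real (\<Sum>e\<in>F. (cmod (hinner H x e))\<^sup>2)"
    using assms by (simp add: inner_proj_right complex_norm_square mult.commute del: of_real_power)
  then show "Re (hinner H x (proj F x)) = (\<Sum>e\<in>F. (cmod (hinner H x e))\<^sup>2)" by simp
  have "hinner H (proj F x) (proj F x) = hinner H x (proj F x)"
    unfolding inner_proj_right[OF assms(1) proj_carrier[OF assms(1)]]
      inner_proj_right[OF assms(1,3)]
    using assms by (intro sum.cong) (simp_all add: inner_proj_member)
  then show "(hnorm H (proj F x))\<^sup>2 = (\<Sum>e\<in>F. (cmod (hinner H x e))\<^sup>2)"
    using 1 assms by (simp add: hnorm_sq)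
qed

lemma hnorm_residual_sq:
  assumes "orthonormal F" "finite F" "x \<in> hcarrier H"
  shows "(hnorm H (x - proj F x))\<^sup>2 = (hnorm H x)\<^sup>2 - (\<Sum>e\<in>F. (cmod (hinner H x e))\<^sup>2)"
  using assms hnorm_proj_sq[OF assms] by (simp add: hnorm_diff_sq)

lemma Bessel_finite:
  assumes "orthonormal F" "finite F" "x \<in> hcarrier H"
  shows "(\<Sum>e\<in>F. (cmod (hinner H x e))\<^sup>2) \<le> (hnorm H x)\<^sup>2"
  using hnorm_residual_sq[OF assms] zero_le_power2[of "hnorm H (x - proj F x)"] by linarith

lemma hnorm_residual_le:
  assumes "orthonormal F" "finite F" "x \<in> hcarrier H"
  shows "hnorm H (x - proj F x) \<le> hnorm H x"
proof (rule power2_le_imp_le)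
  show "(hnorm H (x - proj F x))\<^sup>2 \<le> (hnorm H x)\<^sup>2"
    using hnorm_residual_sq[OF assms] sum_nonneg[of F "\<lambda>e. (cmod (hinner H x e))\<^sup>2"] by simp
qed (use assms in simp)

end

section \<open>Operators with finite trace\<close>

locale selfadjoint_operator = inner_product_space H for H :: "('a::ab_group_add) hspace" +
  fixes T :: "'a \<Rightarrow> 'a"
  assumes selfadjoint: "selfadjoint H T"
begin

lemma op_simps:
  "x \<in> hcarrier H \<Longrightarrow> T x \<in> hcarrier H"
  "x \<in> hcarrier H \<Longrightarrow> y \<in> hcarrier H \<Longrightarrow> T (x + y) = T x + T y"
  "x \<in> hcarrier H \<Longrightarrow> T (hscale H c x) = hscale H c (T x)"
  "x \<in> hcarrier H \<Longrightarrow> y \<in> hcarrier H \<Longrightarrow> hinner H (T x) y = hinner H x (T y)"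
  using selfadjoint by (auto simp: selfadjoint_def is_adjoint_def bounded_operator_def)

lemma pow_carrier [simp]: "x \<in> hcarrier H \<Longrightarrow> (T ^^ n) x \<in> hcarrier H"
  by (induction n) (auto simp: op_simps)

lemma pow_add:
  "x \<in> hcarrier H \<Longrightarrow> y \<in> hcarrier H \<Longrightarrow> (T ^^ n) (x + y) = (T ^^ n) x + (T ^^ n) y"
  by (induction n) (auto simp: op_simps)

lemma pow_scale: "x \<in> hcarrier H \<Longrightarrow> (T ^^ n) (hscale H c x) = hscale H c ((T ^^ n) x)"
  by (induction n) (auto simp: op_simps)

lemma pow_diff:
  "x \<in> hcarrier H \<Longrightarrow> y \<in> hcarrier H \<Longrightarrow> (T ^^ n) (x - y) = (T ^^ n) x - (T ^^ n) y"
  using pow_add[of "x - y" y n] by simp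

lemma pow_zero [simp]: "(T ^^ n) 0 = 0"
  using pow_diff[of 0 0 n] by simp

lemma pow_sum:
  "(\<And>i. i \<in> I \<Longrightarrow> f i \<in> hcarrier H) \<Longrightarrow> (T ^^ n) (sum f I) = (\<Sum>i\<in>I. (T ^^ n) (f i))"
  by (induction I rule: infinite_finite_induct) (simp_all add: pow_add)

lemma pow_inner:
  "x \<in> hcarrier H \<Longrightarrow> y \<in> hcarrier H \<Longrightarrow> hinner H ((T ^^ n) x) y = hinner H x ((T ^^ n) y)"
  by (induction n arbitrary: x) (simp_all add: funpow_swap1 op_simps)

lemma pow_inner_split:
  "x \<in> hcarrier H \<Longrightarrow> y \<in> hcarrier H \<Longrightarrow>
    hinner H ((T ^^ (j + k)) x) y = hinner H ((T ^^ k) x) ((T ^^ j) y)"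
  by (simp add: funpow_add pow_inner)

text \<open>The operator-side use of evenness: the trace of an even power becomes a sum of squared
  norms, hence of nonnegative terms.\<close>

lemma inner_pow_double:
  "x \<in> hcarrier H \<Longrightarrow> hinner H ((T ^^ (2 * k)) x) x = complex_of_real ((hnorm H ((T ^^ k) x))\<^sup>2)"
  using pow_inner_split[of x x k k] by (simp add: mult_2 inner_same)

lemma op_bounded:
  obtains B where "B > 0" "\<And>x. x \<in> hcarrier H \<Longrightarrow> hnorm H (T x) \<le> B * hnorm H x"
proof -
  have "\<exists>B. \<forall>x\<in>hcarrier H. hnorm H (T x) \<le> B * hnorm H x"
    using selfadjoint unfolding selfadjoint_def is_adjoint_def bounded_operator_def by blast
  then obtain B where B: "\<And>x. x \<in> hcarrier H \<Longrightarrow> hnorm H (T x) \<le> B * hnorm H x" by blast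
  have "hnorm H (T x) \<le> max B 1 * hnorm H x" if "x \<in> hcarrier H" for x
    using B[OF that] mult_right_mono[of B "max B 1" "hnorm H x"] that by simp
  then show thesis using that[of "max B 1"] by auto
qed

end

text \<open>The Schatten exponent is \<open>2 * m\<close>, so the assumption makes
  \<open>T ^^ m\<close> a Hilbert-Schmidt operator, and \<open>Re t\<close> is the square of its
  Hilbert-Schmidt norm.\<close>

locale finite_trace_operator = selfadjoint_operator +
  fixes m :: nat and t :: complex
  assumes trace: "has_trace H (T ^^ (2 * m)) t"
begin

lemma hilbert_schmidt:
  assumes "orthonormal_basis H E"
  shows "((\<lambda>e. (hnorm H ((T ^^ m) e))\<^sup>2) has_sum Re t) E"
proof -
  have "((\<lambda>e. Re (hinner H ((T ^^ (2 * m)) e) e)) has_sum Re t) E"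
    using trace assms by (intro has_sum_Re) (simp add: has_trace_def)
  then show ?thesis
    using assms by (subst has_sum_cong) (auto simp: inner_pow_double orthonormal_basis_def)
qed

lemma hilbert_schmidt_finite:
  assumes "orthonormal D" "finite D"
  shows "(\<Sum>d\<in>D. (hnorm H ((T ^^ m) d))\<^sup>2) \<le> Re t"
proof -
  obtain E where E: "D \<subseteq> E" "orthonormal_basis H E"
    using orthonormal_basis_extension[OF assms(1)] .
  show ?thesis
    using hilbert_schmidt[OF E(2)] assms(2) E(1)
    by (intro finite_sum_le_has_sum[where A = E]) auto
qed

text \<open>A residual vector extends the finite orthonormal system, so the trace bounds it.\<close>

lemma residual_bound:
  assumes "orthonormal D" "finite D" "r \<in> hcarrier H" "\<And>d. d \<in> D \<Longrightarrow> hinner H r d = 0"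
  shows "(hnorm H ((T ^^ m) r))\<^sup>2 \<le> (Re t - (\<Sum>d\<in>D. (hnorm H ((T ^^ m) d))\<^sup>2)) * (hnorm H r)\<^sup>2"
proof (cases "r = 0")
  case False
  define u where "u = hscale H (complex_of_real (inverse (hnorm H r))) r"
  have r: "hnorm H r > 0" using hnorm_pos assms False by blast
  have uc: "u \<in> hcarrier H" using assms by (simp add: u_def)
  have nu: "hnorm H u = 1" unfolding u_def by (rule normalize[OF assms(3) False])
  have ud: "hinner H u d = 0" if "d \<in> D" for d
    using assms that orthonormalD(1)[OF assms(1) that] by (simp add: u_def inner_scale_left)
  have "u \<notin> D" using ud[of u] orthonormalD(2)[OF assms(1)] by force
  then have "(\<Sum>d\<in>D. (hnorm H ((T ^^ m) d))\<^sup>2) + (hnorm H ((T ^^ m) u))\<^sup>2 \<le> Re t"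
    using hilbert_schmidt_finite[OF orthonormal_insert[OF assms(1) uc nu ud]] assms(2) by simp
  moreover have "(hnorm H ((T ^^ m) u))\<^sup>2 = (hnorm H ((T ^^ m) r))\<^sup>2 / (hnorm H r)\<^sup>2"
  proof -
    have "hnorm H ((T ^^ m) u) = inverse (hnorm H r) * hnorm H ((T ^^ m) r)"
      using assms r by (simp add: u_def pow_scale hnorm_scale norm_inverse)
    then show ?thesis by (simp add: power_mult_distrib power_inverse field_simps)
  qed
  ultimately show ?thesis using r by (simp add: field_simps)
qed simp

text \<open>By selfadjointness the error after a finite \<open>F\<close> is the pairing of
  \<open>z\<close> with \<open>T ^^ m\<close> applied to the residual of \<open>y\<close>, and
  \<open>residual_bound\<close> makes it at most a multiple of the square root of the part of the
  trace outside \<open>F\<close>. Finiteness of the trace thus does the work of completeness in the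
  usual identity, for vectors in the range of \<open>T ^^ m\<close>.\<close>

lemma Parseval_range:
  assumes E: "orthonormal_basis H E" and y: "y \<in> hcarrier H" and z: "z \<in> hcarrier H"
  shows "((\<lambda>e. hinner H ((T ^^ m) z) e * hinner H e y) has_sum hinner H ((T ^^ m) z) y) E"
proof -
  let ?R = "T ^^ m"
  let ?s = "\<lambda>F. \<Sum>e\<in>F. (hnorm H (?R e))\<^sup>2"
  let ?d = "\<lambda>F. hinner H (?R z) y - (\<Sum>e\<in>F. hinner H (?R z) e * hinner H e y)"
  have oE: "orthonormal E" using E by (simp add: orthonormal_basis_iff)
  have "cmod (?d F) \<le> hnorm H z * (sqrt (Re t - ?s F) * hnorm H y)"
    if F: "finite F" "F \<subseteq> E" for F
  proof -
    have oF: "orthonormal F" using orthonormal_subset[OF oE F(2)] .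
    have "hinner H e y = cnj (hinner H y e)" if "e \<in> F" for e
      using inner_commute[OF orthonormalD(1)[OF oF that] y] .
    then have "(\<Sum>e\<in>F. hinner H (?R z) e * hinner H e y) = hinner H (?R z) (proj F y)"
      using oF z by (simp add: inner_proj_right mult.commute)
    then have "?d F = hinner H z (?R (y - proj F y))"
      using oF y z by (simp add: inner_diff_right pow_inner pow_diff)
    also have "cmod \<dots> \<le> hnorm H z * hnorm H (?R (y - proj F y))"
      using oF y z by (intro Cauchy_Schwarz) auto
    also have "hnorm H (?R (y - proj F y)) \<le> sqrt (Re t - ?s F) * hnorm H y"
    proof (rule power2_le_imp_le)
      have "(hnorm H (?R (y - proj F y)))\<^sup>2 \<le> (Re t - ?s F) * (hnorm H (y - proj F y))\<^sup>2"
        using residual_bound[OF oF F(1)] residual_orthogonal[OF oF F(1)] oF y by simp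
      also have "\<dots> \<le> (Re t - ?s F) * (hnorm H y)\<^sup>2"
        using hilbert_schmidt_finite[OF oF F(1)] hnorm_residual_le[OF oF F(1) y] oF y
        by (intro mult_left_mono power_mono) auto
      also have "\<dots> = (sqrt (Re t - ?s F) * hnorm H y)\<^sup>2"
        using hilbert_schmidt_finite[OF oF F(1)] by (simp add: power_mult_distrib)
      finally show "(hnorm H (?R (y - proj F y)))\<^sup>2 \<le> (sqrt (Re t - ?s F) * hnorm H y)\<^sup>2" .
    qed (use hilbert_schmidt_finite[OF oF F(1)] y in simp)
    finally show ?thesis using z by (simp add: mult_left_mono)
  qed
  moreover have "((\<lambda>F. hnorm H z * (sqrt (Re t - ?s F) * hnorm H y)) \<longlongrightarrow>
      hnorm H z * (sqrt (Re t - Re t) * hnorm H y)) (finite_subsets_at_top E)"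
    using hilbert_schmidt[OF E] unfolding has_sum_def by (intro tendsto_intros)
  ultimately have "(?d \<longlongrightarrow> 0) (finite_subsets_at_top E)"
    by (intro Lim_null_comparison[of ?d]) (auto intro: eventually_finite_subsets_at_top_weakI)
  then have "((\<lambda>F. hinner H (?R z) y - ?d F) \<longlongrightarrow> hinner H (?R z) y - 0) (finite_subsets_at_top E)"
    by (intro tendsto_intros)
  then show ?thesis by (simp add: has_sum_def)
qed

lemma Parseval_range_norm:
  assumes E: "orthonormal_basis H E" and z: "z \<in> hcarrier H"
  shows "((\<lambda>e. (cmod (hinner H ((T ^^ m) z) e))\<^sup>2) has_sum (hnorm H ((T ^^ m) z))\<^sup>2) E"
proof -
  let ?y = "(T ^^ m) z"
  have "((\<lambda>e. Re (hinner H ?y e * hinner H e ?y)) has_sum Re (hinner H ?y ?y)) E"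
    by (intro has_sum_Re Parseval_range E z) (simp add: z)
  moreover have "Re (hinner H ?y e * hinner H e ?y) = (cmod (hinner H ?y e))\<^sup>2" if "e \<in> E" for e
  proof -
    have "e \<in> hcarrier H" using E that by (auto simp: orthonormal_basis_def)
    then have "hinner H e ?y = cnj (hinner H ?y e)" using inner_commute[of e ?y] z by simp
    then show ?thesis by (simp add: complex_mult_cnj cmod_power2)
  qed
  ultimately have "((\<lambda>e. (cmod (hinner H ?y e))\<^sup>2) has_sum Re (hinner H ?y ?y)) E"
    by (simp del: times_complex.sel cong: has_sum_cong)
  then show ?thesis using z by (simp add: hnorm_sq)
qed

text \<open>
  A substitute for completeness, which is not accessible: the axioms make \<^const>\<open>hdist\<close> a metric on the
  carrier only, whereas the facts about \<^const>\<open>Metric_space.mcomplete\<close> presuppose a function that is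
  symmetric and nonnegative everywhere.  It holds because the sum defining the trace has the
  same value for all maximal orthonormal systems.  The limit, which a priori lives in the
  completion, is a functional; a maximal orthonormal system in its kernel misses being a basis
  by one vector, which spans the limit by Parseval's identity.
\<close>

lemma range_Cauchy_convergent:
  assumes z: "\<And>k. z k \<in> hcarrier H" and y: "\<And>k. y k = (T ^^ m) (z k)"
    and Cauchy: "\<And>\<epsilon>. \<epsilon> > 0 \<Longrightarrow> \<exists>N. \<forall>k\<ge>N. \<forall>l\<ge>N. hnorm H (y k - y l) < \<epsilon>"
  obtains x where "x \<in> hcarrier H" "(\<lambda>k. hnorm H (y k - x)) \<longlonglongrightarrow> 0"
proof -
  have yc [simp]: "y k \<in> hcarrier H" for k by (simp add: y z)
  \<comment> \<open>The kernel of the functional sending \<open>u\<close> to the limit of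
    \<open>hinner H u (y k)\<close>, which exists for all \<open>u\<close> in the carrier by
    \<open>conv\<close> below.\<close>
  define S where "S = {u \<in> hcarrier H. (\<lambda>k. hinner H u (y k)) \<longlonglongrightarrow> 0}"
  have S: "S \<subseteq> hcarrier H" "hscale H c u \<in> S" if "u \<in> S" for c u
    using that by (auto simp: S_def inner_scale_left intro: tendsto_mult_right_zero)
  have "orthonormal {}" by (simp add: orthonormal_def)
  then obtain E where E: "E \<subseteq> S" "orthonormal E"
    and Emax: "\<And>u. u \<in> S \<Longrightarrow> (\<And>e. e \<in> E \<Longrightarrow> hinner H u e = 0) \<Longrightarrow> u = 0"
    using maximal_orthonormal[of "{}" S] S(2) by (auto simp: S_def)
  have ec: "e \<in> hcarrier H" if "e \<in> E" for e using orthonormalD(1)[OF E(2) that] .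
  have conv: "\<exists>c. (\<lambda>k. hinner H u (y k)) \<longlonglongrightarrow> c" if u: "u \<in> hcarrier H" for u
  proof -
    have "Cauchy (\<lambda>k. hinner H u (y k))"
    proof (rule metric_CauchyI)
      fix \<epsilon> :: real assume "\<epsilon> > 0"
      have pos: "hnorm H u + 1 > 0" using hnorm_nonneg[OF u] by linarith
      then have "\<epsilon> / (hnorm H u + 1) > 0" using \<open>\<epsilon> > 0\<close> by simp
      then obtain N where N: "\<And>k l. k \<ge> N \<Longrightarrow> l \<ge> N \<Longrightarrow> hnorm H (y k - y l) < \<epsilon> / (hnorm H u + 1)"
        using Cauchy by blast
      have "dist (hinner H u (y k)) (hinner H u (y l)) < \<epsilon>" if "k \<ge> N" "l \<ge> N" for k l
      proof -
        have "dist (hinner H u (y k)) (hinner H u (y l)) = cmod (hinner H u (y k - y l))"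
          using u by (simp add: dist_norm inner_diff_right)
        also have "\<dots> \<le> hnorm H u * hnorm H (y k - y l)" using u by (intro Cauchy_Schwarz) auto
        also have "\<dots> \<le> (hnorm H u + 1) * hnorm H (y k - y l)" by (intro mult_right_mono) auto
        also have "\<dots> < \<epsilon>" using N[OF that] pos by (simp add: field_simps)
        finally show ?thesis .
      qed
      then show "\<exists>M. \<forall>k\<ge>M. \<forall>l\<ge>M. dist (hinner H u (y k)) (hinner H u (y l)) < \<epsilon>" by blast
    qed
    then show ?thesis using Cauchy_convergent_iff convergent_def by blast
  qed
  \<comment> \<open>For \<open>e\<close> in \<open>E\<close> the coordinates
    \<open>hinner H (y l) e\<close> tend to 0, so Bessel's inequality for \<open>y k - y l\<close>
    becomes, as \<open>l\<close> grows, a bound for \<open>y k\<close> alone.\<close>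
  have small: "\<exists>N. \<forall>k\<ge>N. \<forall>F. finite F \<and> F \<subseteq> E \<longrightarrow> (\<Sum>e\<in>F. (cmod (hinner H (y k) e))\<^sup>2) \<le> \<epsilon>\<^sup>2"
    if "\<epsilon> > 0" for \<epsilon>
  proof -
    obtain N where N: "\<And>k l. k \<ge> N \<Longrightarrow> l \<ge> N \<Longrightarrow> hnorm H (y k - y l) < \<epsilon>"
      using Cauchy[OF \<open>\<epsilon> > 0\<close>] by blast
    have "(\<Sum>e\<in>F. (cmod (hinner H (y k) e))\<^sup>2) \<le> \<epsilon>\<^sup>2" if k: "k \<ge> N" and F: "finite F" "F \<subseteq> E" for k F
    proof (rule LIMSEQ_le_const2)
      have "(\<lambda>l. hinner H (y l) e) \<longlonglongrightarrow> 0" if "e \<in> F" for e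
      proof -
        have "(\<lambda>l. cnj (hinner H e (y l))) \<longlonglongrightarrow> cnj 0"
          using that F E by (intro tendsto_cnj) (auto simp: S_def)
        moreover have "hinner H (y l) e = cnj (hinner H e (y l))" for l
          using inner_commute[OF yc ec] that F by blast
        ultimately show ?thesis by (simp only: complex_cnj_zero)
      qed
      then have "(\<lambda>l. \<Sum>e\<in>F. (cmod (hinner H (y k) e - hinner H (y l) e))\<^sup>2)
          \<longlonglongrightarrow> (\<Sum>e\<in>F. (cmod (hinner H (y k) e - 0))\<^sup>2)"
        by (intro tendsto_intros) auto
      moreover have "(\<Sum>e\<in>F. (cmod (hinner H (y k) e - hinner H (y l) e))\<^sup>2) =
          (\<Sum>e\<in>F. (cmod (hinner H (y k - y l) e))\<^sup>2)" for l
        using F ec by (intro sum.cong) (auto simp: inner_diff_left subset_iff)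
      ultimately show "(\<lambda>l. \<Sum>e\<in>F. (cmod (hinner H (y k - y l) e))\<^sup>2)
          \<longlonglongrightarrow> (\<Sum>e\<in>F. (cmod (hinner H (y k) e))\<^sup>2)" by simp
      show "\<exists>N. \<forall>l\<ge>N. (\<Sum>e\<in>F. (cmod (hinner H (y k - y l) e))\<^sup>2) \<le> \<epsilon>\<^sup>2"
      proof (intro exI allI impI)
        fix l assume "l \<ge> N"
        have "(\<Sum>e\<in>F. (cmod (hinner H (y k - y l) e))\<^sup>2) \<le> (hnorm H (y k - y l))\<^sup>2"
          using Bessel_finite[OF orthonormal_subset[OF E(2) F(2)] F(1)] by simp
        also have "\<dots> \<le> \<epsilon>\<^sup>2" using N[OF k \<open>l \<ge> N\<close>] by (intro power_mono) auto
        finally show "(\<Sum>e\<in>F. (cmod (hinner H (y k - y l) e))\<^sup>2) \<le> \<epsilon>\<^sup>2" .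
      qed
    qed
    then show ?thesis by blast
  qed
  show thesis
  proof (cases "orthonormal_basis H E")
    \<comment> \<open>If the system in the kernel is already a basis, \<open>small\<close> and
      Parseval's identity bound the whole norm, and the limit is 0.\<close>
    case True
    have "(\<lambda>k. hnorm H (y k - 0)) \<longlonglongrightarrow> 0"
    proof (rule LIMSEQ_I)
      fix r :: real assume "r > 0"
      then have "r / 2 > 0" by simp
      from small[OF this] obtain N where N: "\<And>k F. k \<ge> N \<Longrightarrow> finite F \<Longrightarrow> F \<subseteq> E \<Longrightarrow>
          (\<Sum>e\<in>F. (cmod (hinner H (y k) e))\<^sup>2) \<le> (r / 2)\<^sup>2"
        by blast
      have "norm (hnorm H (y k - 0) - 0) < r" if "k \<ge> N" for k
      proof -
        have "(hnorm H (y k))\<^sup>2 \<le> (r / 2)\<^sup>2"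
        proof (rule has_sum_le_finite_sums)
          show "((\<lambda>e. (cmod (hinner H (y k) e))\<^sup>2) has_sum (hnorm H (y k))\<^sup>2) E"
            using Parseval_range_norm[OF True z[of k]] by (simp only: y)
        qed (use N[OF that] in blast)
        then have "hnorm H (y k) \<le> r / 2" by (rule power2_le_imp_le) (use \<open>r > 0\<close> in simp)
        then show ?thesis using \<open>r > 0\<close> by simp
      qed
      then show "\<exists>N. \<forall>k\<ge>N. norm (hnorm H (y k - 0) - 0) < r" by blast
    qed
    then show thesis using that[of 0] by simp
  next
    case False
    then obtain v where v: "v \<in> hcarrier H" "v \<noteq> 0" "\<And>e. e \<in> E \<Longrightarrow> hinner H v e = 0"
      using E by (auto simp: orthonormal_basis_iff)
    define x where "x = hscale H (complex_of_real (inverse (hnorm H v))) v"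
    have xc [simp]: "x \<in> hcarrier H" using v by (simp add: x_def)
    have nx: "hnorm H x = 1" unfolding x_def by (rule normalize[OF v(1,2)])
    have xe: "hinner H x e = 0" if "e \<in> E" for e
      using v ec that by (simp add: x_def inner_scale_left)
    obtain c where c: "(\<lambda>k. hinner H x (y k)) \<longlonglongrightarrow> c" using conv xc by blast
    have xS: "x \<notin> S" using Emax[OF _ xe] nx hnorm_zero by (metis zero_neq_one)
    then have c0: "c \<noteq> 0" using c xc unfolding S_def by blast
    have ox: "orthonormal {x}" using orthonormal_insert[of "{}" x] nx by (simp add: orthonormal_def)
    have basis: "orthonormal_basis H (insert x E)"
      unfolding orthonormal_basis_iff
    proof (intro conjI ballI impI orthonormal_insert E xc nx xe)
      fix u assume u: "u \<in> hcarrier H" and ort: "\<forall>e\<in>insert x E. hinner H u e = 0"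
      \<comment> \<open>Subtracting \<open>d / c\<close> times \<open>x\<close> brings
        \<open>u\<close> into the kernel \<open>S\<close> and keeps it orthogonal to
        \<open>E\<close>, so maximality of \<open>E\<close> makes the difference vanish.\<close>
      obtain d where d: "(\<lambda>k. hinner H u (y k)) \<longlonglongrightarrow> d" using conv u by blast
      have "(\<lambda>k. hinner H u (y k) - d / c * hinner H x (y k)) \<longlonglongrightarrow> d - d / c * c"
        by (intro tendsto_intros c d)
      then have "u - hscale H (d / c) x \<in> S"
        using u c0 by (simp add: S_def inner_diff_left inner_scale_left)
      moreover have "hinner H (u - hscale H (d / c) x) e = 0" if "e \<in> E" for e
        using that u ort xe ec by (simp add: inner_diff_left inner_scale_left)
      ultimately have "u - hscale H (d / c) x = 0" using Emax by blast
      then have "u = hscale H (d / c) x" by simp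
      moreover from this have "hinner H u x = d / c" using nx inner_same[of x] by (simp add: inner_scale_left)
      ultimately show "u = 0" using ort by simp
    qed
    \<comment> \<open>The coordinate of \<open>y k\<close> along \<open>x\<close>. By
      \<open>small\<close> and Parseval's identity in the basis \<open>insert x E\<close>,
      \<open>y k\<close> comes close to \<open>hscale H (w k) x\<close>, and \<open>w\<close>
      converges.\<close>
    define w where "w k = hinner H (y k) x" for k
    have w: "w \<longlonglongrightarrow> cnj c"
    proof -
      have "w = (\<lambda>k. cnj (hinner H x (y k)))" using inner_commute[OF yc xc] by (auto simp: w_def)
      then show ?thesis using c by (auto intro: tendsto_cnj)
    qed
    have "(\<lambda>k. hnorm H (y k - hscale H (w k) x)) \<longlonglongrightarrow> 0"
    proof (rule LIMSEQ_I)
      fix r :: real assume "r > 0"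
      then have "r / 2 > 0" by simp
      from small[OF this] obtain N where N: "\<And>k F. k \<ge> N \<Longrightarrow> finite F \<Longrightarrow> F \<subseteq> E \<Longrightarrow>
          (\<Sum>e\<in>F. (cmod (hinner H (y k) e))\<^sup>2) \<le> (r / 2)\<^sup>2"
        by blast
      have "norm (hnorm H (y k - hscale H (w k) x) - 0) < r" if "k \<ge> N" for k
      proof -
        have "x \<notin> E" using xS E by blast
        have "(hnorm H (y k))\<^sup>2 \<le> (cmod (w k))\<^sup>2 + (r / 2)\<^sup>2"
        proof (rule has_sum_le_finite_sums)
          show "((\<lambda>e. (cmod (hinner H (y k) e))\<^sup>2) has_sum (hnorm H (y k))\<^sup>2) (insert x E)"
            using Parseval_range_norm[OF basis z[of k]] by (simp only: y)
          fix F assume F: "finite F" "F \<subseteq> insert x E"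
          have "(\<Sum>e\<in>F. (cmod (hinner H (y k) e))\<^sup>2) \<le> (\<Sum>e\<in>insert x (F - {x}). (cmod (hinner H (y k) e))\<^sup>2)"
            using F by (intro sum_mono2) auto
          also have "\<dots> \<le> (cmod (w k))\<^sup>2 + (r / 2)\<^sup>2"
            using N[OF that, of "F - {x}"] F by (subst sum.insert) (auto simp: w_def)
          finally show "(\<Sum>e\<in>F. (cmod (hinner H (y k) e))\<^sup>2) \<le> (cmod (w k))\<^sup>2 + (r / 2)\<^sup>2" .
        qed
        then have "(hnorm H (y k - hscale H (w k) x))\<^sup>2 \<le> (r / 2)\<^sup>2"
          using hnorm_residual_sq[OF ox, of "y k"] by (simp add: proj_def w_def)
        then have "hnorm H (y k - hscale H (w k) x) \<le> r / 2" by (rule power2_le_imp_le) (use \<open>r > 0\<close> in simp)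
        then show ?thesis using \<open>r > 0\<close> by simp
      qed
      then show "\<exists>N. \<forall>k\<ge>N. norm (hnorm H (y k - hscale H (w k) x) - 0) < r" by blast
    qed
    moreover have "(\<lambda>k. cmod (w k - cnj c)) \<longlonglongrightarrow> 0"
      using w by (simp add: tendsto_norm_zero LIM_zero)
    ultimately have lim: "(\<lambda>k. hnorm H (y k - hscale H (w k) x) + cmod (w k - cnj c)) \<longlonglongrightarrow> 0 + 0"
      by (rule tendsto_add)
    have "hnorm H (y k - hscale H (cnj c) x) \<le> hnorm H (y k - hscale H (w k) x) + cmod (w k - cnj c)" for k
    proof -
      have "hnorm H (hscale H (w k) x - hscale H (cnj c) x) = cmod (w k - cnj c)"
        using nx by (simp add: hnorm_scale flip: scale_left_diff_distrib)
      then show ?thesis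
        using hnorm_triangle[of "y k - hscale H (w k) x" "hscale H (w k) x - hscale H (cnj c) x"] by simp
    qed
    then have "(\<lambda>k. hnorm H (y k - hscale H (cnj c) x)) \<longlonglongrightarrow> 0"
      by (intro Lim_null_comparison[OF _ lim[simplified]]) auto
    then show thesis using that[of "hscale H (cnj c) x"] by simp
  qed
qed

end

section \<open>The spectral theorem\<close>

context selfadjoint_operator
begin

lemma eigenvalue_pow:
  assumes "x \<in> hcarrier H" "T x = hscale H c x"
  shows "(T ^^ n) x = hscale H (c ^ n) x"
  using assms by (induction n) (simp_all add: op_simps mult.commute)

text \<open>Move one factor \<open>T\<close> across the inner product and apply the Cauchy-Schwarz
  inequality.\<close>

lemma pow_log_convex:
  assumes x: "x \<in> hcarrier H"
  shows "(hnorm H ((T ^^ Suc n) x))\<^sup>2 \<le> hnorm H ((T ^^ n) x) * hnorm H ((T ^^ Suc (Suc n)) x)"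
proof -
  have "hinner H ((T ^^ n) x) ((T ^^ Suc (Suc n)) x) = hinner H ((T ^^ Suc n) x) ((T ^^ Suc n) x)"
    using x by (simp add: op_simps)
  also have "\<dots> = complex_of_real ((hnorm H ((T ^^ Suc n) x))\<^sup>2)"
    by (rule inner_same) (use x in \<open>simp add: op_simps\<close>)
  finally have "cmod (hinner H ((T ^^ n) x) ((T ^^ Suc (Suc n)) x)) = (hnorm H ((T ^^ Suc n) x))\<^sup>2"
    by (simp only: norm_of_real abs_power2)
  then show ?thesis
    using Cauchy_Schwarz[OF pow_carrier[OF x] pow_carrier[OF x], of n "Suc (Suc n)"] by simp
qed

text \<open>By \<open>pow_log_convex\<close> the quotients of consecutive norms never decrease, and
  the first one is \<open>hnorm H (T x)\<close>. A nearly maximal \<open>hnorm H (T x)\<close>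
  therefore stays visible in all powers.\<close>

lemma hnorm_pow_ge:
  assumes x: "x \<in> hcarrier H" "hnorm H x = 1"
  shows "(hnorm H (T x)) ^ n \<le> hnorm H ((T ^^ n) x)"
proof (cases "hnorm H (T x) = 0")
  case True
  then show ?thesis using x by (cases n) (auto simp: op_simps)
next
  case False
  define r where "r = hnorm H (T x)"
  define c where "c n = hnorm H ((T ^^ n) x)" for n
  have r: "r > 0" using False hnorm_nonneg[OF op_simps(1)[OF x(1)]] by (simp add: r_def)
  have conv: "(c (Suc n))\<^sup>2 \<le> c n * c (Suc (Suc n))" for n
    unfolding c_def by (rule pow_log_convex[OF x(1)])
  \<comment> \<open>Positivity is carried along in the induction because the quotient argument
    divides by \<open>c n\<close>.\<close>
  have step: "c n > 0 \<and> r * c n \<le> c (Suc n)" for n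
  proof (induction n)
    case 0
    then show ?case using x by (simp add: c_def r_def)
  next
    case (Suc n)
    then have pos: "c n > 0" "c (Suc n) > 0" using r by (auto intro: less_le_trans[OF mult_pos_pos])
    have "r * c (Suc n) * c n \<le> c (Suc n) * c (Suc n)"
      using Suc pos mult_right_mono[of "r * c n" "c (Suc n)" "c (Suc n)"] by (simp add: mult_ac)
    also have "\<dots> \<le> c (Suc (Suc n)) * c n" using conv[of n] by (simp add: power2_eq_square mult.commute)
    finally show ?case using pos by simp
  qed
  have "r ^ n \<le> c n"
  proof (induction n)
    case 0
    then show ?case using x by (simp add: c_def)
  next
    case (Suc n)
    then show ?case using step[of n] r mult_left_mono[of "r ^ n" "c n" r] by (simp; linarith)
  qed
  then show ?thesis by (simp add: r_def c_def)
qed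

end

section \<open>Existence of eigenvectors\<close>

context finite_trace_operator
begin

text \<open>
  Let \<open>\<nu>\<close> be the norm of \<open>T\<close> on the orthogonal complement of \<open>F\<close> and \<open>C = T / \<nu>\<close>.  Since \<open>\<parallel>C\<^sup>n x\<parallel>\<close>
  decreases, \<open>C\<^sup>2\<^sup>n x\<close> is a Cauchy sequence, whose limit is fixed by \<open>C\<^sup>2\<close>.  If all limits vanished,
  the finiteness of the trace would make \<open>\<parallel>C\<^sup>n\<parallel>\<close> tend to 0, whereas \<open>\<parallel>C\<^sup>n\<parallel> = 1\<close> by logarithmic convexity.
\<close>

lemma eigenvector_orthogonal:
  assumes F: "orthonormal F" and eig: "\<And>f. f \<in> F \<Longrightarrow> \<exists>c. T f = hscale H (complex_of_real c) f"
    and x0: "x0 \<in> hcarrier H" "\<And>f. f \<in> F \<Longrightarrow> hinner H x0 f = 0" "T x0 \<noteq> 0"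
  obtains y c where "y \<in> hcarrier H" "y \<noteq> 0" "\<And>f. f \<in> F \<Longrightarrow> hinner H y f = 0"
    "T y = hscale H (complex_of_real c) y"
proof -
  define M where "M = {x \<in> hcarrier H. \<forall>f\<in>F. hinner H x f = 0}"
  have Mc: "x \<in> hcarrier H" if "x \<in> M" for x using that by (simp add: M_def)
  have fc: "f \<in> hcarrier H" if "f \<in> F" for f using orthonormalD(1)[OF F that] .
  have M_scale: "hscale H c x \<in> M" if "x \<in> M" for c x
    using that fc by (auto simp: M_def inner_scale_left)
  have M_add: "x + y \<in> M" if "x \<in> M" "y \<in> M" for x y
    using that fc by (auto simp: M_def inner_add_left)
  have M_diff: "x - y \<in> M" if "x \<in> M" "y \<in> M" for x y
    using that fc by (auto simp: M_def inner_diff_left)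
  have M_zero: "0 \<in> M" using fc by (simp add: M_def)
  \<comment> \<open>The complement \<open>M\<close> of \<open>F\<close> is invariant because
    \<open>F\<close> consists of eigenvectors, so the search for a new eigenvector can stay inside
    \<open>M\<close>.\<close>
  have M_T: "T x \<in> M" if "x \<in> M" for x
  proof -
    have "hinner H (T x) f = 0" if f: "f \<in> F" for f
    proof -
      obtain c where "T f = hscale H (complex_of_real c) f" using eig[OF f] by blast
      then show ?thesis using \<open>x \<in> M\<close> f fc[OF f] by (simp add: M_def op_simps inner_scale_right)
    qed
    then show ?thesis using that by (simp add: M_def op_simps)
  qed
  have M_pow: "(T ^^ n) x \<in> M" if "x \<in> M" for n x using that by (induction n) (auto intro: M_T)
  have x0M: "x0 \<in> M" using x0 by (simp add: M_def)
  obtain B where B: "B > 0" "\<And>x. x \<in> hcarrier H \<Longrightarrow> hnorm H (T x) \<le> B * hnorm H x"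
    using op_bounded by blast
  define A where "A = (\<lambda>x. hnorm H (T x)) ` {x \<in> M. hnorm H x = 1}"
  define \<nu> where "\<nu> = Sup A"
  have bdd: "bdd_above A"
    by (rule bdd_aboveI[of _ B]) (use B(2) Mc in \<open>force simp: A_def\<close>)
  have ub: "hnorm H (T x) \<le> \<nu> * hnorm H x" if "x \<in> M" for x
  proof (cases "x = 0")
    case True
    then show ?thesis using pow_zero[of 1] by simp
  next
    case False
    define u where "u = hscale H (complex_of_real (inverse (hnorm H x))) x"
    have "hnorm H u = 1" unfolding u_def by (rule normalize[OF Mc[OF that] False])
    then have "hnorm H (T u) \<in> A" using that by (auto simp: A_def u_def intro: M_scale)
    then have "hnorm H (T u) \<le> \<nu>" unfolding \<nu>_def using bdd by (rule cSup_upper)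
    moreover have "hnorm H (T u) = inverse (hnorm H x) * hnorm H (T x)"
      using Mc[OF that] by (simp add: u_def op_simps hnorm_scale norm_inverse)
    ultimately show ?thesis using hnorm_pos[OF Mc[OF that] False] by (simp add: field_simps)
  qed
  have "hnorm H (T x0) > 0" using x0 by (intro hnorm_pos) (auto simp: op_simps)
  then have "\<nu> * hnorm H x0 > 0" using ub[OF x0M] by linarith
  then have \<nu>: "\<nu> > 0" using hnorm_nonneg[OF x0(1)] by (auto simp: zero_less_mult_iff)
  have x0n: "x0 \<noteq> 0" using x0(3) pow_zero[of 1] by auto
  have "hscale H (complex_of_real (inverse (hnorm H x0))) x0 \<in> {x \<in> M. hnorm H x = 1}"
    using M_scale[OF x0M] normalize[OF x0(1) x0n] by simp
  then have "A \<noteq> {}" unfolding A_def by blast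
  then have lb: "\<exists>x\<in>M. hnorm H x = 1 \<and> r < hnorm H (T x)" if "r < \<nu>" for r
    using less_cSup_iff[OF _ bdd, of r] that by (auto simp: \<nu>_def A_def)

  \<comment> \<open>The length of the n-th iterate of \<open>x\<close> under \<open>T\<close>
    divided by \<open>\<nu>\<close>; on \<open>M\<close> it cannot increase with
    \<open>n\<close>.\<close>
  define a where "a n x = hnorm H ((T ^^ n) x) / \<nu> ^ n" for n x
  have a_nonneg: "a n x \<ge> 0" if "x \<in> M" for n x using Mc[OF that] \<nu> by (simp add: a_def)
  have a_step: "a (Suc n) x \<le> a n x" if "x \<in> M" for n x
    using ub[OF M_pow[OF that, of n]] \<nu> by (simp add: a_def field_simps)
  have a_dec: "decseq (\<lambda>n. a n x)" if "x \<in> M" for x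
    using a_step[OF that] by (simp add: decseq_Suc_iff)
  show thesis
  proof (cases "\<forall>x\<in>M. (\<lambda>n. a n x) \<longlonglongrightarrow> 0")
    case False
    then obtain x where xM: "x \<in> M" and nz: "\<not> (\<lambda>n. a n x) \<longlonglongrightarrow> 0" by blast
    have x [simp]: "x \<in> hcarrier H" using Mc[OF xM] .
    obtain L where L: "(\<lambda>n. a n x) \<longlonglongrightarrow> L"
      using decseq_convergent[OF a_dec[OF xM], of 0] a_nonneg[OF xM] by blast
    then have L0: "L \<noteq> 0" using nz by blast
    \<comment> \<open>Even powers only: the inner product of \<open>y k\<close> and
      \<open>y l\<close> is then the square of \<open>a (k + l) x\<close>, so all distances are
      expressed through the convergent sequence \<open>a\<close>.\<close>
    define y where "y k = hscale H (complex_of_real (inverse \<nu> ^ (2 * k))) ((T ^^ (2 * k)) x)" for k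
    have yc [simp]: "y k \<in> hcarrier H" for k by (simp add: y_def)
    have yM: "y k \<in> M" for k using M_scale M_pow xM by (simp add: y_def)
    have yin: "hinner H (y k) (y l) = complex_of_real ((a (k + l) x)\<^sup>2)" for k l
    proof -
      have "hinner H ((T ^^ (2 * k)) x) ((T ^^ (2 * l)) x) = hinner H ((T ^^ (2 * (k + l))) x) x"
        using pow_inner_split[of x x "2 * l" "2 * k"] by (simp add: add.commute)
      also have "\<dots> = complex_of_real ((hnorm H ((T ^^ (k + l)) x))\<^sup>2)" by (rule inner_pow_double) simp
      finally have "hinner H (y k) (y l) = complex_of_real
          (inverse \<nu> ^ (2 * k) * (inverse \<nu> ^ (2 * l) * (hnorm H ((T ^^ (k + l)) x))\<^sup>2))"
        by (simp add: y_def inner_scale_left inner_scale_right)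
      also have "inverse \<nu> ^ (2 * k) * (inverse \<nu> ^ (2 * l) * (hnorm H ((T ^^ (k + l)) x))\<^sup>2) = (a (k + l) x)\<^sup>2"
        using \<nu> by (simp add: a_def power_divide power_mult[symmetric] power_inverse field_simps flip: power_add)
      finally show ?thesis .
    qed
    have ynorm: "hnorm H (y k) = a (2 * k) x" for k
      using yin[of k k] a_nonneg[OF xM] by (simp add: hnorm_def mult_2)
    have ydiff: "(hnorm H (y k - y l))\<^sup>2 = (a (2 * k) x)\<^sup>2 - 2 * (a (k + l) x)\<^sup>2 + (a (2 * l) x)\<^sup>2" for k l
      using hnorm_diff_sq[of "y k" "y l"] by (simp add: yin ynorm)
    \<comment> \<open>The shift by \<open>m\<close> puts the sequence in the range of
      \<open>T ^^ m\<close>, where Cauchy sequences converge. The three terms of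
      \<open>ydiff\<close> have weights 1, 2 and 1, hence the tolerance
      \<open>\<epsilon>\<^sup>2 / 4\<close>.\<close>
    have "\<exists>N. \<forall>k\<ge>N. \<forall>l\<ge>N. hnorm H (y (k + m) - y (l + m)) < \<epsilon>" if "\<epsilon> > 0" for \<epsilon> :: real
    proof -
      have "(\<lambda>n. (a n x)\<^sup>2) \<longlonglongrightarrow> L\<^sup>2" using L by (intro tendsto_intros)
      moreover have "\<epsilon>\<^sup>2 / 4 > 0" using that by simp
      ultimately obtain N where N: "\<And>n. n \<ge> N \<Longrightarrow> \<bar>(a n x)\<^sup>2 - L\<^sup>2\<bar> < \<epsilon>\<^sup>2 / 4"
        unfolding LIMSEQ_iff real_norm_def by meson
      have "hnorm H (y (k + m) - y (l + m)) < \<epsilon>" if "k \<ge> N" "l \<ge> N" for k l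
      proof (rule power2_less_imp_less)
        have "2 * (k + m) \<ge> N" "k + m + (l + m) \<ge> N" "2 * (l + m) \<ge> N" using that by auto
        then show "(hnorm H (y (k + m) - y (l + m)))\<^sup>2 < \<epsilon>\<^sup>2"
          unfolding ydiff using N[of "2 * (k + m)"] N[of "k + m + (l + m)"] N[of "2 * (l + m)"] by argo
      qed (use \<open>\<epsilon> > 0\<close> in simp)
      then show ?thesis by blast
    qed
    moreover have "y (k + m) = (T ^^ m) (hscale H (complex_of_real (inverse \<nu> ^ (2 * (k + m)))) ((T ^^ (2 * k + m)) x))" for k
    proof -
      have "2 * (k + m) = m + (2 * k + m)" by simp
      then show ?thesis unfolding y_def by (simp only: pow_scale pow_carrier x funpow_add o_apply)
    qed
    moreover have "hscale H (complex_of_real (inverse \<nu> ^ (2 * (k + m)))) ((T ^^ (2 * k + m)) x) \<in> hcarrier H" for k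
      by simp
    ultimately obtain v where v: "v \<in> hcarrier H" "(\<lambda>k. hnorm H (y (k + m) - v)) \<longlonglongrightarrow> 0"
      using range_Cauchy_convergent[of "\<lambda>k. hscale H (complex_of_real (inverse \<nu> ^ (2 * (k + m)))) ((T ^^ (2 * k + m)) x)"
          "\<lambda>k. y (k + m)"] by blast
    have v_lim: "(\<lambda>k. hnorm H (y (k + Suc m) - v)) \<longlonglongrightarrow> 0"
      using LIMSEQ_Suc[OF v(2)] by simp
    have v0: "v \<noteq> 0"
    proof
      assume "v = 0"
      have "strict_mono (\<lambda>k. 2 * (k + m))" by (simp add: strict_mono_def)
      from LIMSEQ_subseq_LIMSEQ[OF L this] have "(\<lambda>k. a (2 * (k + m)) x) \<longlonglongrightarrow> L" by (simp add: o_def)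
      then show False using v(2) L0 LIMSEQ_unique \<open>v = 0\<close> by (auto simp: ynorm)
    qed
    have vM: "v \<in> M"
      unfolding M_def
    proof (intro CollectI conjI v(1) ballI)
      fix f assume f: "f \<in> F"
      have "norm (hinner H v f) \<le> hnorm H (y (k + m) - v)" for k
      proof -
        have "hinner H v f = - hinner H (y (k + m) - v) f"
          using yM[of "k + m"] f v(1) fc[OF f] by (simp add: M_def inner_diff_left)
        then show ?thesis
          using Cauchy_Schwarz[of "y (k + m) - v" f] v(1) fc[OF f] orthonormalD(4)[OF F f] by simp
      qed
      then have "norm (hinner H v f) \<le> 0"
        by (intro LIMSEQ_le_const[OF v(2)]) blast
      then show "hinner H v f = 0" by simp
    qed
    have TT: "T (T v) = hscale H (complex_of_real (\<nu>\<^sup>2)) v"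
    proof -
      let ?d = "T (T v) - hscale H (complex_of_real (\<nu>\<^sup>2)) v"
      have dc: "?d \<in> hcarrier H" using v(1) by (simp add: op_simps)
      have bound: "hnorm H ?d \<le> B * (B * hnorm H (y (k + m) - v)) + \<nu>\<^sup>2 * hnorm H (y (k + Suc m) - v)" for k
      proof -
        let ?y = "y (k + m)" and ?y' = "y (k + Suc m)"
        have yy: "T (T ?y) = hscale H (complex_of_real (\<nu>\<^sup>2)) ?y'"
        proof -
          have "(T ^^ (2 * (k + Suc m))) x = T (T ((T ^^ (2 * (k + m))) x))" by simp
          moreover have "\<nu>\<^sup>2 * inverse \<nu> ^ (2 * (k + Suc m)) = inverse \<nu> ^ (2 * (k + m))"
            using \<nu> by (simp add: power2_eq_square power_inverse field_simps)
          then have "complex_of_real (\<nu>\<^sup>2) * complex_of_real (inverse \<nu> ^ (2 * (k + Suc m))) =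
              complex_of_real (inverse \<nu> ^ (2 * (k + m)))" by (simp only: flip: of_real_mult)
          ultimately show ?thesis
            unfolding y_def by (simp only: op_simps pow_carrier x scale_scale)
        qed
        have "?d = T (T (v - ?y)) + hscale H (complex_of_real (\<nu>\<^sup>2)) (?y' - v)"
          using v(1) pow_diff[of v ?y 2] by (simp add: scale_right_diff_distrib numeral_2_eq_2 yy)
        then have "hnorm H ?d \<le> hnorm H (T (T (v - ?y))) + \<nu>\<^sup>2 * hnorm H (?y' - v)"
          using hnorm_triangle[of "T (T (v - ?y))" "hscale H (complex_of_real (\<nu>\<^sup>2)) (?y' - v)"] v(1)
          by (simp add: op_simps hnorm_scale norm_power)
        also have "hnorm H (T (T (v - ?y))) \<le> B * hnorm H (T (v - ?y))"
          using v(1) by (intro B) (simp add: op_simps)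
        also have "hnorm H (T (v - ?y)) \<le> B * hnorm H (?y - v)"
          using B(2)[of "v - ?y"] v(1) hnorm_diff_commute[of v ?y] by simp
        finally show ?thesis using B(1) by simp
      qed
      have "(\<lambda>k. B * (B * hnorm H (y (k + m) - v)) + \<nu>\<^sup>2 * hnorm H (y (k + Suc m) - v)) \<longlonglongrightarrow> B * (B * 0) + \<nu>\<^sup>2 * 0"
        by (intro tendsto_intros v(2) v_lim)
      then have "hnorm H ?d \<le> B * (B * 0) + \<nu>\<^sup>2 * 0"
        by (rule LIMSEQ_le_const) (use bound in blast)
      then have "hnorm H ?d = 0" using hnorm_nonneg[OF dc] by simp
      then show ?thesis using hnorm_eq_0[OF dc] by simp
    qed
    \<comment> \<open>By \<open>TT\<close>, \<open>T - \<nu>\<close> and \<open>T + \<nu>\<close>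
      compose to 0 on \<open>v\<close>: either \<open>T + \<nu>\<close> kills \<open>v\<close>,
      which then has eigenvalue \<open>- \<nu>\<close>, or the image \<open>u\<close> is an
      eigenvector for \<open>\<nu>\<close>.\<close>
    define u where "u = T v + hscale H (complex_of_real \<nu>) v"
    have uM: "u \<in> M" using vM by (simp add: u_def M_add M_T M_scale)
    show thesis
    proof (cases "u = 0")
      case True
      then have "T v = hscale H (complex_of_real (- \<nu>)) v"
        by (simp add: u_def add_eq_0_iff2 scale_minus_left)
      then show thesis using that[of v "- \<nu>"] v0 vM by (simp add: M_def)
    next
      case False
      have "T u = hscale H (complex_of_real \<nu>) u"
        using v(1) by (simp add: u_def op_simps TT scale_right_distrib power2_eq_square add.commute)
      then show thesis using that[of u \<nu>] False uM by (simp add: M_def)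
    qed
  next
    case True
    obtain E where E: "F \<subseteq> E" "orthonormal_basis H E" using orthonormal_basis_extension[OF F] .
    have oE: "orthonormal E" using E by (simp add: orthonormal_basis_iff)
    \<comment> \<open>Chosen so that the residual \<open>r\<close> of a unit vector outside
      \<open>F0\<close> has \<open>a m r\<close> at most 1/4, and by monotonicity also
      \<open>a n r\<close> for later \<open>n\<close>.\<close>
    define \<delta> where "\<delta> = (\<nu> ^ m / 4)\<^sup>2"
    have "\<delta> > 0" using \<nu> by (simp add: \<delta>_def)
    then obtain F0 where F0: "finite F0" "F0 \<subseteq> E" "Re t - (\<Sum>e\<in>F0. (hnorm H ((T ^^ m) e))\<^sup>2) \<le> \<delta>"
    proof -
      have "\<forall>\<^sub>F X in finite_subsets_at_top E. dist (\<Sum>e\<in>X. (hnorm H ((T ^^ m) e))\<^sup>2) (Re t) < \<delta>"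
        using hilbert_schmidt[OF E(2)] \<open>\<delta> > 0\<close> unfolding has_sum_def tendsto_iff by blast
      then obtain X where "finite X" "X \<subseteq> E" "dist (\<Sum>e\<in>X. (hnorm H ((T ^^ m) e))\<^sup>2) (Re t) < \<delta>"
        unfolding eventually_finite_subsets_at_top by blast
      then show thesis by (intro that[of X]) (auto simp: dist_real_def)
    qed
    have oF0: "orthonormal F0" using orthonormal_subset[OF oE F0(2)] .
    \<comment> \<open>Vectors of \<open>M\<close> have no coordinates along \<open>F\<close>, so
      only these members of \<open>F0\<close> matter; they lie in \<open>M\<close>, where the case
      assumption makes \<open>a n g\<close> tend to 0.\<close>
    define G where "G = F0 - F"
    have oG: "orthonormal G" "finite G" using orthonormal_subset[OF oF0] F0(1) by (auto simp: G_def)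
    have GM: "g \<in> M" if g: "g \<in> G" for g
      unfolding M_def
    proof (intro CollectI conjI ballI)
      have gE: "g \<in> E" "g \<notin> F" using g F0(2) by (auto simp: G_def)
      then show "g \<in> hcarrier H" using orthonormalD(1)[OF oE] by blast
      fix f assume "f \<in> F"
      then show "hinner H g f = 0" using orthonormalD(3)[OF oE gE(1), of f] gE(2) E(1) by blast
    qed
    have "(\<lambda>n. \<Sum>g\<in>G. a n g) \<longlonglongrightarrow> (\<Sum>g\<in>G. 0)"
      using True GM by (intro tendsto_sum) auto
    then have "(\<lambda>n. \<Sum>g\<in>G. a n g) \<longlonglongrightarrow> 0" by simp
    then have "\<forall>\<^sub>F n in sequentially. (\<Sum>g\<in>G. a n g) < 1/4" by (rule order_tendstoD) simp
    then have "\<forall>\<^sub>F n in sequentially. (\<Sum>g\<in>G. a n g) < 1/4 \<and> n \<ge> Suc m"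
      by (intro eventually_conj eventually_ge_at_top)
    then obtain n where n: "(\<Sum>g\<in>G. a n g) < 1/4" "n \<ge> Suc m"
      using eventually_happens'[OF sequentially_bot] by blast
    \<comment> \<open>The residual outside \<open>F0\<close> and the finitely many coordinates in
      \<open>G\<close> contribute at most 1/4 each.\<close>
    have half: "a n x \<le> 1/2" if xM: "x \<in> M" and nx: "hnorm H x = 1" for x
    proof -
      have x [simp]: "x \<in> hcarrier H" using Mc[OF xM] .
      define r where "r = x - proj F0 x"
      have "proj F0 x = proj G x"
        unfolding proj_def G_def using F0(1) xM
        by (intro sum.mono_neutral_right) (auto simp: M_def)
      then have xr: "x = r + (\<Sum>g\<in>G. hscale H (hinner H x g) g)" by (simp add: r_def proj_def)
      have sM: "proj G x \<in> M"
        unfolding proj_def using oG(2) GM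
        by (induction G rule: finite_induct) (auto intro: M_add M_scale M_zero)
      have rM: "r \<in> M" using M_diff[OF xM sM] \<open>proj F0 x = proj G x\<close> by (simp add: r_def)
      have rc [simp]: "r \<in> hcarrier H" using Mc[OF rM] .
      have gc: "g \<in> hcarrier H" if "g \<in> G" for g using Mc[OF GM[OF that]] .
      have "(hnorm H ((T ^^ m) r))\<^sup>2 \<le> (Re t - (\<Sum>e\<in>F0. (hnorm H ((T ^^ m) e))\<^sup>2)) * (hnorm H r)\<^sup>2"
        using residual_bound[OF oF0 F0(1) rc] residual_orthogonal[OF oF0 F0(1) _ x] unfolding r_def by blast
      also have "\<dots> \<le> \<delta> * 1"
        using F0(3) hilbert_schmidt_finite[OF oF0 F0(1)] hnorm_residual_le[OF oF0 F0(1) x] nx rc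
        unfolding r_def by (intro mult_mono power_le_one) (auto simp del: rc)
      finally have "(hnorm H ((T ^^ m) r))\<^sup>2 \<le> (\<nu> ^ m / 4)\<^sup>2" by (simp add: \<delta>_def)
      then have "hnorm H ((T ^^ m) r) \<le> \<nu> ^ m / 4" by (rule power2_le_imp_le) (use \<nu> in simp)
      then have "a m r \<le> 1/4" using \<nu> by (simp add: a_def field_simps)
      moreover have "a n r \<le> a m r" using decseqD[OF a_dec[OF rM]] n(2) by simp
      ultimately have ar: "a n r \<le> 1/4" by simp
      have tri: "hnorm H (\<Sum>g\<in>G'. hscale H (hinner H x g) ((T ^^ n) g)) \<le> (\<Sum>g\<in>G'. hnorm H ((T ^^ n) g))"
        if "G' \<subseteq> G" for G'
        using finite_subset[OF that oG(2)] that
      proof (induction G' rule: finite_induct)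
        case (insert g G')
        have g: "g \<in> hcarrier H" using insert gc by blast
        have "cmod (hinner H x g) \<le> 1"
          using Cauchy_Schwarz[OF x g] nx orthonormalD(4)[OF oG(1), of g] insert by simp
        then have "hnorm H (hscale H (hinner H x g) ((T ^^ n) g)) \<le> hnorm H ((T ^^ n) g)"
          using g by (simp add: hnorm_scale mult_left_le_one_le)
        moreover have "(\<Sum>g\<in>G'. hscale H (hinner H x g) ((T ^^ n) g)) \<in> hcarrier H"
          using insert gc by (intro carrier_sum) auto
        ultimately show ?case
          using insert g hnorm_triangle[of "hscale H (hinner H x g) ((T ^^ n) g)" "\<Sum>g\<in>G'. hscale H (hinner H x g) ((T ^^ n) g)"]
          by (simp)
      qed simp
      have "(T ^^ n) (\<Sum>g\<in>G. hscale H (hinner H x g) g) = (\<Sum>g\<in>G. hscale H (hinner H x g) ((T ^^ n) g))"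
        using gc by (subst pow_sum) (auto simp: pow_scale)
      moreover have "(\<Sum>g\<in>G. hscale H (hinner H x g) g) \<in> hcarrier H" using gc by (intro carrier_sum) auto
      ultimately have "(T ^^ n) x = (T ^^ n) r + (\<Sum>g\<in>G. hscale H (hinner H x g) ((T ^^ n) g))"
        by (subst xr) (simp add: pow_add)
      moreover have "(\<Sum>g\<in>G. hscale H (hinner H x g) ((T ^^ n) g)) \<in> hcarrier H"
        using gc by (intro carrier_sum) auto
      ultimately have "hnorm H ((T ^^ n) x) \<le> hnorm H ((T ^^ n) r) + (\<Sum>g\<in>G. hnorm H ((T ^^ n) g))"
        using hnorm_triangle[of "(T ^^ n) r" "\<Sum>g\<in>G. hscale H (hinner H x g) ((T ^^ n) g)"] tri[of G] by simp
      then have "a n x \<le> a n r + (\<Sum>g\<in>G. a n g)"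
        using \<nu> by (simp add: a_def divide_right_mono flip: sum_divide_distrib add_divide_distrib)
      then show ?thesis using ar n(1) by simp
    qed
    \<comment> \<open>Bernoulli's inequality gives \<open>s ^ n\<close> at least 3/4, so an almost
      maximal \<open>x\<close> keeps \<open>a n x\<close> at 3/4 or more, against the bound 1/2 in
      \<open>half\<close>.\<close>
    define s where "s = 1 - 1 / (4 * real n)"
    have s: "0 < s" "s < 1" using n(2) by (auto simp: s_def field_simps)
    obtain x where x: "x \<in> M" "hnorm H x = 1" "s * \<nu> < hnorm H (T x)"
      using lb[of "s * \<nu>"] s \<nu> by auto
    have "3/4 = 1 + real n * (- (1 / (4 * real n)))" using n(2) by (simp add: field_simps)
    also have "\<dots> \<le> (1 + (- (1 / (4 * real n)))) ^ n"
      using n(2) by (intro Bernoulli_inequality) (simp add: field_simps)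
    also have "\<dots> = s ^ n" by (simp add: s_def)
    finally have "3/4 * \<nu> ^ n \<le> (s * \<nu>) ^ n" using \<nu> by (simp add: power_mult_distrib)
    also have "\<dots> \<le> hnorm H (T x) ^ n" using x(3) s \<nu> by (intro power_mono) auto
    also have "\<dots> \<le> hnorm H ((T ^^ n) x)" using hnorm_pow_ge[OF Mc[OF x(1)] x(2)] .
    finally have "3/4 \<le> a n x" using \<nu> by (simp add: a_def field_simps)
    then show thesis using half[OF x(1,2)] by simp
  qed
qed

text \<open>Take a maximal orthonormal set of eigenvectors. A nonzero vector orthogonal to it either
  is killed by \<open>T\<close>, hence an eigenvector for 0, or makes
  \<open>eigenvector_orthogonal\<close> produce another eigenvector in the complement; both
  contradict maximality.\<close>

theorem spectral_theorem:
  obtains F \<mu> where "orthonormal_basis H F" "\<And>f. f \<in> F \<Longrightarrow> T f = hscale H (complex_of_real (\<mu> f)) f"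
proof -
  define S where "S = {x \<in> hcarrier H. \<exists>c. T x = hscale H (complex_of_real c) x}"
  have "orthonormal {}" "{} \<subseteq> S" "S \<subseteq> hcarrier H" by (auto simp: orthonormal_def S_def)
  moreover have "hscale H c x \<in> S" if "x \<in> S" for c x
    using that by (auto simp: S_def op_simps mult.commute)
  ultimately obtain F where F: "F \<subseteq> S" "orthonormal F"
    "\<And>x. x \<in> S \<Longrightarrow> (\<And>e. e \<in> F \<Longrightarrow> hinner H x e = 0) \<Longrightarrow> x = 0"
    using maximal_orthonormal[of "{}" S] by metis
  have eig: "\<exists>c. T f = hscale H (complex_of_real c) f" if "f \<in> F" for f using F(1) that by (auto simp: S_def)
  have "x = 0" if x: "x \<in> hcarrier H" "\<forall>e\<in>F. hinner H x e = 0" for x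
  proof (cases "T x = 0")
    case True
    then have "T x = hscale H (complex_of_real 0) x" by simp
    then have "x \<in> S" using x(1) unfolding S_def by blast
    then show ?thesis using F(3) x(2) by blast
  next
    case False
    obtain y c where y: "y \<in> hcarrier H" "y \<noteq> 0" "\<And>f. f \<in> F \<Longrightarrow> hinner H y f = 0"
        "T y = hscale H (complex_of_real c) y"
      using eigenvector_orthogonal[OF F(2) eig x(1) _ False] x(2) by blast
    then have "y \<in> S" by (auto simp: S_def)
    then show ?thesis using F(3)[OF _ y(3)] y(2) by blast
  qed
  then have "orthonormal_basis H F" using F(2) by (auto simp: orthonormal_basis_iff)
  moreover have "T f = hscale H (complex_of_real (SOME c. T f = hscale H (complex_of_real c) f)) f" if "f \<in> F" for f
    using someI_ex[OF eig[OF that]] .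
  ultimately show thesis by (rule that)
qed

end

section \<open>Multiplicities and traces\<close>

context inner_product_space
begin

text \<open>In the absence of an orthonormal basis every number would be a trace; extending the
  empty system provides one, and sums over it are unique.\<close>

lemma operator_trace_eq:
  assumes "has_trace H T t"
  shows "operator_trace H T = t"
proof -
  obtain E where "orthonormal_basis H E"
    using orthonormal_basis_extension[of "{}"] by (auto simp: orthonormal_def)
  then have "s = t" if "has_trace H T s" for s
    using assms that has_sum_unique unfolding has_trace_def by blast
  then show ?thesis unfolding operator_trace_def using assms by blast
qed

lemma orthonormal_independent:
  assumes "orthonormal F" "finite F"
  shows "independent F"
proof (rule independent_if_scalars_zero[OF assms(2)])
  fix u e assume u: "(\<Sum>x\<in>F. hscale H (u x) x) = 0" and e: "e \<in> F"
  have "hinner H (\<Sum>x\<in>F. hscale H (u x) x) e = (\<Sum>x\<in>F. u x * hinner H x e)"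
    using orthonormalD(1)[OF assms(1)] e by (subst inner_sum_left) (auto simp: inner_scale_left)
  also have "\<dots> = (\<Sum>x\<in>F. if x = e then u e else 0)"
    using assms e orthonormalD[OF assms(1)] by (intro sum.cong) auto
  also have "\<dots> = u e" using assms e by simp
  finally show "u e = 0" using u e orthonormalD(1)[OF assms(1) e] by simp
qed

end

context selfadjoint_operator
begin

text \<open>An eigenvector for \<open>s\<close> is orthogonal to the basis vectors with other
  eigenvalues, so its residual after projection onto those with eigenvalue \<open>s\<close> is
  orthogonal to the whole basis. Finiteness matters because \<open>dim\<close> and
  \<open>span\<close> are algebraic.\<close>

lemma eigenvalue_multiplicity_eq_card:
  assumes F: "orthonormal_basis H F" and eig: "\<And>f. f \<in> F \<Longrightarrow> T f = hscale H (complex_of_real (\<mu> f)) f"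
    and fin: "finite {f \<in> F. \<mu> f = s}"
  shows "eigenvalue_multiplicity H T s = card {f \<in> F. \<mu> f = s}"
  unfolding eigenvalue_multiplicity_def
proof (rule dim_unique)
  let ?B = "{f \<in> F. \<mu> f = s}"
  have oF: "orthonormal F" using F by (simp add: orthonormal_basis_iff)
  have oB: "orthonormal ?B" using orthonormal_subset[OF oF] by auto
  show "?B \<subseteq> eigenspace H T s" using eig orthonormalD(1)[OF oF] by (auto simp: eigenspace_def)
  show "independent ?B" using orthonormal_independent[OF oB fin] .
  show "eigenspace H T s \<subseteq> span ?B"
  proof
    fix x assume "x \<in> eigenspace H T s"
    then have x: "x \<in> hcarrier H" "T x = hscale H (complex_of_real s) x" by (auto simp: eigenspace_def)
    have "hinner H (x - proj ?B x) f = 0" if f: "f \<in> F" for f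
    proof (cases "\<mu> f = s")
      case True
      then show ?thesis using residual_orthogonal[OF oB fin _ x(1)] f by simp
    next
      case False
      have fc: "f \<in> hcarrier H" using orthonormalD(1)[OF oF f] .
      have "complex_of_real s * hinner H x f = hinner H (T x) f"
        using x fc by (simp add: inner_scale_left)
      also have "\<dots> = complex_of_real (\<mu> f) * hinner H x f"
        using x(1) fc eig[OF f] by (simp add: op_simps inner_scale_right)
      finally have "hinner H x f = 0" using False by simp
      moreover have "hinner H (proj ?B x) f = (\<Sum>e\<in>?B. 0)"
        unfolding inner_proj_left[OF oB fc]
        using orthonormalD(3)[OF oF _ f] False by (intro sum.cong) auto
      ultimately show ?thesis using x fc oB by (simp add: inner_diff_left)
    qed
    moreover have "x - proj ?B x \<in> hcarrier H" using x oB by simp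
    ultimately have "x - proj ?B x = 0" using F unfolding orthonormal_basis_def by blast
    then have "x = proj ?B x" by simp
    also have "\<dots> \<in> span ?B" unfolding proj_def by (intro span_sum span_scale span_base)
    finally show "x \<in> span ?B" .
  qed
qed simp

text \<open>A double sum of \<open>\<mu> f ^ n\<close> times the squared modulus of
  \<open>hinner H f e\<close> converges absolutely: summed over \<open>e\<close> first it gives the
  eigenvalue sum, over \<open>f\<close> first the diagonal of the power in the basis
  \<open>E\<close>. The expansions are assumptions because they have different sources: the finite
  trace for the given operators, the structure of \<open>l2\<close> for the limit.\<close>

lemma has_trace_pow:
  assumes F: "orthonormal_basis H F" and eig: "\<And>f. f \<in> F \<Longrightarrow> T f = hscale H (complex_of_real (\<mu> f)) f"
    and summable: "(\<lambda>f. \<bar>\<mu> f\<bar> ^ n) summable_on F"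
    and expansion: "\<And>x. x \<in> hcarrier H \<Longrightarrow>
      ((\<lambda>f. hinner H ((T ^^ n) x) f * hinner H f x) has_sum hinner H ((T ^^ n) x) x) F"
    and Parseval: "\<And>E f. orthonormal_basis H E \<Longrightarrow> f \<in> F \<Longrightarrow> \<mu> f ^ n \<noteq> 0 \<Longrightarrow>
      ((\<lambda>e. (cmod (hinner H f e))\<^sup>2) has_sum 1) E"
  shows "has_trace H (T ^^ n) (complex_of_real (\<Sum>\<^sub>\<infinity>f\<in>F. \<mu> f ^ n))"
  unfolding has_trace_def
proof (intro allI impI)
  fix E assume E: "orthonormal_basis H E"
  have Fc: "f \<in> hcarrier H" if "f \<in> F" for f using F that by (auto simp: orthonormal_basis_def)
  have Ec: "e \<in> hcarrier H" if "e \<in> E" for e using E that by (auto simp: orthonormal_basis_def)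
  define g where "g = (\<lambda>(f, e). \<mu> f ^ n * (cmod (hinner H f e))\<^sup>2)"
  have 1: "((\<lambda>e. g (f, e)) has_sum \<mu> f ^ n) E" if "f \<in> F" for f
    using has_sum_cmult_right[OF Parseval[OF E that], of "\<mu> f ^ n"]
    by (cases "\<mu> f ^ n = 0") (auto simp: g_def zero_power)
  have 2: "((\<lambda>e. norm (g (f, e))) has_sum \<bar>\<mu> f\<bar> ^ n) E" if "f \<in> F" for f
    using has_sum_cmult_right[OF Parseval[OF E that], of "\<bar>\<mu> f\<bar> ^ n"]
    by (cases "\<mu> f ^ n = 0") (auto simp: g_def abs_mult power_abs zero_power)
  have "(\<lambda>x. norm (g x)) summable_on F \<times> E"
    unfolding Infinite_Sum.abs_summable_on_Sigma_iff
  proof (intro conjI ballI)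
    show "(\<lambda>e. norm (g (f, e))) summable_on E" if "f \<in> F" for f
      using 2[OF that] by (auto simp: summable_on_def)
    have "(\<lambda>f. norm (\<Sum>\<^sub>\<infinity>e\<in>E. norm (g (f, e)))) summable_on F \<longleftrightarrow> (\<lambda>f. \<bar>\<mu> f\<bar> ^ n) summable_on F"
      by (intro summable_on_cong) (subst infsumI[OF 2], auto)
    then show "(\<lambda>f. norm (\<Sum>\<^sub>\<infinity>e\<in>E. norm (g (f, e)))) summable_on F" using summable by simp
  qed
  then have "g summable_on F \<times> E" by (rule abs_summable_summable)
  then have sum: "(g has_sum infsum g (F \<times> E)) (F \<times> E)" by (rule has_sum_infsum)
  have "((\<lambda>f. \<mu> f ^ n) has_sum infsum g (F \<times> E)) F"
    by (rule has_sum_SigmaD[OF sum 1])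
  then have S: "infsum g (F \<times> E) = (\<Sum>\<^sub>\<infinity>f\<in>F. \<mu> f ^ n)" by (simp add: infsumI)
  have swapped: "((\<lambda>(e, f). g (f, e)) has_sum (\<Sum>\<^sub>\<infinity>f\<in>F. \<mu> f ^ n)) (E \<times> F)"
    using sum unfolding S has_sum_swap[of g] .
  have 3: "((\<lambda>f. complex_of_real (g (f, e))) has_sum hinner H ((T ^^ n) e) e) F" if e: "e \<in> E" for e
  proof -
    have "hinner H ((T ^^ n) e) f * hinner H f e = complex_of_real (g (f, e))" if f: "f \<in> F" for f
    proof -
      have "(T ^^ n) f = hscale H (complex_of_real (\<mu> f ^ n)) f"
        using eigenvalue_pow[OF Fc[OF f] eig[OF f]] by simp
      then have "hinner H ((T ^^ n) e) f = complex_of_real (\<mu> f ^ n) * hinner H e f"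
        using Ec[OF e] Fc[OF f] by (simp add: pow_inner inner_scale_right)
      moreover have "hinner H e f = cnj (hinner H f e)" using inner_commute Ec[OF e] Fc[OF f] by blast
      then have "hinner H e f * hinner H f e = complex_of_real ((cmod (hinner H f e))\<^sup>2)"
        by (simp add: complex_norm_square mult.commute del: of_real_power)
      ultimately show ?thesis by (simp add: g_def mult.assoc)
    qed
    then show ?thesis using expansion[OF Ec[OF e]] by (simp cong: has_sum_cong)
  qed
  have "((\<lambda>x. complex_of_real ((\<lambda>(e, f). g (f, e)) x)) has_sum
      complex_of_real (\<Sum>\<^sub>\<infinity>f\<in>F. \<mu> f ^ n)) (E \<times> F)"
    by (rule has_sum_of_real[OF swapped])
  then show "((\<lambda>e. hinner H ((T ^^ n) e) e) has_sum complex_of_real (\<Sum>\<^sub>\<infinity>f\<in>F. \<mu> f ^ n)) E"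
    by (rule has_sum_SigmaD) (use 3 in simp)
qed

end

context finite_trace_operator
begin

lemma eigenvalues_summable:
  assumes F: "orthonormal_basis H F" and eig: "\<And>f. f \<in> F \<Longrightarrow> T f = hscale H (complex_of_real (\<mu> f)) f"
  shows "(\<lambda>f. \<bar>\<mu> f\<bar> ^ (2 * m)) summable_on F"
proof -
  have "(hnorm H ((T ^^ m) f))\<^sup>2 = \<bar>\<mu> f\<bar> ^ (2 * m)" if "f \<in> F" for f
  proof -
    have oF: "orthonormal F" using F by (simp add: orthonormal_basis_iff)
    have "(T ^^ m) f = hscale H (complex_of_real (\<mu> f ^ m)) f"
      using eigenvalue_pow[OF orthonormalD(1)[OF oF that] eig[OF that]] by simp
    then have "hnorm H ((T ^^ m) f) = \<bar>\<mu> f\<bar> ^ m"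
      using orthonormalD(1,4)[OF oF that] by (simp add: hnorm_scale norm_power power_abs)
    then show ?thesis by (simp add: power_mult mult.commute flip: power_mult)
  qed
  then show ?thesis
    using hilbert_schmidt[OF F] by (auto simp: summable_on_def cong: has_sum_cong)
qed

text \<open>Both expansions come from the range of \<open>T ^^ m\<close>: it contains
  \<open>(T ^^ n) x\<close> because \<open>m \<le> n\<close>, and every basis vector with nonzero
  eigenvalue, being the image of a multiple of itself.\<close>

lemma has_trace_eigenvalues:
  assumes F: "orthonormal_basis H F" and eig: "\<And>f. f \<in> F \<Longrightarrow> T f = hscale H (complex_of_real (\<mu> f)) f"
    and n: "n \<ge> m" and summable: "(\<lambda>f. \<bar>\<mu> f\<bar> ^ n) summable_on F"
  shows "has_trace H (T ^^ n) (complex_of_real (\<Sum>\<^sub>\<infinity>f\<in>F. \<mu> f ^ n))"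
proof (rule has_trace_pow[OF F eig summable])
  have oF: "orthonormal F" using F by (simp add: orthonormal_basis_iff)
  have pow: "(T ^^ n) x = (T ^^ m) ((T ^^ (n - m)) x)" for x
    using n by (metis comp_apply funpow_add le_add_diff_inverse)
  show "((\<lambda>f. hinner H ((T ^^ n) x) f * hinner H f x) has_sum hinner H ((T ^^ n) x) x) F"
    if "x \<in> hcarrier H" for x
    unfolding pow using Parseval_range[OF F that, of "(T ^^ (n - m)) x"] that by simp
  fix E f assume E: "orthonormal_basis H E" and f: "f \<in> F" and nz: "\<mu> f ^ n \<noteq> 0"
  have fc: "f \<in> hcarrier H" using orthonormalD(1)[OF oF f] .
  have nz': "\<mu> f ^ m \<noteq> 0" using nz n by (metis power_eq_0_iff le_zero_eq gr0I)
  have "(T ^^ m) (hscale H (complex_of_real (inverse (\<mu> f ^ m))) f) =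
      hscale H (complex_of_real (inverse (\<mu> f ^ m) * \<mu> f ^ m)) f"
    using eigenvalue_pow[OF fc eig[OF f], of m] fc by (simp add: pow_scale)
  also have "inverse (\<mu> f ^ m) * \<mu> f ^ m = 1" using nz' by simp
  finally have "(T ^^ m) (hscale H (complex_of_real (inverse (\<mu> f ^ m))) f) = f" by simp
  then show "((\<lambda>e. (cmod (hinner H f e))\<^sup>2) has_sum 1) E"
    using Parseval_range_norm[OF E, of "hscale H (complex_of_real (inverse (\<mu> f ^ m))) f"] fc
      orthonormalD(4)[OF oF f] by (simp del: of_real_inverse)
qed

end

section \<open>Lists of eigenvalues\<close>

text \<open>The multiplicity function is a parameter so that the same notion serves the positive
  eigenvalues and, after a change of sign, the negative ones.\<close>

definition eigenvalue_list :: "(real \<Rightarrow> nat) \<Rightarrow> (nat \<Rightarrow> real) \<Rightarrow> bool" where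
  "eigenvalue_list mlt l \<longleftrightarrow> decseq l \<and> (\<forall>i. l i \<ge> 0) \<and>
     (\<forall>t>0. finite {i. l i = t} \<and> card {i. l i = t} = mlt t)"

text \<open>The entry \<open>l i\<close> is the largest positive eigenvalue with more than
  \<open>i\<close> members of \<open>F\<close> at or above it, and 0 if there is none. Every
  positive \<open>t\<close> then occupies the indices from the number of members above
  \<open>t\<close> up to, but excluding, the number at or above \<open>t\<close>.\<close>

lemma eigenvalue_list_exists:
  fixes \<mu> :: "'b \<Rightarrow> real"
  assumes fin: "\<And>\<epsilon>. \<epsilon> > 0 \<Longrightarrow> finite {f \<in> F. \<mu> f \<ge> \<epsilon>}"
  shows "\<exists>l. eigenvalue_list (\<lambda>t. card {f \<in> F. \<mu> f = t}) l"
proof -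
  define N where "N t = card {f \<in> F. \<mu> f \<ge> t}" for t
  define W where "W i = {f \<in> F. \<mu> f > 0 \<and> i < N (\<mu> f)}" for i
  have N_mono: "N t \<le> N s" if "0 < s" "s \<le> t" for s t
    unfolding N_def using that by (intro card_mono fin) auto
  have "\<exists>v. (W i = {} \<and> v = 0) \<or> (\<exists>f\<in>W i. \<mu> f = v \<and> (\<forall>g\<in>W i. \<mu> g \<le> v))" for i
  proof (cases "W i = {}")
    case False
    then obtain f0 where f0: "f0 \<in> W i" by blast
    \<comment> \<open>\<open>W i\<close> may be infinite, with values accumulating at 0; only the
      finitely many members at or above one chosen value compete for the maximum.\<close>
    let ?A = "{f \<in> W i. \<mu> f \<ge> \<mu> f0}"
    have "finite ?A" using f0 by (intro finite_subset[OF _ fin[of "\<mu> f0"]]) (auto simp: W_def)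
    then have fA: "finite (\<mu> ` ?A)" "\<mu> ` ?A \<noteq> {}" using f0 by auto
    obtain f where f: "f \<in> ?A" "\<mu> f = Max (\<mu> ` ?A)" using Max_in[OF fA] by auto
    have "\<mu> g \<le> \<mu> f" if "g \<in> W i" for g
    proof (cases "\<mu> g \<ge> \<mu> f0")
      case True
      then show ?thesis using that f fA by simp
    next
      case False
      then show ?thesis using f(1) by simp
    qed
    then show ?thesis using f(1) by blast
  qed simp
  then obtain l where l: "\<And>i. (W i = {} \<and> l i = 0) \<or> (\<exists>f\<in>W i. \<mu> f = l i \<and> (\<forall>g\<in>W i. \<mu> g \<le> l i))"
    by metis
  have l_pos: "i < N (l i)" if "l i > 0" for i using l[of i] that by (auto simp: W_def)
  \<comment> \<open>In a finite upward closed set with more than \<open>i\<close> members, a member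
    of least value belongs to \<open>W i\<close>. The sets of interest are the members at or above
    \<open>t\<close> and those strictly above.\<close>
  have lower: "\<exists>f\<in>A. \<mu> f \<le> l i"
    if A: "finite A" "A \<subseteq> F" "\<And>f. f \<in> A \<Longrightarrow> \<mu> f > 0" "\<And>f g. f \<in> A \<Longrightarrow> g \<in> F \<Longrightarrow> \<mu> f \<le> \<mu> g \<Longrightarrow> g \<in> A"
      and i: "i < card A" for A i
  proof -
    have fA: "finite (\<mu> ` A)" "\<mu> ` A \<noteq> {}" using A(1) i by auto
    obtain f where f: "f \<in> A" "\<mu> f = Min (\<mu> ` A)" using Min_in[OF fA] by auto
    have "{g \<in> F. \<mu> g \<ge> \<mu> f} = A" using A(2) A(4)[OF f(1)] f(2) fA(1) by auto
    then have "f \<in> W i" using i f(1) A by (auto simp: W_def N_def)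
    then show ?thesis using l[of i] f(1) by auto
  qed
  have ge: "l i \<ge> t \<longleftrightarrow> i < card {f \<in> F. \<mu> f \<ge> t}" if t: "t > 0" for i t
  proof
    assume "l i \<ge> t"
    then show "i < card {f \<in> F. \<mu> f \<ge> t}"
      using l_pos[of i] N_mono[OF t, of "l i"] t by (simp add: N_def)
  next
    assume "i < card {f \<in> F. \<mu> f \<ge> t}"
    then obtain f where "f \<in> {f \<in> F. \<mu> f \<ge> t}" "\<mu> f \<le> l i"
      using lower[of "{f \<in> F. \<mu> f \<ge> t}" i] fin[OF t] t by force
    then show "l i \<ge> t" by simp
  qed
  have fin_gt: "finite {f \<in> F. \<mu> f > t}" if "t > 0" for t
    by (rule finite_subset[OF _ fin[OF that]]) auto
  have gt: "l i > t \<longleftrightarrow> i < card {f \<in> F. \<mu> f > t}" if t: "t > 0" for i t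
  proof
    assume *: "l i > t"
    have "card {f \<in> F. \<mu> f \<ge> l i} \<le> card {f \<in> F. \<mu> f > t}"
      using * by (intro card_mono fin_gt t) auto
    then show "i < card {f \<in> F. \<mu> f > t}" using l_pos[of i] * t by (simp add: N_def)
  next
    assume "i < card {f \<in> F. \<mu> f > t}"
    then obtain f where "f \<in> {f \<in> F. \<mu> f > t}" "\<mu> f \<le> l i"
      using lower[of "{f \<in> F. \<mu> f > t}" i] fin_gt[OF t] t by force
    then show "l i > t" by simp
  qed
  have nonneg: "l i \<ge> 0" for i using l[of i] by (auto simp: W_def)
  have "l (Suc i) \<le> l i" for i
  proof (cases "l (Suc i) > 0")
    case True
    then show ?thesis using ge[of "l (Suc i)" "Suc i"] ge[of "l (Suc i)" i] by simp
  next
    case False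
    then show ?thesis using nonneg[of i] by simp
  qed
  then have "decseq l" by (simp add: decseq_Suc_iff)
  moreover have "finite {i. l i = t} \<and> card {i. l i = t} = card {f \<in> F. \<mu> f = t}" if t: "t > 0" for t
  proof -
    have "{i. l i = t} = {card {f \<in> F. \<mu> f > t}..<card {f \<in> F. \<mu> f \<ge> t}}"
    proof (rule set_eqI)
      fix i
      have "l i = t \<longleftrightarrow> l i \<ge> t \<and> \<not> l i > t" by auto
      then show "i \<in> {i. l i = t} \<longleftrightarrow> i \<in> {card {f \<in> F. \<mu> f > t}..<card {f \<in> F. \<mu> f \<ge> t}}"
        unfolding ge[OF t] gt[OF t] by auto
    qed
    moreover have "{f \<in> F. \<mu> f \<ge> t} = {f \<in> F. \<mu> f > t} \<union> {f \<in> F. \<mu> f = t}" by auto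
    moreover have "card ({f \<in> F. \<mu> f > t} \<union> {f \<in> F. \<mu> f = t}) = card {f \<in> F. \<mu> f > t} + card {f \<in> F. \<mu> f = t}"
      using fin_gt[OF t] finite_subset[OF _ fin[OF t], of "{f \<in> F. \<mu> f = t}"]
      by (intro card_Un_disjoint) auto
    ultimately show ?thesis by simp
  qed
  ultimately show ?thesis using nonneg unfolding eigenvalue_list_def by blast
qed

text \<open>Level sets of \<open>l\<close> and \<open>\<mu>\<close> are finite of equal size, and
  their bijections are glued along the positive levels. The padding zeros and the kernel, whose
  sizes may differ, stay outside.\<close>

lemma eigenvalue_list_bij:
  fixes \<mu> :: "'b \<Rightarrow> real"
  assumes l: "eigenvalue_list (\<lambda>t. card {f \<in> F. \<mu> f = t}) l"
    and fin: "\<And>\<epsilon>. \<epsilon> > 0 \<Longrightarrow> finite {f \<in> F. \<mu> f \<ge> \<epsilon>}"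
  obtains g where "bij_betw g {i. l i > 0} {f \<in> F. \<mu> f > 0}" "\<And>i. l i > 0 \<Longrightarrow> \<mu> (g i) = l i"
proof -
  have "\<exists>h. bij_betw h {i. l i = t} {f \<in> F. \<mu> f = t}" if "t > 0" for t
    using l that finite_subset[OF _ fin[OF that], of "{f \<in> F. \<mu> f = t}"]
    by (intro finite_same_card_bij) (auto simp: eigenvalue_list_def)
  then obtain h where h: "\<And>t. t > 0 \<Longrightarrow> bij_betw (h t) {i. l i = t} {f \<in> F. \<mu> f = t}" by metis
  define g where "g i = h (l i) i" for i
  have g: "g i \<in> F \<and> \<mu> (g i) = l i" if "l i > 0" for i
    using bij_betwE[OF h[OF that]] by (auto simp: g_def)
  have "bij_betw g {i. l i > 0} {f \<in> F. \<mu> f > 0}"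
  proof (intro bij_betw_imageI inj_onI)
    fix i j assume ij: "i \<in> {i. l i > 0}" "j \<in> {i. l i > 0}" "g i = g j"
    then have "l i = l j" using g by (metis mem_Collect_eq)
    then show "i = j"
      using ij bij_betw_imp_inj_on[OF h[of "l i"]] by (auto simp: g_def inj_on_def)
  next
    have "f \<in> g ` {i. l i > 0}" if f: "f \<in> F" "\<mu> f > 0" for f
    proof -
      have "f \<in> h (\<mu> f) ` {i. l i = \<mu> f}"
        unfolding bij_betw_imp_surj_on[OF h[OF f(2)]] using f(1) by simp
      then obtain i where i: "l i = \<mu> f" "f = h (\<mu> f) i" by blast
      then have "g i = f" "l i > 0" using f(2) unfolding g_def by simp_all
      then show ?thesis by blast
    qed
    moreover have "g i \<in> {f \<in> F. \<mu> f > 0}" if "i \<in> {i. l i > 0}" for i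
      using g[of i] that by simp
    ultimately show "g ` {i. l i > 0} = {f \<in> F. \<mu> f > 0}" by blast
  qed
  then show thesis by (rule that) (use g in blast)
qed

lemma downward_closed_eq_lessThan:
  fixes S :: "nat set"
  assumes "finite S" "\<And>i j. i \<in> S \<Longrightarrow> j \<le> i \<Longrightarrow> j \<in> S"
  shows "S = {..<card S}"
proof (cases "S = {}")
  case False
  define M where "M = Max S"
  have "S = {..M}"
    unfolding M_def using Max_ge[OF assms(1)] assms(2)[OF Max_in[OF assms(1) False]] by auto
  then show ?thesis by (simp add: lessThan_Suc_atMost)
qed simp

text \<open>The indices with \<open>l i \<ge> t\<close> form an initial segment, whose length
  \<open>eigenvalue_list_bij\<close> supplies. The right side does not mention \<open>l\<close>, so
  these equivalences determine the list.\<close>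

lemma eigenvalue_list_ge_iff:
  fixes \<mu> :: "'b \<Rightarrow> real"
  assumes l: "eigenvalue_list (\<lambda>t. card {f \<in> F. \<mu> f = t}) l"
    and fin: "\<And>\<epsilon>. \<epsilon> > 0 \<Longrightarrow> finite {f \<in> F. \<mu> f \<ge> \<epsilon>}"
    and t: "t > 0"
  shows "l i \<ge> t \<longleftrightarrow> i < card {f \<in> F. \<mu> f \<ge> t}"
proof -
  obtain g where g: "bij_betw g {i. l i > 0} {f \<in> F. \<mu> f > 0}" "\<And>i. l i > 0 \<Longrightarrow> \<mu> (g i) = l i"
    using eigenvalue_list_bij[OF l fin] by blast
  have "g ` {i. l i \<ge> t} = {f \<in> F. \<mu> f \<ge> t}"
  proof
    have "g i \<in> {f \<in> F. \<mu> f \<ge> t}" if "l i \<ge> t" for i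
    proof -
      have "l i > 0" using that t by simp
      then show ?thesis using bij_betw_apply[OF g(1), of i] g(2)[of i] that by simp
    qed
    then show "g ` {i. l i \<ge> t} \<subseteq> {f \<in> F. \<mu> f \<ge> t}" by blast
    show "{f \<in> F. \<mu> f \<ge> t} \<subseteq> g ` {i. l i \<ge> t}"
    proof
      fix f assume f: "f \<in> {f \<in> F. \<mu> f \<ge> t}"
      then have "f \<in> g ` {i. l i > 0}" using bij_betw_imp_surj_on[OF g(1)] t by simp
      then obtain i where i: "l i > 0" "f = g i" by blast
      then have "l i \<ge> t" using g(2)[OF i(1)] f by simp
      then show "f \<in> g ` {i. l i \<ge> t}" using i(2) by blast
    qed
  qed
  then have "bij_betw g {i. l i \<ge> t} {f \<in> F. \<mu> f \<ge> t}"
    using t by (intro bij_betw_subset[OF g(1)]) auto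
  then have "finite {i. l i \<ge> t}" "card {i. l i \<ge> t} = card {f \<in> F. \<mu> f \<ge> t}"
    using fin[OF t] bij_betw_finite bij_betw_same_card by blast+
  moreover have "j \<in> {i. l i \<ge> t}" if "i \<in> {i. l i \<ge> t}" "j \<le> i" for i j
    using l that decseqD[of l j i] by (auto simp: eigenvalue_list_def)
  ultimately have "{i. l i \<ge> t} = {..<card {f \<in> F. \<mu> f \<ge> t}}"
    using downward_closed_eq_lessThan by metis
  then show ?thesis by auto
qed

lemma eigenvalue_list_unique:
  fixes \<mu> :: "'b \<Rightarrow> real"
  assumes l: "eigenvalue_list (\<lambda>t. card {f \<in> F. \<mu> f = t}) l"
    and l': "eigenvalue_list (\<lambda>t. card {f \<in> F. \<mu> f = t}) l'"
    and fin: "\<And>\<epsilon>. \<epsilon> > 0 \<Longrightarrow> finite {f \<in> F. \<mu> f \<ge> \<epsilon>}"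
  shows "l = l'"
proof
  fix i
  have iff: "l i \<ge> t \<longleftrightarrow> l' i \<ge> t" if "t > 0" for t
    using eigenvalue_list_ge_iff[OF l fin that] eigenvalue_list_ge_iff[OF l' fin that] by simp
  have "l i \<ge> 0" "l' i \<ge> 0" using l l' by (auto simp: eigenvalue_list_def)
  then show "l i = l' i" using iff[of "l i"] iff[of "l' i"] by (cases "l i = 0"; cases "l' i = 0") auto
qed

lemma eigenvalue_list_power_sum:
  fixes \<mu> :: "'b \<Rightarrow> real"
  assumes l: "eigenvalue_list (\<lambda>t. card {f \<in> F. \<mu> f = t}) l"
    and fin: "\<And>\<epsilon>. \<epsilon> > 0 \<Longrightarrow> finite {f \<in> F. \<mu> f \<ge> \<epsilon>}"
    and n: "n > 0" and S: "((\<lambda>f. \<mu> f ^ n) has_sum S) {f \<in> F. \<mu> f > 0}"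
  shows "(\<lambda>i. l i ^ n) sums S" "summable (\<lambda>i. l i ^ n)"
proof -
  obtain g where g: "bij_betw g {i. l i > 0} {f \<in> F. \<mu> f > 0}" "\<And>i. l i > 0 \<Longrightarrow> \<mu> (g i) = l i"
    using eigenvalue_list_bij[OF l fin] by blast
  have nonneg: "l i \<ge> 0" for i using l by (simp add: eigenvalue_list_def)
  have "((\<lambda>i. \<mu> (g i) ^ n) has_sum S) {i. l i > 0}"
    using S has_sum_reindex_bij_betw[OF g(1), of "\<lambda>f. \<mu> f ^ n"] by simp
  moreover have "((\<lambda>i. \<mu> (g i) ^ n) has_sum S) {i. l i > 0} \<longleftrightarrow> ((\<lambda>i. l i ^ n) has_sum S) {i. l i > 0}"
    by (rule has_sum_cong) (use g(2) in simp)
  \<comment> \<open>Since \<open>n\<close> is positive, the zero entries of the list contribute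
    nothing.\<close>
  moreover have "((\<lambda>i. l i ^ n) has_sum S) {i. l i > 0} \<longleftrightarrow> ((\<lambda>i. l i ^ n) has_sum S) UNIV"
    using n nonneg by (intro has_sum_cong_neutral) (auto simp: not_less order_antisym)
  ultimately have "((\<lambda>i. l i ^ n) has_sum S) UNIV" by simp
  then show "(\<lambda>i. l i ^ n) sums S" by (rule has_sum_imp_sums)
  then show "summable (\<lambda>i. l i ^ n)" by (rule sums_summable)
qed

section \<open>Convergence of power sums\<close>

text \<open>Oscillation is excluded across positive levels only, those at which eigenvalues can be
  counted. Compactness gives a cluster point \<open>L\<close>; if the sequence were far from
  \<open>L\<close> infinitely often, two levels in between would be crossed infinitely
  often.\<close>

lemma convergent_if_no_oscillation:
  fixes x :: "nat \<Rightarrow> real"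
  assumes bounds: "\<And>k. 0 \<le> x k" "\<And>k. x k \<le> R"
    and no_osc: "\<And>s t. 0 < s \<Longrightarrow> s < t \<Longrightarrow> (\<exists>\<^sub>F k in sequentially. t \<le> x k) \<Longrightarrow>
      (\<exists>\<^sub>F k in sequentially. x k < s) \<Longrightarrow> False"
  shows "convergent x"
proof -
  have "compact {0..R}" by simp
  moreover have "\<forall>k. x k \<in> {0..R}" using bounds by simp
  ultimately obtain L r where L: "L \<in> {0..R}" "strict_mono r" "(x \<circ> r) \<longlonglongrightarrow> L"
    unfolding compact_def by metis
  have near: "\<exists>\<^sub>F k in sequentially. \<bar>x k - L\<bar> < \<delta>" if "\<delta> > 0" for \<delta>
    unfolding frequently_sequentially
  proof
    fix M
    have "\<forall>\<^sub>F j in sequentially. dist ((x \<circ> r) j) L < \<delta>" using tendstoD[OF L(3) that] .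
    moreover have "\<forall>\<^sub>F j in sequentially. j \<ge> M" by (rule eventually_ge_at_top)
    ultimately have "\<forall>\<^sub>F j in sequentially. dist ((x \<circ> r) j) L < \<delta> \<and> j \<ge> M" by (rule eventually_conj)
    then obtain j where "dist ((x \<circ> r) j) L < \<delta>" "j \<ge> M"
      using eventually_happens'[OF sequentially_bot] by blast
    then show "\<exists>k\<ge>M. \<bar>x k - L\<bar> < \<delta>"
      using seq_suble[OF L(2), of j] by (intro exI[of _ "r j"]) (simp add: dist_real_def)
  qed
  have "x \<longlonglongrightarrow> L"
  proof (rule tendstoI, rule ccontr)
    fix e :: real assume "e > 0" and "\<not> (\<forall>\<^sub>F k in sequentially. dist (x k) L < e)"
    then have far: "\<exists>\<^sub>F k in sequentially. e \<le> \<bar>x k - L\<bar>"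
      by (simp add: not_eventually dist_real_def not_less)
    have "\<exists>\<^sub>F k in sequentially. L + e \<le> x k \<or> x k \<le> L - e"
      by (rule frequently_elim1[OF far]) (auto simp: abs_if split: if_splits)
    then have "(\<exists>\<^sub>F k in sequentially. L + e \<le> x k) \<or> (\<exists>\<^sub>F k in sequentially. x k \<le> L - e)"
      by (simp add: frequently_disj_iff)
    then show False
    proof
      assume up: "\<exists>\<^sub>F k in sequentially. L + e \<le> x k"
      show False
      proof (rule no_osc[OF _ _ up])
        show "0 < L + e / 2" "L + e / 2 < L + e" using L(1) \<open>e > 0\<close> by auto
        have "e / 2 > 0" using \<open>e > 0\<close> by simp
        from near[OF this] show "\<exists>\<^sub>F k in sequentially. x k < L + e / 2"
          by (rule frequently_elim1) linarith
      qed
    next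
      assume down: "\<exists>\<^sub>F k in sequentially. x k \<le> L - e"
      then obtain k where "x k \<le> L - e" using frequently_ex by blast
      \<comment> \<open>Nonnegativity of the sequence pushes \<open>L\<close> up to at least
        \<open>e\<close>, so that both levels below \<open>L\<close> are positive.\<close>
      then have Le: "L \<ge> e" using bounds(1)[of k] by linarith
      show False
      proof (rule no_osc)
        show "0 < L - 2 * e / 3" "L - 2 * e / 3 < L - e / 3" using Le \<open>e > 0\<close> by auto
        have "e / 3 > 0" using \<open>e > 0\<close> by simp
        from near[OF this] show "\<exists>\<^sub>F k in sequentially. L - e / 3 \<le> x k"
          by (rule frequently_elim1) linarith
        show "\<exists>\<^sub>F k in sequentially. x k < L - 2 * e / 3"
          by (rule frequently_elim1[OF down]) (use \<open>e > 0\<close> in linarith)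
      qed
    qed
  qed
  then show ?thesis by (auto simp: convergent_def)
qed

text \<open>
  \<open>P k\<close> lists the positive eigenvalues of the \<open>k\<close>-th operator and \<open>Q k\<close> the absolute values of the
  negative ones.
\<close>

locale power_sums =
  fixes P Q :: "nat \<Rightarrow> nat \<Rightarrow> real" and p :: nat and \<alpha> :: "nat \<Rightarrow> real"
  assumes even: "even p" and p: "p > 0"
    and P_dec: "\<And>k. decseq (P k)" and Q_dec: "\<And>k. decseq (Q k)"
    and P_nonneg: "\<And>k i. 0 \<le> P k i" and Q_nonneg: "\<And>k i. 0 \<le> Q k i"
    and P_summable: "\<And>k. summable (\<lambda>i. P k i ^ p)" and Q_summable: "\<And>k. summable (\<lambda>i. Q k i ^ p)"
    and lim: "\<And>n. n \<ge> p \<Longrightarrow> (\<lambda>k. \<Sum>i. P k i ^ n + (- Q k i) ^ n) \<longlonglongrightarrow> \<alpha> n"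
begin

section \<open>Spectral measures weighted by p-th powers\<close>

definition mass :: "nat \<Rightarrow> nat \<Rightarrow> real" where "mass k i = P k i ^ p + Q k i ^ p"

lemma mass_nonneg: "mass k i \<ge> 0"
  by (simp add: mass_def P_nonneg Q_nonneg)

lemma mass_summable: "summable (mass k)"
  unfolding mass_def by (intro summable_add P_summable Q_summable)

definition bound :: real where "bound = (SOME C. \<forall>k. suminf (mass k) \<le> C)"

text \<open>For even \<open>p\<close> the total mass is the p-th power sum; these converge, so one
  constant serves all \<open>k\<close>.\<close>

lemma mass_le_bound: "suminf (mass k) \<le> bound"
proof -
  have "Bseq (\<lambda>k. \<Sum>i. P k i ^ p + (- Q k i) ^ p)"
    using lim[of p] by (intro convergent_imp_Bseq) (auto simp: convergent_def)
  then obtain K where "\<And>k. norm (\<Sum>i. P k i ^ p + (- Q k i) ^ p) \<le> K" by (auto simp: Bseq_def)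
  then have "\<forall>k. suminf (mass k) \<le> K" using even by (auto simp: mass_def[abs_def] abs_le_iff)
  then show ?thesis unfolding bound_def by (rule someI2) blast
qed

lemma bound_nonneg: "bound \<ge> 0"
  using mass_le_bound[of 0] suminf_nonneg[OF mass_summable[of 0] mass_nonneg] by linarith

lemma sum_mass_le: "sum (mass k) {..<n} \<le> bound"
  using sum_le_suminf[OF mass_summable[of k], of "{..<n}"] mass_nonneg mass_le_bound[of k] by simp

lemma mass_le: "mass k i \<le> bound"
  using sum_mass_le[of k "Suc i"] sum_nonneg[of "{..<i}" "mass k"] mass_nonneg by simp

text \<open>A crude bound for the supports: beyond 1 a number is at most its p-th power, which saves
  taking a root.\<close>

definition radius :: real where "radius = max 1 bound"

lemma le_radius: "x \<ge> 0 \<Longrightarrow> x ^ p \<le> bound \<Longrightarrow> x \<le> radius"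
proof (cases "x \<le> 1")
  case False
  assume "x \<ge> 0" "x ^ p \<le> bound"
  moreover have "x ^ 1 \<le> x ^ p" using False p by (intro power_increasing) auto
  ultimately show ?thesis by (simp add: radius_def)
qed (simp add: radius_def)

lemma P_le_radius: "P k i \<le> radius" and Q_le_radius: "Q k i \<le> radius"
proof -
  have "P k i ^ p \<le> bound" "Q k i ^ p \<le> bound"
    using mass_le[of k i] zero_le_power[OF P_nonneg, of k i p] zero_le_power[OF Q_nonneg, of k i p]
    by (auto simp: mass_def)
  then show "P k i \<le> radius" "Q k i \<le> radius" using le_radius P_nonneg Q_nonneg by blast+
qed

text \<open>Summed over \<open>i\<close>, this is the integral of \<open>f\<close> against the
  measure that gives each eigenvalue its p-th power as mass; padding zeros have no mass.\<close>

definition weighted :: "(real \<Rightarrow> real) \<Rightarrow> nat \<Rightarrow> nat \<Rightarrow> real" where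
  "weighted f k i = f (P k i) * P k i ^ p + f (- Q k i) * Q k i ^ p"

lemma weighted_bound:
  assumes "\<And>x. \<bar>x\<bar> \<le> radius \<Longrightarrow> \<bar>f x\<bar> \<le> c"
  shows "\<bar>weighted f k i\<bar> \<le> c * mass k i"
proof -
  have "\<bar>f (P k i)\<bar> \<le> c" "\<bar>f (- Q k i)\<bar> \<le> c"
    using assms P_nonneg Q_nonneg P_le_radius Q_le_radius by auto
  then have "\<bar>f (P k i)\<bar> * P k i ^ p + \<bar>f (- Q k i)\<bar> * Q k i ^ p \<le> c * P k i ^ p + c * Q k i ^ p"
    using P_nonneg Q_nonneg by (intro add_mono mult_right_mono) auto
  moreover have "\<bar>weighted f k i\<bar> \<le> \<bar>f (P k i) * P k i ^ p\<bar> + \<bar>f (- Q k i) * Q k i ^ p\<bar>"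
    unfolding weighted_def by (rule abs_triangle_ineq)
  ultimately show ?thesis
    using P_nonneg Q_nonneg by (simp add: abs_mult power_abs mass_def distrib_left)
qed

lemma weighted_summable:
  assumes "\<And>x. \<bar>x\<bar> \<le> radius \<Longrightarrow> \<bar>f x\<bar> \<le> c"
  shows "summable (weighted f k)"
  using weighted_bound[OF assms]
  by (intro summable_comparison_test'[OF summable_mult[OF mass_summable[of k]], of 0 "weighted f k" c]) simp

lemma weighted_suminf_bound:
  assumes "\<And>x. \<bar>x\<bar> \<le> radius \<Longrightarrow> \<bar>f x\<bar> \<le> c" "c \<ge> 0"
  shows "\<bar>suminf (weighted f k)\<bar> \<le> c * bound"
proof -
  have 1: "summable (\<lambda>i. c * mass k i)" by (intro summable_mult mass_summable)
  have "norm (suminf (weighted f k)) \<le> (\<Sum>i. c * mass k i)"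
    using weighted_bound[OF assms(1)] by (intro norm_suminf_le 1) simp
  also have "\<dots> = c * suminf (mass k)" by (intro suminf_mult mass_summable)
  also have "\<dots> \<le> c * bound" using mass_le_bound assms(2) by (rule mult_left_mono)
  finally show ?thesis by simp
qed

lemma continuous_bounded:
  fixes f :: "real \<Rightarrow> real"
  assumes "continuous_on {- radius..radius} f"
  obtains c where "c \<ge> 0" "\<And>x. \<bar>x\<bar> \<le> radius \<Longrightarrow> \<bar>f x\<bar> \<le> c"
proof -
  have "bounded (f ` {- radius..radius})"
    using assms by (intro compact_imp_bounded compact_continuous_image) auto
  then obtain c where c: "\<forall>y\<in>f ` {- radius..radius}. norm y \<le> c" unfolding bounded_iff by blast
  have b: "\<bar>f x\<bar> \<le> c" if "\<bar>x\<bar> \<le> radius" for x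
    using c that by (auto simp: abs_le_iff)
  show thesis
  proof (rule that[of "max 0 c"])
    show "\<bar>f x\<bar> \<le> max 0 c" if "\<bar>x\<bar> \<le> radius" for x using b[OF that] by simp
  qed simp
qed

text \<open>The j-th moment is the power sum of exponent \<open>p + j\<close>; evenness lets
  \<open>Q k i ^ p\<close> be read as a power of \<open>- Q k i\<close>.\<close>

lemma weighted_power_convergent:
  "(\<lambda>k. suminf (weighted (\<lambda>x. x ^ j) k)) \<longlonglongrightarrow> \<alpha> (p + j)"
proof -
  have "(- Q k i) ^ j * Q k i ^ p = (- Q k i) ^ (p + j)" for k i
    using even by (simp add: power_add mult.commute)
  then have "weighted (\<lambda>x. x ^ j) k = (\<lambda>i. P k i ^ (p + j) + (- Q k i) ^ (p + j))" for k
    by (intro ext) (simp add: weighted_def power_add mult.commute)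
  then show ?thesis using lim[of "p + j"] by simp
qed

lemma weighted_polynomial_convergent:
  "convergent (\<lambda>k. suminf (weighted (\<lambda>x. \<Sum>j\<le>N. c j * x ^ j) k))"
proof -
  have s: "summable (weighted (\<lambda>x. x ^ j) k)" for j k
  proof -
    have "continuous_on {- radius..radius} (\<lambda>x::real. x ^ j)" by (intro continuous_intros)
    then obtain d where "\<And>x. \<bar>x\<bar> \<le> radius \<Longrightarrow> \<bar>x ^ j\<bar> \<le> d" using continuous_bounded by metis
    then show ?thesis by (rule weighted_summable)
  qed
  have "weighted (\<lambda>x. \<Sum>j\<le>N. c j * x ^ j) k = (\<lambda>i. \<Sum>j\<le>N. c j * weighted (\<lambda>x. x ^ j) k i)" for k
    by (intro ext) (simp add: weighted_def sum_distrib_right sum.distrib distrib_left mult.assoc)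
  then have "suminf (weighted (\<lambda>x. \<Sum>j\<le>N. c j * x ^ j) k) = (\<Sum>j\<le>N. c j * suminf (weighted (\<lambda>x. x ^ j) k))" for k
    using s by (simp add: suminf_sum summable_mult suminf_mult)
  moreover have "(\<lambda>k. \<Sum>j\<le>N. c j * suminf (weighted (\<lambda>x. x ^ j) k)) \<longlonglongrightarrow> (\<Sum>j\<le>N. c j * \<alpha> (p + j))"
    by (intro tendsto_intros weighted_power_convergent)
  ultimately show ?thesis by (auto simp: convergent_def)
qed

lemma weighted_convergent:
  assumes f: "continuous_on {- radius..radius} f"
  shows "convergent (\<lambda>k. suminf (weighted f k))"
  unfolding Cauchy_convergent_iff[symmetric]
proof (rule metric_CauchyI)
  fix e :: real assume e: "e > 0"
  \<comment> \<open>A uniform error \<open>d\<close> costs at most \<open>d * bound\<close> in the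
    integral, less than a third of \<open>e\<close>; adding 1 keeps the denominator positive if
    \<open>bound\<close> is 0.\<close>
  define d where "d = e / (3 * (bound + 1))"
  have d: "d > 0" "d * bound < e / 3" using e bound_nonneg by (auto simp: d_def field_simps)
  have "compact {- radius..radius}" by simp
  from Stone_Weierstrass_real_polynomial_function[OF this f d(1)]
  obtain g where g: "real_polynomial_function g" "\<And>x. x \<in> {- radius..radius} \<Longrightarrow> \<bar>f x - g x\<bar> < d" by blast
  obtain c N where gc: "g = (\<lambda>x. \<Sum>j\<le>N. c j * x ^ j)"
    using g(1) unfolding real_polynomial_function_iff_sum by blast
  have gcont: "continuous_on {- radius..radius} g" unfolding gc by (intro continuous_intros)
  obtain cf where cf: "\<And>x. \<bar>x\<bar> \<le> radius \<Longrightarrow> \<bar>f x\<bar> \<le> cf" using continuous_bounded[OF f] by metis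
  obtain cg where cg: "\<And>x. \<bar>x\<bar> \<le> radius \<Longrightarrow> \<bar>g x\<bar> \<le> cg" using continuous_bounded[OF gcont] by metis
  have close: "\<bar>suminf (weighted f k) - suminf (weighted g k)\<bar> < e / 3" for k
  proof -
    have "\<bar>suminf (weighted (\<lambda>x. f x - g x) k)\<bar> \<le> d * bound"
    proof (rule weighted_suminf_bound)
      fix x assume "\<bar>x\<bar> \<le> radius"
      then have "x \<in> {- radius..radius}" by auto
      then show "\<bar>f x - g x\<bar> \<le> d" using g(2) less_imp_le by blast
    qed (use d in simp)
    moreover have "suminf (weighted (\<lambda>x. f x - g x) k) = suminf (weighted f k) - suminf (weighted g k)"
    proof -
      have "weighted (\<lambda>x. f x - g x) k = (\<lambda>i. weighted f k i - weighted g k i)"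
        by (intro ext) (simp add: weighted_def algebra_simps)
      then show ?thesis using suminf_diff[OF weighted_summable[OF cf] weighted_summable[OF cg]] by simp
    qed
    ultimately show ?thesis using d(2) by linarith
  qed
  have "Cauchy (\<lambda>k. suminf (weighted g k))"
    using weighted_polynomial_convergent unfolding gc by (simp add: Cauchy_convergent_iff)
  then obtain M where M: "\<And>k l. k \<ge> M \<Longrightarrow> l \<ge> M \<Longrightarrow> dist (suminf (weighted g k)) (suminf (weighted g l)) < e / 3"
    using metric_CauchyD[of _ "e / 3"] e by (metis divide_pos_pos zero_less_numeral)
  have "dist (suminf (weighted f k)) (suminf (weighted f l)) < e" if "k \<ge> M" "l \<ge> M" for k l
    using M[OF that] close[of k] close[of l] unfolding dist_real_def by linarith
  then show "\<exists>M. \<forall>k\<ge>M. \<forall>l\<ge>M. dist (suminf (weighted f k)) (suminf (weighted f l)) < e" by blast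
qed

text \<open>
  A bump function that vanishes below \<open>s\<close> and is 1 above \<open>t\<close> counts the eigenvalues, up to those
  between \<open>s\<close> and \<open>t\<close>.
\<close>

lemma P_convergent: "convergent (\<lambda>k. P k i)"
proof (rule convergent_if_no_oscillation)
  fix s t :: real
  assume st: "0 < s" "s < t"
    and up: "\<exists>\<^sub>F k in sequentially. t \<le> P k i" and down: "\<exists>\<^sub>F k in sequentially. P k i < s"
  define g where "g x = min 1 (max 0 ((x - s) / (t - s)))" for x
  \<comment> \<open>Dividing by the p-th power cancels the weight, so that the integral of
    \<open>f\<close> is the plain sum of \<open>g (P k j)\<close>. The maximum with \<open>s\<close>
    changes the denominator only where \<open>g\<close> vanishes and keeps it away from 0.\<close>
  define f where "f x = g x / max s x ^ p" for x
  have nz: "max s x \<noteq> 0" for x using st by simp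
  have "continuous_on {- radius..radius} f"
    unfolding f_def g_def using st nz by (intro continuous_intros) auto
  then have cont: "continuous_on {- radius..radius} f" .
  obtain L where L: "(\<lambda>k. suminf (weighted f k)) \<longlonglongrightarrow> L"
    using weighted_convergent[OF cont] unfolding convergent_def by blast
  obtain c where c: "\<And>x. \<bar>x\<bar> \<le> radius \<Longrightarrow> \<bar>f x\<bar> \<le> c"
    using continuous_bounded[OF cont] by metis
  have g0: "g x = 0" if "x \<le> s" for x using that st by (simp add: g_def max_def field_simps)
  have g1: "g x = 1" if "x \<ge> t" for x using that st by (simp add: g_def field_simps)
  have g01: "0 \<le> g x" "g x \<le> 1" for x by (auto simp: g_def)
  have w: "weighted f k j = g (P k j)" for k j
  proof -
    have "f (P k j) * P k j ^ p = g (P k j)"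
    proof (cases "P k j \<le> s")
      case False
      then have "max s (P k j) = P k j" "P k j \<noteq> 0" using st by auto
      then show ?thesis by (simp add: f_def)
    qed (simp add: f_def g0)
    moreover have "f (- Q k j) = 0" using g0[of "- Q k j"] Q_nonneg[of k j] st by (simp add: f_def)
    ultimately show ?thesis by (simp add: weighted_def)
  qed
  have upper: "suminf (weighted f k) \<ge> real (Suc i)" if "t \<le> P k i" for k
  proof -
    have "weighted f k j = 1" if "j \<le> i" for j
      using decseqD[OF P_dec[of k] that] \<open>t \<le> P k i\<close> by (simp add: w g1)
    then have "(\<Sum>j<Suc i. weighted f k j) = real (Suc i)" by simp
    moreover have "(\<Sum>j<Suc i. weighted f k j) \<le> suminf (weighted f k)"
      using g01 by (intro sum_le_suminf weighted_summable[OF c]) (auto simp: w)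
    ultimately show ?thesis by simp
  qed
  have lower: "suminf (weighted f k) \<le> real i" if "P k i < s" for k
  proof -
    have "weighted f k j = 0" if "j \<notin> {..<i}" for j
      using decseqD[OF P_dec[of k], of i j] that \<open>P k i < s\<close> by (simp add: w g0)
    then have "suminf (weighted f k) = (\<Sum>j<i. weighted f k j)" by (intro suminf_finite) auto
    also have "\<dots> \<le> (\<Sum>j<i. 1)" using g01 by (intro sum_mono) (simp add: w)
    finally show ?thesis by simp
  qed
  \<comment> \<open>The integral is at least \<open>i + 1\<close> in one case and at most
    \<open>i\<close> in the other, so the two values cannot both be closer than 1/2 to
    \<open>L\<close>.\<close>
  have "\<forall>\<^sub>F k in sequentially. dist (suminf (weighted f k)) L < 1/2" by (rule tendstoD[OF L]) simp
  then have "\<exists>\<^sub>F k in sequentially. t \<le> P k i \<and> dist (suminf (weighted f k)) L < 1/2"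
    "\<exists>\<^sub>F k in sequentially. P k i < s \<and> dist (suminf (weighted f k)) L < 1/2"
    using frequently_eventually_frequently[OF up] frequently_eventually_frequently[OF down] by auto
  from frequently_ex[OF this(1)] frequently_ex[OF this(2)]
  obtain k l where "t \<le> P k i" "dist (suminf (weighted f k)) L < 1/2"
    "P l i < s" "dist (suminf (weighted f l)) L < 1/2"
    by blast
  then show False using upper[of k] lower[of l] unfolding dist_real_def of_nat_Suc by linarith
qed (use P_nonneg P_le_radius in auto)

text \<open>With indices from 0, the entries up to \<open>i\<close> are \<open>Suc i\<close> numbers
  not below \<open>P k i\<close>, and their p-th powers sum to at most \<open>bound\<close>. The
  estimate is uniform in \<open>k\<close> and serves as dominating series.\<close>

lemma P_decay:
  assumes "n > 0"
  shows "P k i ^ n \<le> (bound / real (Suc i)) powr (real n / real p)"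
proof (cases "P k i = 0")
  case False
  then have pos: "P k i > 0" using P_nonneg[of k i] by simp
  have "(\<Sum>j<Suc i. P k i ^ p) \<le> (\<Sum>j<Suc i. mass k j)"
  proof (rule sum_mono)
    fix j assume "j \<in> {..<Suc i}"
    then have "P k i ^ p \<le> P k j ^ p"
      using decseqD[OF P_dec[of k], of j i] P_nonneg by (intro power_mono) auto
    then show "P k i ^ p \<le> mass k j" using zero_le_power[OF Q_nonneg, of k j p] by (simp add: mass_def)
  qed
  also have "\<dots> \<le> bound" by (rule sum_mass_le)
  finally have "P k i ^ p \<le> bound / real (Suc i)" by (simp add: field_simps)
  then have "(P k i ^ p) powr (real n / real p) \<le> (bound / real (Suc i)) powr (real n / real p)"
    using P_nonneg by (intro powr_mono2) auto
  moreover have "(P k i ^ p) powr (real n / real p) = P k i ^ n"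
  proof -
    have "(P k i ^ p) powr (real n / real p) = (P k i powr real p) powr (real n / real p)"
      using pos by (simp add: powr_realpow)
    also have "\<dots> = P k i powr real n" using p by (simp add: powr_powr)
    finally show ?thesis using pos by (simp add: powr_realpow)
  qed
  ultimately show ?thesis by simp
qed (use assms in \<open>simp add: zero_power\<close>)

lemma
  assumes l: "\<And>i. (\<lambda>k. P k i) \<longlonglongrightarrow> l i"
  shows P_limit_decseq: "decseq l" and P_limit_nonneg: "\<And>i. l i \<ge> 0"
    and P_limit_summable: "summable (\<lambda>i. l i ^ p)"
    and P_limit_power_sum: "\<And>n. n > p \<Longrightarrow> (\<lambda>k. \<Sum>i. P k i ^ n) \<longlonglongrightarrow> (\<Sum>i. l i ^ n)"
proof -
  show "decseq l"
    unfolding decseq_def using P_dec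
    by (intro allI impI LIMSEQ_le[OF l l]) (auto simp: decseq_def)
  show nonneg: "l i \<ge> 0" for i
    by (rule LIMSEQ_le_const[OF l]) (use P_nonneg in blast)
  \<comment> \<open>At exponent \<open>p\<close> the bound on partial sums survives the limit, but
    the sums themselves need not converge to the sum of the limits.\<close>
  show "summable (\<lambda>i. l i ^ p)"
  proof (rule summableI_nonneg_bounded)
    fix n
    have "(\<lambda>k. \<Sum>i<n. P k i ^ p) \<longlonglongrightarrow> (\<Sum>i<n. l i ^ p)" by (intro tendsto_intros l)
    moreover have "(\<Sum>i<n. P k i ^ p) \<le> bound" for k
    proof -
      have "(\<Sum>i<n. P k i ^ p) \<le> (\<Sum>i<n. mass k i)"
        using Q_nonneg by (intro sum_mono) (simp add: mass_def)
      then show ?thesis using sum_mass_le[of k n] by linarith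
    qed
    ultimately show "(\<Sum>i<n. l i ^ p) \<le> bound" by (intro LIMSEQ_le_const2) auto
  qed (use nonneg in simp)
  fix n :: nat assume n: "n > p"
  \<comment> \<open>\<open>n > p\<close> makes \<open>r\<close> greater than 1, as summability of
    the dominating series requires.\<close>
  define r where "r = real n / real p"
  have r: "r > 1" using n p by (simp add: r_def)
  have "summable (\<lambda>i. real (Suc i) powr - r)"
    using r summable_real_powr_iff[of "- r"] summable_Suc_iff[of "\<lambda>i. real i powr - r"] by simp
  then have "summable (\<lambda>i. bound powr r * real (Suc i) powr - r)" by (rule summable_mult)
  moreover have "bound powr r * real (Suc i) powr - r = (bound / real (Suc i)) powr r" for i
  proof -
    have "(bound / real (Suc i)) powr r = bound powr r / real (Suc i) powr r"
      by (rule powr_divide)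
    then show ?thesis by (simp only: powr_minus divide_inverse)
  qed
  ultimately have M: "summable (\<lambda>i. (bound / real (Suc i)) powr r)" by (simp only:)
  have "\<forall>\<^sub>F (i, k) in sequentially \<times>\<^sub>F sequentially. norm (P k i ^ n) \<le> (bound / real (Suc i)) powr r"
    using P_decay[of n] P_nonneg n unfolding r_def
    by (intro always_eventually) (auto simp: power_abs abs_of_nonneg simp del: of_nat_Suc)
  from tannerys_theorem[OF tendsto_power[OF l] this M]
  show "(\<lambda>k. \<Sum>i. P k i ^ n) \<longlonglongrightarrow> (\<Sum>i. l i ^ n)" by simp
qed

end

lemma (in power_sums) P_power_summable: "n \<ge> p \<Longrightarrow> summable (\<lambda>i. P k i ^ n)"
proof (rule summable_comparison_test')
  assume n: "n \<ge> p"
  show "summable (\<lambda>i. radius ^ (n - p) * P k i ^ p)" by (intro summable_mult P_summable)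
  fix i
  have "P k i ^ n = P k i ^ (n - p) * P k i ^ p" using n by (simp flip: power_add)
  also have "\<dots> \<le> radius ^ (n - p) * P k i ^ p"
    using P_nonneg P_le_radius by (intro mult_right_mono power_mono) auto
  finally show "norm (P k i ^ n) \<le> radius ^ (n - p) * P k i ^ p" using P_nonneg by simp
qed

text \<open>Changing the sign of all operators exchanges \<open>P\<close> and \<open>Q\<close> and
  multiplies the n-th trace by \<open>(- 1) ^ n\<close>; so the results on \<open>P\<close> carry
  over to \<open>Q\<close>.\<close>

lemma power_sums_mirror:
  assumes "power_sums P Q p \<alpha>"
  shows "power_sums Q P p (\<lambda>n. (- 1) ^ n * \<alpha> n)"
proof -
  interpret power_sums P Q p \<alpha> by fact
  show ?thesis
  proof
    fix n assume n: "n \<ge> p"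
    have *: "(- 1) ^ n * (P k i ^ n + (- Q k i) ^ n) = Q k i ^ n + (- P k i) ^ n" for k i
      by (simp add: distrib_left flip: power_mult_distrib)
    have "summable (weighted (\<lambda>x. x ^ (n - p)) k)" for k
    proof -
      have "continuous_on {- radius..radius} (\<lambda>x::real. x ^ (n - p))" by (intro continuous_intros)
      then obtain d where "\<And>x. \<bar>x\<bar> \<le> radius \<Longrightarrow> \<bar>x ^ (n - p)\<bar> \<le> d" using continuous_bounded by metis
      then show ?thesis by (rule weighted_summable)
    qed
    moreover have "weighted (\<lambda>x. x ^ (n - p)) k = (\<lambda>i. P k i ^ n + (- Q k i) ^ n)" for k
    proof
      fix i
      have "(- Q k i) ^ (n - p) * Q k i ^ p = (- Q k i) ^ (n - p) * (- Q k i) ^ p" using even by simp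
      then show "weighted (\<lambda>x. x ^ (n - p)) k i = P k i ^ n + (- Q k i) ^ n"
        using n by (simp add: weighted_def flip: power_add)
    qed
    ultimately have "summable (\<lambda>i. P k i ^ n + (- Q k i) ^ n)" for k by metis
    then have "(\<Sum>i. Q k i ^ n + (- P k i) ^ n) = (- 1) ^ n * (\<Sum>i. P k i ^ n + (- Q k i) ^ n)" for k
      unfolding *[symmetric] by (rule suminf_mult)
    then show "(\<lambda>k. \<Sum>i. Q k i ^ n + (- P k i) ^ n) \<longlonglongrightarrow> (- 1) ^ n * \<alpha> n"
      using tendsto_mult_left[OF lim[OF n], of "(- 1) ^ n"] by simp
  qed (use even p P_dec Q_dec P_nonneg Q_nonneg P_summable Q_summable in auto)
qed

theorem power_sums_limit:
  assumes "power_sums P Q p \<alpha>"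
  obtains l l' where
    "\<And>i. (\<lambda>k. P k i) \<longlonglongrightarrow> l i" "decseq l" "\<And>i. l i \<ge> 0" "summable (\<lambda>i. l i ^ p)"
    "\<And>i. (\<lambda>k. Q k i) \<longlonglongrightarrow> l' i" "decseq l'" "\<And>i. l' i \<ge> 0" "summable (\<lambda>i. l' i ^ p)"
    "\<And>n. n > p \<Longrightarrow> \<alpha> n = (\<Sum>i. l i ^ n) + (- 1) ^ n * (\<Sum>i. l' i ^ n)"
proof -
  interpret A: power_sums P Q p \<alpha> by fact
  interpret B: power_sums Q P p "\<lambda>n. (- 1) ^ n * \<alpha> n" using power_sums_mirror[OF assms] .
  have "\<forall>i. \<exists>x. (\<lambda>k. P k i) \<longlonglongrightarrow> x" "\<forall>i. \<exists>x. (\<lambda>k. Q k i) \<longlonglongrightarrow> x"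
    using A.P_convergent B.P_convergent by (simp_all add: convergent_def)
  then obtain l l' where l: "\<And>i. (\<lambda>k. P k i) \<longlonglongrightarrow> l i" and l': "\<And>i. (\<lambda>k. Q k i) \<longlonglongrightarrow> l' i"
    by metis
  have "\<alpha> n = (\<Sum>i. l i ^ n) + (- 1) ^ n * (\<Sum>i. l' i ^ n)" if n: "n > p" for n
  proof (rule LIMSEQ_unique)
    show "(\<lambda>k. \<Sum>i. P k i ^ n + (- Q k i) ^ n) \<longlonglongrightarrow> \<alpha> n" using n by (intro A.lim) simp
    have "(\<Sum>i. P k i ^ n + (- Q k i) ^ n) = (\<Sum>i. P k i ^ n) + (- 1) ^ n * (\<Sum>i. Q k i ^ n)" for k
    proof -
      have s: "summable (\<lambda>i. P k i ^ n)" "summable (\<lambda>i. Q k i ^ n)"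
        using A.P_power_summable[of n] B.P_power_summable[of n] n by auto
      have "(\<lambda>i. P k i ^ n + (- Q k i) ^ n) = (\<lambda>i. P k i ^ n + (- 1) ^ n * Q k i ^ n)"
        by (simp flip: power_mult_distrib)
      then show ?thesis using s by (simp add: suminf_add suminf_mult summable_mult flip: suminf_add)
    qed
    moreover have "(\<lambda>k. (\<Sum>i. P k i ^ n) + (- 1) ^ n * (\<Sum>i. Q k i ^ n)) \<longlonglongrightarrow>
        (\<Sum>i. l i ^ n) + (- 1) ^ n * (\<Sum>i. l' i ^ n)"
      by (intro tendsto_intros A.P_limit_power_sum B.P_limit_power_sum l l' n)
    ultimately show "(\<lambda>k. \<Sum>i. P k i ^ n + (- Q k i) ^ n) \<longlonglongrightarrow>
        (\<Sum>i. l i ^ n) + (- 1) ^ n * (\<Sum>i. l' i ^ n)" by simp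
  qed
  then show thesis
    using that[OF l A.P_limit_decseq[OF l] A.P_limit_nonneg[OF l] A.P_limit_summable[OF l]
        l' B.P_limit_decseq[OF l'] B.P_limit_nonneg[OF l'] B.P_limit_summable[OF l']] by blast
qed

section \<open>The eigenvalue lists of an operator\<close>

lemma finite_superlevel:
  fixes g :: "'b \<Rightarrow> real"
  assumes g: "g summable_on F" "\<And>f. f \<in> F \<Longrightarrow> g f \<ge> 0" and \<epsilon>: "\<epsilon> > 0"
  shows "finite {f \<in> F. g f \<ge> \<epsilon>}"
proof (rule ccontr)
  assume inf: "infinite {f \<in> F. g f \<ge> \<epsilon>}"
  obtain n :: nat where n: "infsum g F < real n * \<epsilon>" using reals_Archimedean3[OF \<epsilon>] by blast
  obtain B where B: "B \<subseteq> {f \<in> F. g f \<ge> \<epsilon>}" "finite B" "card B = n"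
    using infinite_arbitrarily_large[OF inf] by blast
  have "real n * \<epsilon> = (\<Sum>f\<in>B. \<epsilon>)" using B(3) by simp
  also have "\<dots> \<le> sum g B" using B(1) by (intro sum_mono) auto
  also have "\<dots> \<le> infsum g F"
    using B g by (intro finite_sum_le_infsum) auto
  finally show False using n by simp
qed

lemma abs_power_summable_mono:
  fixes \<mu> :: "'b \<Rightarrow> real"
  assumes s: "(\<lambda>f. \<bar>\<mu> f\<bar> ^ p) summable_on F" and n: "n \<ge> p" "p > 0"
  shows "(\<lambda>f. \<bar>\<mu> f\<bar> ^ n) summable_on F"
proof -
  define R where "R = max 1 (\<Sum>\<^sub>\<infinity>f\<in>F. \<bar>\<mu> f\<bar> ^ p)"
  have R: "\<bar>\<mu> f\<bar> \<le> R" if f: "f \<in> F" for f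
  proof (cases "\<bar>\<mu> f\<bar> \<le> 1")
    case False
    have "\<bar>\<mu> f\<bar> ^ 1 \<le> \<bar>\<mu> f\<bar> ^ p" using False n by (intro power_increasing) auto
    also have "\<dots> = (\<Sum>g\<in>{f}. \<bar>\<mu> g\<bar> ^ p)" by simp
    also have "\<dots> \<le> (\<Sum>\<^sub>\<infinity>f\<in>F. \<bar>\<mu> f\<bar> ^ p)" using f by (intro finite_sum_le_infsum s) auto
    finally show ?thesis by (simp add: R_def)
  qed (simp add: R_def)
  have "(\<lambda>f. R ^ (n - p) * \<bar>\<mu> f\<bar> ^ p) summable_on F" by (intro summable_on_cmult_right s)
  then show ?thesis
  proof (rule summable_on_comparison_test)
    fix f assume "f \<in> F"
    have "\<bar>\<mu> f\<bar> ^ n = \<bar>\<mu> f\<bar> ^ (n - p) * \<bar>\<mu> f\<bar> ^ p" using n by (simp flip: power_add)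
    also have "\<dots> \<le> R ^ (n - p) * \<bar>\<mu> f\<bar> ^ p"
      using R[OF \<open>f \<in> F\<close>] by (intro mult_right_mono power_mono) auto
    finally show "\<bar>\<mu> f\<bar> ^ n \<le> R ^ (n - p) * \<bar>\<mu> f\<bar> ^ p" .
  qed simp
qed

text \<open>Split the basis by the sign of the eigenvalue. \<open>Q\<close> lists absolute values,
  which accounts for the sign \<open>(- 1) ^ n\<close>; the kernel contributes nothing since
  \<open>n\<close> is positive.\<close>

lemma eigenvalue_lists_power_sum:
  fixes \<mu> :: "'b \<Rightarrow> real"
  assumes P: "eigenvalue_list (\<lambda>t. card {f \<in> F. \<mu> f = t}) P"
    and Q: "eigenvalue_list (\<lambda>t. card {f \<in> F. - \<mu> f = t}) Q"
    and fin: "\<And>\<epsilon>. \<epsilon> > 0 \<Longrightarrow> finite {f \<in> F. \<mu> f \<ge> \<epsilon>}" "\<And>\<epsilon>. \<epsilon> > 0 \<Longrightarrow> finite {f \<in> F. - \<mu> f \<ge> \<epsilon>}"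
    and n: "n > 0" and s: "(\<lambda>f. \<bar>\<mu> f\<bar> ^ n) summable_on F"
  shows "summable (\<lambda>i. P i ^ n)" "summable (\<lambda>i. Q i ^ n)"
    "(\<Sum>\<^sub>\<infinity>f\<in>F. \<mu> f ^ n) = (\<Sum>i. P i ^ n) + (- 1) ^ n * (\<Sum>i. Q i ^ n)"
proof -
  let ?A = "{f \<in> F. \<mu> f > 0}" and ?B = "{f \<in> F. - \<mu> f > 0}"
  have "(\<lambda>f. \<mu> f ^ n) summable_on F"
    by (rule abs_summable_summable) (use s in \<open>simp add: power_abs\<close>)
  then have "(\<lambda>f. \<mu> f ^ n) summable_on ?A" "(\<lambda>f. \<mu> f ^ n) summable_on ?B"
    by (rule summable_on_subset_banach, blast)+
  then obtain S S' where S: "((\<lambda>f. \<mu> f ^ n) has_sum S) ?A" and S': "((\<lambda>f. \<mu> f ^ n) has_sum S') ?B"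
    by (auto simp: summable_on_def)
  have "((\<lambda>f. (- 1) ^ n * \<mu> f ^ n) has_sum (- 1) ^ n * S') ?B" by (rule has_sum_cmult_right[OF S'])
  then have S'': "((\<lambda>f. (- \<mu> f) ^ n) has_sum (- 1) ^ n * S') ?B" by (simp flip: power_mult_distrib)
  note P_sum = eigenvalue_list_power_sum[OF P fin(1) n S]
  note Q_sum = eigenvalue_list_power_sum[OF Q fin(2) n S'']
  show "summable (\<lambda>i. P i ^ n)" by (rule P_sum(2))
  show "summable (\<lambda>i. Q i ^ n)" by (rule Q_sum(2))
  have "((\<lambda>f. \<mu> f ^ n) has_sum (S + S')) (?A \<union> ?B)" by (rule has_sum_Un_disjoint[OF S S']) auto
  moreover have "((\<lambda>f. \<mu> f ^ n) has_sum (S + S')) (?A \<union> ?B) \<longleftrightarrow> ((\<lambda>f. \<mu> f ^ n) has_sum (S + S')) F"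
    using n by (intro has_sum_cong_neutral) (auto simp: zero_power)
  ultimately have "(\<Sum>\<^sub>\<infinity>f\<in>F. \<mu> f ^ n) = S + S'" by (simp add: infsumI)
  moreover have "(\<Sum>i. P i ^ n) = S" "(\<Sum>i. Q i ^ n) = (- 1) ^ n * S'"
    using P_sum(1) Q_sum(1) by (simp_all add: sums_iff)
  moreover have "(- 1) ^ n * ((- 1) ^ n * S') = S'" by (simp flip: mult.assoc power_mult_distrib)
  ultimately show "(\<Sum>\<^sub>\<infinity>f\<in>F. \<mu> f ^ n) = (\<Sum>i. P i ^ n) + (- 1) ^ n * (\<Sum>i. Q i ^ n)" by simp
qed

context selfadjoint_operator
begin

context
  fixes F and \<mu> :: "'a \<Rightarrow> real" and p :: nat
  assumes F: "orthonormal_basis H F" and eig: "\<And>f. f \<in> F \<Longrightarrow> T f = hscale H (complex_of_real (\<mu> f)) f"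
    and p: "p > 0" and summable: "(\<lambda>f. \<bar>\<mu> f\<bar> ^ p) summable_on F"
begin

lemma finite_eigenvalues_ge:
  assumes "\<epsilon> > 0"
  shows "finite {f \<in> F. \<mu> f \<ge> \<epsilon>}" "finite {f \<in> F. - \<mu> f \<ge> \<epsilon>}"
proof -
  have "finite {f \<in> F. \<bar>\<mu> f\<bar> ^ p \<ge> \<epsilon> ^ p}"
    using assms by (intro finite_superlevel[OF summable]) auto
  moreover have "\<epsilon> ^ p \<le> \<bar>\<mu> f\<bar> ^ p" if "\<epsilon> \<le> \<mu> f \<or> \<epsilon> \<le> - \<mu> f" for f
    using that assms by (intro power_mono) auto
  then have "{f \<in> F. \<mu> f \<ge> \<epsilon>} \<subseteq> {f \<in> F. \<bar>\<mu> f\<bar> ^ p \<ge> \<epsilon> ^ p}" "{f \<in> F. - \<mu> f \<ge> \<epsilon>} \<subseteq> {f \<in> F. \<bar>\<mu> f\<bar> ^ p \<ge> \<epsilon> ^ p}"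
    by blast+
  ultimately show "finite {f \<in> F. \<mu> f \<ge> \<epsilon>}" "finite {f \<in> F. - \<mu> f \<ge> \<epsilon>}"
    using finite_subset by blast+
qed

text \<open>At positive levels multiplicities are counts in the basis, so the description in
  \<open>eigenvalue_plus\<close> amounts to \<open>eigenvalue_list\<close>, whose solution is
  unique.\<close>

lemma eigenvalue_plus_eq:
  assumes l: "eigenvalue_list (\<lambda>t. card {f \<in> F. \<mu> f = t}) l"
  shows "eigenvalue_plus H T = l"
proof -
  have mlt: "eigenvalue_multiplicity H T t = card {f \<in> F. \<mu> f = t}" if "t > 0" for t
    by (rule eigenvalue_multiplicity_eq_card[OF F eig])
       (auto intro: finite_subset[OF _ finite_eigenvalues_ge(1)[OF that]])
  have iff: "nonneg_eigenvalue_list H T l' \<longleftrightarrow> eigenvalue_list (\<lambda>t. card {f \<in> F. \<mu> f = t}) l'" for l'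
    unfolding nonneg_eigenvalue_list_def eigenvalue_list_def by (simp add: mlt)
  then show ?thesis
    unfolding eigenvalue_plus_def
  proof (intro the_equality)
    show "l' = l" if "nonneg_eigenvalue_list H T l'" for l'
      by (rule eigenvalue_list_unique[OF _ l finite_eigenvalues_ge(1)]) (use that iff in simp)
  qed (use l iff in simp)
qed

text \<open>Negation turns a nonpositive list for \<open>T\<close> into an
  \<open>eigenvalue_list\<close> for \<open>- \<mu>\<close>, to which uniqueness applies.\<close>

lemma eigenvalue_minus_eq:
  assumes l: "eigenvalue_list (\<lambda>t. card {f \<in> F. - \<mu> f = t}) l"
  shows "eigenvalue_minus H T = (\<lambda>i. - l i)"
proof -
  have mlt: "eigenvalue_multiplicity H T (- t) = card {f \<in> F. - \<mu> f = t}" if "t > 0" for t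
  proof -
    have *: "{f \<in> F. - \<mu> f = t} = {f \<in> F. \<mu> f = - t}" by auto
    have "finite {f \<in> F. \<mu> f = - t}"
      by (rule finite_subset[OF _ finite_eigenvalues_ge(2)[OF that]]) auto
    then show ?thesis unfolding * by (intro eigenvalue_multiplicity_eq_card[OF F eig])
  qed
  have iff: "nonpos_eigenvalue_list H T l' \<longleftrightarrow> eigenvalue_list (\<lambda>t. card {f \<in> F. - \<mu> f = t}) (\<lambda>i. - l' i)" for l'
  proof -
    have "(\<forall>t<0. finite {i. l' i = t} \<and> card {i. l' i = t} = eigenvalue_multiplicity H T t) \<longleftrightarrow>
        (\<forall>t>0. finite {i. l' i = - t} \<and> card {i. l' i = - t} = eigenvalue_multiplicity H T (- t))"
      by (metis neg_0_less_iff_less neg_less_0_iff_less minus_minus)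
    moreover have "{i. l' i = - t} = {i. - l' i = t}" for t by auto
    moreover have "incseq l' \<longleftrightarrow> decseq (\<lambda>i. - l' i)" by (simp add: incseq_def decseq_def)
    ultimately show ?thesis
      unfolding nonpos_eigenvalue_list_def eigenvalue_list_def by (simp add: mlt)
  qed
  show ?thesis
    unfolding eigenvalue_minus_def
  proof (rule the_equality)
    show "nonpos_eigenvalue_list H T (\<lambda>i. - l i)" using l by (simp add: iff)
    fix l' assume "nonpos_eigenvalue_list H T l'"
    then have "(\<lambda>i. - l' i) = l"
      by (intro eigenvalue_list_unique[OF _ l finite_eigenvalues_ge(2)]) (simp_all add: iff)
    then show "l' = (\<lambda>i. - l i)" by auto
  qed
qed

end

end

text \<open>What the limit argument has to know of a single operator, with basis and eigenvectors
  eliminated.\<close>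

lemma (in finite_trace_operator) eigenvalue_lists:
  assumes m: "m > 0"
  obtains P Q where
    "eigenvalue_plus H T = P" "eigenvalue_minus H T = (\<lambda>i. - Q i)"
    "decseq P" "decseq Q" "\<And>i. P i \<ge> 0" "\<And>i. Q i \<ge> 0"
    "\<And>n. n \<ge> 2 * m \<Longrightarrow> summable (\<lambda>i. P i ^ n)" "\<And>n. n \<ge> 2 * m \<Longrightarrow> summable (\<lambda>i. Q i ^ n)"
    "\<And>n. n \<ge> 2 * m \<Longrightarrow> operator_trace H (T ^^ n) =
      complex_of_real ((\<Sum>i. P i ^ n) + (- 1) ^ n * (\<Sum>i. Q i ^ n))"
proof -
  obtain F \<mu> where F: "orthonormal_basis H F"
    and eig: "\<And>f. f \<in> F \<Longrightarrow> T f = hscale H (complex_of_real (\<mu> f)) f"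
    using spectral_theorem by blast
  have p: "2 * m > 0" using m by simp
  have s: "(\<lambda>f. \<bar>\<mu> f\<bar> ^ (2 * m)) summable_on F" by (rule eigenvalues_summable[OF F eig])
  note fin = finite_eigenvalues_ge[OF F eig p s]
  obtain P where P: "eigenvalue_list (\<lambda>t. card {f \<in> F. \<mu> f = t}) P"
    using eigenvalue_list_exists[OF fin(1)] by blast
  obtain Q where Q: "eigenvalue_list (\<lambda>t. card {f \<in> F. - \<mu> f = t}) Q"
    using eigenvalue_list_exists[where \<mu> = "\<lambda>f. - \<mu> f", OF fin(2)] by blast
  have s': "(\<lambda>f. \<bar>\<mu> f\<bar> ^ n) summable_on F" if "n \<ge> 2 * m" for n
    by (rule abs_power_summable_mono[OF s that p])
  show thesis
  proof (rule that[of P Q])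
    show "eigenvalue_plus H T = P" by (rule eigenvalue_plus_eq[OF F eig p s P])
    show "eigenvalue_minus H T = (\<lambda>i. - Q i)" by (rule eigenvalue_minus_eq[OF F eig p s Q])
    show "decseq P" "decseq Q" "P i \<ge> 0" "Q i \<ge> 0" for i using P Q by (auto simp: eigenvalue_list_def)
    fix n assume n: "n \<ge> 2 * m"
    have n0: "n > 0" using n m by simp
    have sums: "summable (\<lambda>i. P i ^ n)" "summable (\<lambda>i. Q i ^ n)"
      "(\<Sum>\<^sub>\<infinity>f\<in>F. \<mu> f ^ n) = (\<Sum>i. P i ^ n) + (- 1) ^ n * (\<Sum>i. Q i ^ n)"
      by (intro eigenvalue_lists_power_sum[OF P Q _ _ n0 s'[OF n]] fin; assumption)+
    show "summable (\<lambda>i. P i ^ n)" "summable (\<lambda>i. Q i ^ n)" by fact+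
    have "has_trace H (T ^^ n) (complex_of_real (\<Sum>\<^sub>\<infinity>f\<in>F. \<mu> f ^ n))"
      using n by (intro has_trace_eigenvalues[OF F eig _ s'[OF n]]) auto
    then show "operator_trace H (T ^^ n) =
        complex_of_real ((\<Sum>i. P i ^ n) + (- 1) ^ n * (\<Sum>i. Q i ^ n))"
      unfolding sums(3)[symmetric] by (rule operator_trace_eq)
  qed
qed

text \<open>For even exponents \<open>|T|\<^sup>p = T\<^sup>p\<close>.\<close>

lemma (in selfadjoint_operator) schatten_class_has_trace:
  assumes "T \<in> schatten_class H (2 * m)"
  obtains t where "has_trace H (T ^^ (2 * m)) t"
proof -
  obtain P t S where P: "positive_operator H P" and S: "is_adjoint H T S"
    and PP: "\<And>x. x \<in> hcarrier H \<Longrightarrow> P (P x) = S (T x)" and t: "has_trace H (P ^^ (2 * m)) t"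
    using assms unfolding schatten_class_def is_absolute_value_def by blast
  have Sc: "S x \<in> hcarrier H" if "x \<in> hcarrier H" for x
    using S that by (auto simp: is_adjoint_def bounded_operator_def)
  have ST: "S y = T y" if y: "y \<in> hcarrier H" for y
  proof -
    have "hinner H x (S y) = hinner H x (T y)" if "x \<in> hcarrier H" for x
      using S that y op_simps(4)[OF that y] unfolding is_adjoint_def by metis
    then have "hinner H x (S y - T y) = 0" if "x \<in> hcarrier H" for x
      using that Sc[OF y] op_simps(1)[OF y] y by (simp add: inner_diff_right)
    then show ?thesis using inner_definite[of "S y - T y"] Sc[OF y] op_simps(1)[OF y] by simp
  qed
  \<comment> \<open>Comparing squares is enough: \<open>P (P x)\<close> equals
    \<open>T (T x)\<close>, and the exponent is even, so \<open>P\<close> itself is never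
    determined.\<close>
  have PT: "(P ^^ (2 * j)) x = (T ^^ (2 * j)) x" if x: "x \<in> hcarrier H" for j x
  proof (induction j)
    case (Suc j)
    have "(P ^^ (2 * Suc j)) x = P (P ((T ^^ (2 * j)) x))" using Suc by simp
    also have "\<dots> = T (T ((T ^^ (2 * j)) x))" using x by (simp add: PP ST op_simps)
    finally show ?case by simp
  qed simp
  have "hinner H ((P ^^ (2 * m)) e) e = hinner H ((T ^^ (2 * m)) e) e" if "orthonormal_basis H E" "e \<in> E" for E e
  proof -
    have "e \<in> hcarrier H" using that by (auto simp: orthonormal_basis_def)
    then show ?thesis using PT by simp
  qed
  then have "has_trace H (T ^^ (2 * m)) t"
    using t unfolding has_trace_def by (metis (no_types, lifting) has_sum_cong)
  then show thesis by (rule that)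
qed

text \<open>Completeness, in the form in which \<open>l2_complete\<close> delivers it, provides a
  limit \<open>z\<close> of finite projections \<open>y n\<close> of \<open>x\<close>. The
  difference \<open>x - z\<close> is orthogonal to the basis, so \<open>z = x\<close>, and the
  defect in Parseval's identity, bounded by the squared distances from \<open>y n\<close> to
  \<open>x\<close>, vanishes.\<close>

lemma (in inner_product_space) Parseval_complete:
  assumes complete: "\<And>y. (\<And>k. y k \<in> hcarrier H) \<Longrightarrow>
      (\<And>\<epsilon>. \<epsilon> > 0 \<Longrightarrow> \<exists>N. \<forall>k\<ge>N. \<forall>l\<ge>N. hnorm H (y k - y l) < \<epsilon>) \<Longrightarrow>
      \<exists>x\<in>hcarrier H. (\<lambda>k. hnorm H (y k - x)) \<longlonglongrightarrow> 0"
    and E: "orthonormal_basis H E" and x: "x \<in> hcarrier H"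
  shows "((\<lambda>e. (cmod (hinner H x e))\<^sup>2) has_sum (hnorm H x)\<^sup>2) E"
proof -
  let ?g = "\<lambda>e. (cmod (hinner H x e))\<^sup>2"
  have oE: "orthonormal E" using E by (simp add: orthonormal_basis_iff)
  have "?g summable_on E"
  proof (rule nonneg_bounded_partial_sums_imp_summable_on)
    show "\<forall>\<^sub>F F in finite_subsets_at_top E. sum ?g F \<le> (hnorm H x)\<^sup>2"
      using Bessel_finite[OF orthonormal_subset[OF oE] _ x]
      by (intro eventually_finite_subsets_at_top_weakI)
  qed simp
  then obtain S where S: "(?g has_sum S) E" by (auto simp: summable_on_def)
  have below: "sum ?g F \<le> S" if "finite F" "F \<subseteq> E" for F
    using that by (intro finite_sum_le_has_sum[OF S]) auto
  have "\<exists>F. finite F \<and> F \<subseteq> E \<and> S - sum ?g F < 1 / real (Suc n)" for n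
  proof -
    have "\<forall>\<^sub>F F in finite_subsets_at_top E. dist (sum ?g F) S < 1 / real (Suc n)"
      using S unfolding has_sum_def by (rule tendstoD) simp
    then obtain F where "finite F" "F \<subseteq> E" "dist (sum ?g F) S < 1 / real (Suc n)"
      unfolding eventually_finite_subsets_at_top by blast
    then show ?thesis by (intro exI[of _ F]) (auto simp: dist_real_def)
  qed
  then obtain F where F: "\<And>n. finite (F n)" "\<And>n. F n \<subseteq> E" "\<And>n. S - sum ?g (F n) < 1 / real (Suc n)"
    by metis
  have oF: "orthonormal (F n)" for n using orthonormal_subset[OF oE F(2)] .
  define y where "y n = proj (F n) x" for n
  have yc [simp]: "y n \<in> hcarrier H" for n using oF by (simp add: y_def)
  \<comment> \<open>\<open>proj G x - y n\<close> is the residual of \<open>proj G x\<close> with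
    respect to \<open>F n\<close>, so its squared norm is the part of the sum over \<open>G\<close>
    outside \<open>F n\<close>.\<close>
  have tail: "(hnorm H (proj G x - y n))\<^sup>2 \<le> 1 / real (Suc n)" if G: "finite G" "F n \<subseteq> G" "G \<subseteq> E" for G n
  proof -
    have oG: "orthonormal G" using orthonormal_subset[OF oE G(3)] .
    have mem: "hinner H (proj G x) e = hinner H x e" if "e \<in> F n" for e
      using that G(2) by (intro inner_proj_member[OF oG G(1)]) auto
    then have "proj (F n) (proj G x) = y n" unfolding y_def proj_def by (intro sum.cong) auto
    then have "(hnorm H (proj G x - y n))\<^sup>2 = (hnorm H (proj G x))\<^sup>2 - (\<Sum>e\<in>F n. (cmod (hinner H (proj G x) e))\<^sup>2)"
      using hnorm_residual_sq[OF oF[of n] F(1)[of n] proj_carrier[OF oG, of x]] by simp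
    also have "\<dots> = sum ?g G - sum ?g (F n)"
      using mem by (simp add: hnorm_proj_sq(1)[OF oG G(1) x])
    also have "\<dots> \<le> 1 / real (Suc n)" using below[OF G(1,3)] F(3)[of n] by linarith
    finally show ?thesis .
  qed
  have "\<exists>N. \<forall>k\<ge>N. \<forall>l\<ge>N. hnorm H (y k - y l) < \<epsilon>" if \<epsilon>: "\<epsilon> > 0" for \<epsilon> :: real
  proof -
    obtain N where N: "1 / real (Suc N) < (\<epsilon> / 2)\<^sup>2"
      using nat_approx_posE[of "(\<epsilon> / 2)\<^sup>2"] \<epsilon> by (metis half_gt_zero zero_less_power)
    have "hnorm H (y k - y l) < \<epsilon>" if kl: "k \<ge> N" "l \<ge> N" for k l
    proof -
      \<comment> \<open>The sets \<open>F n\<close> need not be nested, so \<open>y k\<close> and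
        \<open>y l\<close> are compared through a common superset.\<close>
      define G where "G = F k \<union> F l"
      have G: "finite G" "F k \<subseteq> G" "F l \<subseteq> G" "G \<subseteq> E" using F(1,2) by (auto simp: G_def)
      have oG: "orthonormal G" using orthonormal_subset[OF oE G(4)] .
      have half: "hnorm H (proj G x - y j) < \<epsilon> / 2" if "j \<ge> N" "F j \<subseteq> G" for j
      proof (rule power2_less_imp_less)
        have "1 / real (Suc j) \<le> 1 / real (Suc N)" using that(1) by (simp add: frac_le)
        then show "(hnorm H (proj G x - y j))\<^sup>2 < (\<epsilon> / 2)\<^sup>2"
          using tail[OF G(1) that(2) G(4)] N by linarith
      qed (use \<epsilon> in simp)
      have "y k - y l = (proj G x - y l) - (proj G x - y k)" by simp
      then have "hnorm H (y k - y l) \<le> hnorm H (proj G x - y l) + hnorm H (proj G x - y k)"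
        using hnorm_triangle_diff[of "proj G x - y l" "proj G x - y k"] oG by simp
      then show ?thesis using half[OF kl(1) G(2)] half[OF kl(2) G(3)] by linarith
    qed
    then show ?thesis by blast
  qed
  then obtain z where z: "z \<in> hcarrier H" "(\<lambda>k. hnorm H (y k - z)) \<longlonglongrightarrow> 0"
    using complete[of y] yc by blast
  have inv: "(\<lambda>n. sqrt (1 / real (Suc n))) \<longlonglongrightarrow> 0"
    using tendsto_real_sqrt[OF LIMSEQ_inverse_real_of_nat] by (simp add: divide_inverse)
  have "hinner H (x - z) e = 0" if e: "e \<in> E" for e
  proof -
    have ec: "e \<in> hcarrier H" "hnorm H e = 1" using orthonormalD[OF oE e] by auto
    \<comment> \<open>A basis vector missing from \<open>F n\<close> has its squared coordinate in
      the tail \<open>S - sum ?g (F n)\<close>.\<close>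
    have 1: "cmod (hinner H (x - y n) e) \<le> sqrt (1 / real (Suc n))" for n
    proof (cases "e \<in> F n")
      case True
      then show ?thesis using residual_orthogonal[OF oF F(1) True x] by (simp add: y_def)
    next
      case False
      have "hinner H (y n) e = (\<Sum>f\<in>F n. 0)"
        unfolding y_def inner_proj_left[OF oF ec(1)]
      proof (intro sum.cong refl)
        fix f assume "f \<in> F n"
        then have "hinner H f e = 0" using orthonormalD(3)[OF oE _ e, of f] F(2) False by blast
        then show "hinner H x f * hinner H f e = 0" by simp
      qed
      then have "hinner H (x - y n) e = hinner H x e" using x ec by (simp add: inner_diff_left)
      moreover have "?g e + sum ?g (F n) \<le> S"
        using below[of "insert e (F n)"] False F(1,2) e by simp
      then have "?g e \<le> 1 / real (Suc n)" using F(3)[of n] by linarith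
      ultimately show ?thesis by (metis norm_ge_zero real_le_rsqrt)
    qed
    have "cmod (hinner H (x - z) e) \<le> sqrt (1 / real (Suc n)) + hnorm H (y n - z)" for n
    proof -
      have "hinner H (x - z) e = hinner H (x - y n) e + hinner H (y n - z) e"
        using x z(1) ec by (simp add: inner_diff_left)
      then have "cmod (hinner H (x - z) e) \<le> cmod (hinner H (x - y n) e) + cmod (hinner H (y n - z) e)"
        using norm_triangle_ineq by metis
      moreover have "cmod (hinner H (y n - z) e) \<le> hnorm H (y n - z)"
        using Cauchy_Schwarz[of "y n - z" e] z(1) ec by simp
      ultimately show ?thesis using 1[of n] by linarith
    qed
    then have "cmod (hinner H (x - z) e) \<le> 0 + 0"
      by (intro LIMSEQ_le_const[OF tendsto_add[OF inv z(2)]]) blast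
    then show ?thesis by simp
  qed
  moreover have "x - z \<in> hcarrier H" using x z(1) by simp
  ultimately have "x - z = 0" using E unfolding orthonormal_basis_def by blast
  then have xz: "z = x" by simp
  have lim: "(\<lambda>n. (hnorm H (y n - x))\<^sup>2) \<longlonglongrightarrow> 0\<^sup>2" using z(2) unfolding xz by (intro tendsto_power)
  have "(hnorm H (y n - x))\<^sup>2 \<ge> (hnorm H x)\<^sup>2 - S" for n
    using hnorm_residual_sq[OF oF F(1) x, of n] below[OF F(1,2), of n] x
    by (simp add: y_def oF hnorm_diff_commute[of _ x])
  then have "(hnorm H x)\<^sup>2 - S \<le> 0\<^sup>2" by (intro LIMSEQ_le_const[OF lim]) blast
  moreover have "S \<le> (hnorm H x)\<^sup>2"
    by (rule has_sum_le_finite_sums[OF S]) (use Bessel_finite[OF orthonormal_subset[OF oE] _ x] in blast)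
  ultimately show ?thesis using S by simp
qed

section \<open>Diagonal operators on square-summable sequences\<close>

definition l2 :: "(nat \<Rightarrow> complex) hspace" where
  "l2 = \<lparr>hcarrier = {x. (\<lambda>i. (cmod (x i))\<^sup>2) summable_on UNIV},
         hscale = (\<lambda>c x i. c * x i),
         hinner = (\<lambda>x y. \<Sum>\<^sub>\<infinity>i. x i * cnj (y i))\<rparr>"

lemma l2_simps:
  "x \<in> hcarrier l2 \<longleftrightarrow> (\<lambda>i. (cmod (x i))\<^sup>2) summable_on UNIV"
  "hscale l2 c x = (\<lambda>i. c * x i)"
  "hinner l2 x y = (\<Sum>\<^sub>\<infinity>i. x i * cnj (y i))"
  by (simp_all add: l2_def)

text \<open>Divergent sums default to 0 on both sides; the norm formulas for \<open>l2\<close>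
  therefore hold off the carrier as well.\<close>

lemma infsum_of_real_complex: "(\<Sum>\<^sub>\<infinity>i\<in>A. complex_of_real (f i)) = complex_of_real (\<Sum>\<^sub>\<infinity>i\<in>A. f i)"
proof (cases "f summable_on A")
  case True
  then show ?thesis by (intro infsumI has_sum_of_real has_sum_infsum)
next
  case False
  have "\<not> (\<lambda>i. complex_of_real (f i)) summable_on A"
  proof
    assume "(\<lambda>i. complex_of_real (f i)) summable_on A"
    then have "(\<lambda>i. Re (complex_of_real (f i))) summable_on A" by (rule summable_on_Re)
    then show False using False by simp
  qed
  then show ?thesis using False by (simp add: infsum_not_exists)
qed

lemma l2_inner_same: "hinner l2 x x = complex_of_real (\<Sum>\<^sub>\<infinity>i. (cmod (x i))\<^sup>2)"
  unfolding l2_simps infsum_of_real_complex[symmetric]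
  by (intro infsum_cong) (simp add: complex_norm_square del: of_real_power)

lemma l2_norm: "hnorm l2 x = sqrt (\<Sum>\<^sub>\<infinity>i. (cmod (x i))\<^sup>2)"
  by (simp add: hnorm_def l2_inner_same)

lemma l2_norm_nonneg: "hnorm l2 x \<ge> 0"
  by (simp add: l2_norm infsum_nonneg)

lemma l2_norm_sq: "(hnorm l2 x)\<^sup>2 = (\<Sum>\<^sub>\<infinity>i. (cmod (x i))\<^sup>2)"
  by (simp add: l2_norm infsum_nonneg)

lemma l2_scale: "x \<in> hcarrier l2 \<Longrightarrow> (\<lambda>i. c * x i) \<in> hcarrier l2"
  unfolding l2_simps norm_mult power_mult_distrib by (rule summable_on_cmult_right)

lemma l2_bounded_mult:
  assumes d: "\<And>i. cmod (d i) \<le> B" and x: "x \<in> hcarrier l2"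
  shows "(\<lambda>i. d i * x i) \<in> hcarrier l2" "hnorm l2 (\<lambda>i. d i * x i) \<le> B * hnorm l2 x"
proof -
  have B: "B \<ge> 0" using d[of 0] norm_ge_zero order_trans by blast
  have le: "(cmod (d i * x i))\<^sup>2 \<le> B\<^sup>2 * (cmod (x i))\<^sup>2" for i
    using d[of i] by (simp add: norm_mult power_mult_distrib mult_right_mono power_mono)
  have s: "(\<lambda>i. B\<^sup>2 * (cmod (x i))\<^sup>2) summable_on UNIV"
    using x unfolding l2_simps by (rule summable_on_cmult_right)
  show 1: "(\<lambda>i. d i * x i) \<in> hcarrier l2"
    unfolding l2_simps by (rule summable_on_comparison_test[OF s]) (use le in auto)
  have "(\<Sum>\<^sub>\<infinity>i. (cmod (d i * x i))\<^sup>2) \<le> (\<Sum>\<^sub>\<infinity>i. B\<^sup>2 * (cmod (x i))\<^sup>2)"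
    using le 1 s unfolding l2_simps by (intro infsum_mono) auto
  also have "\<dots> = B\<^sup>2 * (\<Sum>\<^sub>\<infinity>i. (cmod (x i))\<^sup>2)" by (rule infsum_cmult_right')
  finally have "(hnorm l2 (\<lambda>i. d i * x i))\<^sup>2 \<le> (B * hnorm l2 x)\<^sup>2"
    by (simp add: l2_norm_sq power_mult_distrib)
  then show "hnorm l2 (\<lambda>i. d i * x i) \<le> B * hnorm l2 x"
    by (rule power2_le_imp_le) (use B l2_norm_nonneg in simp)
qed

lemma l2_add:
  assumes "x \<in> hcarrier l2" "y \<in> hcarrier l2"
  shows "x + y \<in> hcarrier l2"
proof -
  have "(cmod (x i + y i))\<^sup>2 \<le> 2 * (cmod (x i))\<^sup>2 + 2 * (cmod (y i))\<^sup>2" for i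
  proof -
    have "(cmod (x i + y i))\<^sup>2 \<le> (cmod (x i) + cmod (y i))\<^sup>2" by (intro power_mono norm_triangle_ineq) simp
    also have "\<dots> \<le> 2 * (cmod (x i))\<^sup>2 + 2 * (cmod (y i))\<^sup>2"
      using zero_le_power2[of "cmod (x i) - cmod (y i)"] by (simp add: power2_sum power2_diff)
    finally show ?thesis .
  qed
  then have le: "norm ((cmod ((x + y) i))\<^sup>2) \<le> 2 * (cmod (x i))\<^sup>2 + 2 * (cmod (y i))\<^sup>2" for i by simp
  have "(\<lambda>i. 2 * (cmod (x i))\<^sup>2 + 2 * (cmod (y i))\<^sup>2) summable_on UNIV"
    using assms unfolding l2_simps by (intro summable_on_add summable_on_cmult_right)
  then show ?thesis
    unfolding l2_simps by (rule summable_on_comparison_test) (use le in auto)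
qed

lemma l2_inner_summable:
  assumes "x \<in> hcarrier l2" "y \<in> hcarrier l2"
  shows "(\<lambda>i. x i * cnj (y i)) summable_on UNIV"
proof (rule abs_summable_summable)
  have "(\<lambda>i. (cmod (x i))\<^sup>2 + (cmod (y i))\<^sup>2) summable_on UNIV"
    using assms unfolding l2_simps by (rule summable_on_add)
  then show "(\<lambda>i. norm (x i * cnj (y i))) summable_on UNIV"
  proof (rule summable_on_comparison_test)
    fix i
    have "2 * (cmod (x i) * cmod (y i)) \<le> (cmod (x i))\<^sup>2 + (cmod (y i))\<^sup>2"
      using sum_squares_bound[of "cmod (x i)" "cmod (y i)"] by simp
    then show "norm (x i * cnj (y i)) \<le> (cmod (x i))\<^sup>2 + (cmod (y i))\<^sup>2"
      using mult_nonneg_nonneg[OF norm_ge_zero norm_ge_zero, of "x i" "y i"]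
      unfolding norm_mult complex_mod_cnj by linarith
  qed simp
qed

interpretation l2: inner_product_space l2
proof -
  have vs: "vector_space (hscale l2)"
    by standard (auto simp: l2_simps fun_eq_iff algebra_simps)
  then have md: "module (hscale l2)" by (simp add: module_iff_vector_space)
  show "inner_product_space l2"
  proof (intro inner_product_space.intro vs inner_product_space_axioms.intro)
    show "module.subspace (hscale l2) (hcarrier l2)"
      unfolding module.subspace_def[OF md]
    proof (intro conjI ballI allI)
      show "0 \<in> hcarrier l2" by (simp add: l2_simps)
      show "x + y \<in> hcarrier l2" if "x \<in> hcarrier l2" "y \<in> hcarrier l2" for x y using l2_add that .
      show "hscale l2 c x \<in> hcarrier l2" if "x \<in> hcarrier l2" for c x
        using l2_scale[OF that] by (simp add: l2_simps(2))
    qed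
    show "hinner l2 x y = cnj (hinner l2 y x)" for x y
      unfolding l2_simps by (simp flip: infsum_cnj add: mult.commute)
    show "hinner l2 (x + y) z = hinner l2 x z + hinner l2 y z"
      if "x \<in> hcarrier l2" "y \<in> hcarrier l2" "z \<in> hcarrier l2" for x y z
    proof -
      have "hinner l2 (x + y) z = (\<Sum>\<^sub>\<infinity>i. x i * cnj (z i) + y i * cnj (z i))"
        by (simp add: l2_simps distrib_right)
      also have "\<dots> = hinner l2 x z + hinner l2 y z"
        unfolding l2_simps(3) using that by (intro infsum_add l2_inner_summable)
      finally show ?thesis .
    qed
    show "hinner l2 (hscale l2 c x) y = c * hinner l2 x y" for c x y
      unfolding l2_simps mult.assoc by (rule infsum_cmult_right')
    show "hinner l2 x x \<in> \<real>\<^sub>\<ge>\<^sub>0" for x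
      unfolding l2_inner_same by (simp add: infsum_nonneg)
    show "x = 0" if x: "x \<in> hcarrier l2" and 0: "hinner l2 x x = 0" for x
    proof
      fix i
      have "(\<Sum>\<^sub>\<infinity>i. (cmod (x i))\<^sup>2) = 0" using 0 unfolding l2_inner_same by simp
      then have "(cmod (x i))\<^sup>2 = 0"
        using x unfolding l2_simps by (intro nonneg_infsum_le_0D[of "\<lambda>i. (cmod (x i))\<^sup>2" UNIV]) auto
      then show "x i = 0 i" by simp
    qed
  qed
qed

section \<open>Completeness of \<open>l2\<close>\<close>

lemma l2_coordinate_le: "x \<in> hcarrier l2 \<Longrightarrow> cmod (x i) \<le> hnorm l2 x"
proof (rule power2_le_imp_le)
  assume x: "x \<in> hcarrier l2"
  have "(cmod (x i))\<^sup>2 = (\<Sum>j\<in>{i}. (cmod (x j))\<^sup>2)" by simp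
  also have "\<dots> \<le> (\<Sum>\<^sub>\<infinity>j. (cmod (x j))\<^sup>2)"
    using x unfolding l2_simps by (intro finite_sum_le_infsum) auto
  finally show "(cmod (x i))\<^sup>2 \<le> (hnorm l2 x)\<^sup>2" by (simp add: l2_norm_sq)
qed (rule l2_norm_nonneg)

lemma l2_norm_leI:
  assumes "\<And>F. finite F \<Longrightarrow> (\<Sum>i\<in>F. (cmod (x i))\<^sup>2) \<le> B\<^sup>2" "B \<ge> 0"
  shows "x \<in> hcarrier l2" "hnorm l2 x \<le> B"
proof -
  show x: "x \<in> hcarrier l2"
    unfolding l2_simps
  proof (rule nonneg_bounded_partial_sums_imp_summable_on)
    show "\<forall>\<^sub>F F in finite_subsets_at_top UNIV. (\<Sum>i\<in>F. (cmod (x i))\<^sup>2) \<le> B\<^sup>2"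
      using assms(1) by (intro eventually_finite_subsets_at_top_weakI)
  qed simp
  have "(hnorm l2 x)\<^sup>2 \<le> B\<^sup>2"
    unfolding l2_norm_sq using x assms(1) unfolding l2_simps by (intro infsum_le_finite_sums)
  then show "hnorm l2 x \<le> B" using assms(2) by (rule power2_le_imp_le)
qed

text \<open>The limit is taken coordinatewise; on finitely many coordinates the Cauchy estimate
  passes to the limit, and \<open>l2_norm_leI\<close> collects these bounds into a norm
  bound.\<close>

lemma l2_complete:
  assumes y: "\<And>k. y k \<in> hcarrier l2"
    and Cauchy: "\<And>\<epsilon>. \<epsilon> > 0 \<Longrightarrow> \<exists>N. \<forall>k\<ge>N. \<forall>l\<ge>N. hnorm l2 (y k - y l) < \<epsilon>"
  shows "\<exists>x\<in>hcarrier l2. (\<lambda>k. hnorm l2 (y k - x)) \<longlonglongrightarrow> 0"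
proof -
  have "\<exists>c. (\<lambda>k. y k i) \<longlonglongrightarrow> c" for i
  proof -
    have "Cauchy (\<lambda>k. y k i)"
    proof (rule metric_CauchyI)
      fix \<epsilon> :: real assume "\<epsilon> > 0"
      then obtain N where N: "\<And>k l. k \<ge> N \<Longrightarrow> l \<ge> N \<Longrightarrow> hnorm l2 (y k - y l) < \<epsilon>" using Cauchy by blast
      have "dist (y k i) (y l i) < \<epsilon>" if "k \<ge> N" "l \<ge> N" for k l
        using l2_coordinate_le[of "y k - y l" i] N[OF that] y by (simp add: dist_norm)
      then show "\<exists>N. \<forall>k\<ge>N. \<forall>l\<ge>N. dist (y k i) (y l i) < \<epsilon>" by blast
    qed
    then show ?thesis using Cauchy_convergent_iff convergent_def by blast
  qed
  then obtain x where x: "\<And>i. (\<lambda>k. y k i) \<longlonglongrightarrow> x i" by metis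
  have near: "\<exists>N. \<forall>k\<ge>N. y k - x \<in> hcarrier l2 \<and> hnorm l2 (y k - x) \<le> \<epsilon>" if \<epsilon>: "\<epsilon> > 0" for \<epsilon>
  proof -
    obtain N where N: "\<And>k l. k \<ge> N \<Longrightarrow> l \<ge> N \<Longrightarrow> hnorm l2 (y k - y l) < \<epsilon>" using Cauchy[OF \<epsilon>] by blast
    have "(\<Sum>i\<in>F. (cmod ((y k - x) i))\<^sup>2) \<le> \<epsilon>\<^sup>2" if k: "k \<ge> N" and F: "finite F" for k F
    proof (rule LIMSEQ_le_const2)
      show "(\<lambda>l. \<Sum>i\<in>F. (cmod (y k i - y l i))\<^sup>2) \<longlonglongrightarrow> (\<Sum>i\<in>F. (cmod ((y k - x) i))\<^sup>2)"
        unfolding minus_apply by (intro tendsto_intros x)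
      show "\<exists>N. \<forall>l\<ge>N. (\<Sum>i\<in>F. (cmod (y k i - y l i))\<^sup>2) \<le> \<epsilon>\<^sup>2"
      proof (intro exI allI impI)
        fix l assume l: "l \<ge> N"
        have "y k - y l \<in> hcarrier l2" using y by simp
        then have "(\<Sum>i\<in>F. (cmod ((y k - y l) i))\<^sup>2) \<le> (hnorm l2 (y k - y l))\<^sup>2"
          unfolding l2_norm_sq unfolding l2_simps using F by (intro finite_sum_le_infsum) auto
        also have "\<dots> \<le> \<epsilon>\<^sup>2" using N[OF k l] l2_norm_nonneg by (intro power_mono) auto
        finally show "(\<Sum>i\<in>F. (cmod (y k i - y l i))\<^sup>2) \<le> \<epsilon>\<^sup>2" by simp
      qed
    qed
    then have "\<forall>k\<ge>N. y k - x \<in> hcarrier l2 \<and> hnorm l2 (y k - x) \<le> \<epsilon>"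
      using l2_norm_leI[of _ \<epsilon>] \<epsilon> by (metis less_imp_le)
    then show ?thesis by blast
  qed
  obtain N where "y N - x \<in> hcarrier l2" using near[of 1] by auto
  then have "y N - (y N - x) \<in> hcarrier l2" by (rule l2.carrier_simps(3)[OF y])
  moreover have "y N - (y N - x) = x" by (rule ext) simp
  ultimately have xc: "x \<in> hcarrier l2" by metis
  have "(\<lambda>k. hnorm l2 (y k - x)) \<longlonglongrightarrow> 0"
  proof (rule LIMSEQ_I)
    fix r :: real assume "r > 0"
    then have "r / 2 > 0" by simp
    from near[OF this] obtain N where N: "\<forall>k\<ge>N. y k - x \<in> hcarrier l2 \<and> hnorm l2 (y k - x) \<le> r / 2" by blast
    have "norm (hnorm l2 (y k - x) - 0) < r" if "k \<ge> N" for k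
    proof -
      have "hnorm l2 (y k - x) \<le> r / 2" using N that by blast
      then show ?thesis using l2_norm_nonneg[of "y k - x"] \<open>r > 0\<close> unfolding real_norm_def by linarith
    qed
    then show "\<exists>N. \<forall>k\<ge>N. norm (hnorm l2 (y k - x) - 0) < r" by blast
  qed
  then show ?thesis using xc by blast
qed

text \<open>Outside the carrier the sums default to 0, so that \<^const>\<open>hdist\<close> is nonnegative everywhere.\<close>

lemma l2_metric: "Metric_space (hcarrier l2) (hdist l2)"
proof
  show "0 \<le> hdist l2 x y" for x y by (simp add: hdist_def l2_norm_nonneg)
  show "hdist l2 x y = hdist l2 y x" for x y by (simp add: hdist_def l2_norm norm_minus_commute)
  show "hdist l2 x y = 0 \<longleftrightarrow> x = y" if "x \<in> hcarrier l2" "y \<in> hcarrier l2" for x y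
    using l2.hnorm_eq_0[of "x - y"] that by (simp add: hdist_def)
  show "hdist l2 x z \<le> hdist l2 x y + hdist l2 y z"
    if "x \<in> hcarrier l2" "y \<in> hcarrier l2" "z \<in> hcarrier l2" for x y z
    using l2.hnorm_triangle[of "x - y" "y - z"] that by (simp add: hdist_def)
qed

lemma l2_mcomplete: "Metric_space.mcomplete (hcarrier l2) (hdist l2)"
proof -
  interpret M: Metric_space "hcarrier l2" "hdist l2" by (rule l2_metric)
  show ?thesis
    unfolding M.mcomplete_def
  proof (intro allI impI)
    fix \<sigma> assume \<sigma>: "M.MCauchy \<sigma>"
    have c: "\<sigma> k \<in> hcarrier l2" for k using \<sigma> unfolding M.MCauchy_def by blast
    have "\<exists>N. \<forall>k\<ge>N. \<forall>l\<ge>N. hnorm l2 (\<sigma> k - \<sigma> l) < \<epsilon>" if \<epsilon>: "\<epsilon> > 0" for \<epsilon>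
    proof -
      obtain N where "\<And>k l. N \<le> k \<Longrightarrow> N \<le> l \<Longrightarrow> hdist l2 (\<sigma> k) (\<sigma> l) < \<epsilon>"
        using \<sigma> \<epsilon> unfolding M.MCauchy_def by metis
      then show ?thesis unfolding hdist_def by blast
    qed
    from l2_complete[OF c this]
    obtain x where x: "x \<in> hcarrier l2" "(\<lambda>k. hnorm l2 (\<sigma> k - x)) \<longlonglongrightarrow> 0" by blast
    then have "limitin M.mtopology \<sigma> x sequentially"
      unfolding M.limitin_metric_dist_null hdist_def using c by (intro conjI always_eventually allI) simp_all
    then show "\<exists>x. limitin M.mtopology \<sigma> x sequentially" by blast
  qed
qed

section \<open>Separability of \<open>l2\<close>\<close>

lemma complex_rational_approx:
  assumes "\<delta> > 0"
  shows "\<exists>q :: rat \<times> rat. cmod (z - Complex (of_rat (fst q)) (of_rat (snd q))) < \<delta>"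
proof -
  have "\<exists>r :: rat. \<bar>x - of_rat r\<bar> < \<delta> / 2" for x :: real
  proof -
    obtain r where "x < of_rat r" "of_rat r < x + \<delta> / 2"
      using of_rat_dense[of x "x + \<delta> / 2"] assms by auto
    then show ?thesis by (intro exI[of _ r]) auto
  qed
  then obtain r s where rs: "\<bar>Re z - of_rat r\<bar> < \<delta> / 2" "\<bar>Im z - of_rat s\<bar> < \<delta> / 2" by metis
  have "cmod (z - Complex (of_rat r) (of_rat s)) \<le> \<bar>Re z - of_rat r\<bar> + \<bar>Im z - of_rat s\<bar>"
    using cmod_le[of "z - Complex (of_rat r) (of_rat s)"] by simp
  then show ?thesis using rs by (intro exI[of _ "(r, s)"]) simp
qed

text \<open>Indexing by lists of rationals makes the countability of the dense set a matter of its
  type.\<close>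

definition rational_sequence :: "(rat \<times> rat) list \<Rightarrow> nat \<Rightarrow> complex" where
  "rational_sequence qs i =
    (if i < length qs then Complex (of_rat (fst (qs ! i))) (of_rat (snd (qs ! i))) else 0)"

lemma rational_sequence_l2: "rational_sequence qs \<in> hcarrier l2"
proof -
  have "(\<lambda>i. (cmod (rational_sequence qs i))\<^sup>2) summable_on {..<length qs}" by simp
  moreover have "(\<lambda>i. (cmod (rational_sequence qs i))\<^sup>2) summable_on {..<length qs} \<longleftrightarrow>
      (\<lambda>i. (cmod (rational_sequence qs i))\<^sup>2) summable_on UNIV"
    by (intro summable_on_cong_neutral) (auto simp: rational_sequence_def)
  ultimately show ?thesis by (simp add: l2_simps)
qed

lemma rational_sequence_dense:
  assumes x: "x \<in> hcarrier l2" and r: "r > 0"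
  shows "\<exists>qs. hnorm l2 (x - rational_sequence qs) < r"
proof -
  let ?S = "\<Sum>\<^sub>\<infinity>i. (cmod (x i))\<^sup>2"
  have S: "((\<lambda>i. (cmod (x i))\<^sup>2) has_sum ?S) UNIV"
    using x unfolding l2_simps by (rule has_sum_infsum)
  then have "(\<lambda>i. (cmod (x i))\<^sup>2) sums ?S" by (rule has_sum_imp_sums)
  then have "(\<lambda>n. \<Sum>i<n. (cmod (x i))\<^sup>2) \<longlonglongrightarrow> ?S" by (simp add: sums_def)
  moreover have r2: "r\<^sup>2 / 4 > 0" using r by simp
  ultimately obtain n where n: "\<bar>(\<Sum>i<n. (cmod (x i))\<^sup>2) - ?S\<bar> < r\<^sup>2 / 4"
    unfolding LIMSEQ_iff real_norm_def by (metis order_refl)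
  \<comment> \<open>The first \<open>n\<close> coordinates and the tail may each contribute a
    quarter of \<open>r\<^sup>2\<close>; \<open>n\<close> errors below \<open>\<delta>\<close>
    respect this because \<open>real n \<le> (real n + 1)\<^sup>2\<close>.\<close>
  define \<delta> where "\<delta> = r / 2 / (real n + 1)"
  have \<delta>: "\<delta> > 0" using r by (simp add: \<delta>_def)
  have "\<forall>i. \<exists>q :: rat \<times> rat. cmod (x i - Complex (of_rat (fst q)) (of_rat (snd q))) < \<delta>"
    using complex_rational_approx[OF \<delta>] by blast
  from choice[OF this] obtain q :: "nat \<Rightarrow> rat \<times> rat"
    where q: "\<And>i. cmod (x i - Complex (of_rat (fst (q i))) (of_rat (snd (q i)))) < \<delta>" by blast
  define y where "y = rational_sequence (map q [0..<n])"
  have y1: "cmod (x i - y i) < \<delta>" if "i < n" for i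
    using q[of i] that by (simp add: y_def rational_sequence_def)
  have y2: "y i = 0" if "i \<ge> n" for i using that by (simp add: y_def rational_sequence_def)
  have "(\<Sum>i\<in>F. (cmod ((x - y) i))\<^sup>2) \<le> r\<^sup>2 / 2" if F: "finite F" for F
  proof -
    have "(\<Sum>i\<in>F. (cmod ((x - y) i))\<^sup>2) \<le> (\<Sum>i\<in>{..<n} \<union> (F - {..<n}). (cmod ((x - y) i))\<^sup>2)"
      using F by (intro sum_mono2) auto
    also have "\<dots> = (\<Sum>i<n. (cmod ((x - y) i))\<^sup>2) + (\<Sum>i\<in>F - {..<n}. (cmod ((x - y) i))\<^sup>2)"
      using F by (intro sum.union_disjoint) auto
    also have "(\<Sum>i\<in>F - {..<n}. (cmod ((x - y) i))\<^sup>2) = (\<Sum>i\<in>F - {..<n}. (cmod (x i))\<^sup>2)"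
      using y2 by (intro sum.cong) auto
    also have "(\<Sum>i\<in>F - {..<n}. (cmod (x i))\<^sup>2) \<le> r\<^sup>2 / 4"
    proof -
      have "(\<Sum>i<n. (cmod (x i))\<^sup>2) + (\<Sum>i\<in>F - {..<n}. (cmod (x i))\<^sup>2) = (\<Sum>i\<in>{..<n} \<union> (F - {..<n}). (cmod (x i))\<^sup>2)"
        using F by (intro sum.union_disjoint[symmetric]) auto
      also have "\<dots> \<le> ?S" using F by (intro finite_sum_le_has_sum[OF S]) auto
      finally show ?thesis using n by linarith
    qed
    also have "(\<Sum>i<n. (cmod ((x - y) i))\<^sup>2) \<le> (\<Sum>i<n. \<delta>\<^sup>2)"
      using y1 less_imp_le by (intro sum_mono power_mono) auto
    also have "(\<Sum>i<n. \<delta>\<^sup>2) = real n * \<delta>\<^sup>2" by simp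
    also have "real n * \<delta>\<^sup>2 \<le> r\<^sup>2 / 4"
    proof -
      have "real n \<le> (real n + 1)\<^sup>2" by (simp add: power2_sum)
      then have le: "real n * (r\<^sup>2 / (real n + 1)\<^sup>2) \<le> r\<^sup>2"
        using mult_right_mono[of "real n" "(real n + 1)\<^sup>2" "r\<^sup>2"] by (simp add: divide_le_eq mult.commute)
      have eq: "real n * \<delta>\<^sup>2 = real n * (r\<^sup>2 / (real n + 1)\<^sup>2) / 4"
        unfolding \<delta>_def power_divide by simp
      show ?thesis unfolding eq by (rule divide_right_mono[OF le]) simp
    qed
    finally show ?thesis by simp
  qed
  moreover have "r\<^sup>2 / 2 = (r / sqrt 2)\<^sup>2" by (simp add: power_divide)
  ultimately have "hnorm l2 (x - y) \<le> r / sqrt 2"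
    using r by (intro l2_norm_leI(2)) auto
  also have "r / sqrt 2 < r" using r by (simp add: field_simps)
  finally show ?thesis unfolding y_def by blast
qed

lemma l2_separable_hilbert_space: "separable_hilbert_space l2"
proof -
  interpret M: Metric_space "hcarrier l2" "hdist l2" by (rule l2_metric)
  have "hilbert_space l2"
    using l2.subspace_carrier l2.inner_commute l2.inner_add_left l2.inner_scale_left l2.inner_nonneg
      l2.inner_definite l2_mcomplete l2.vector_space_axioms
    by (intro hilbert_space.intro hilbert_space_axioms.intro)
  moreover have "separable_space M.mtopology"
    unfolding separable_space_def
  proof (intro exI conjI)
    show "countable (range rational_sequence)" by simp
    show "range rational_sequence \<subseteq> topspace M.mtopology" using rational_sequence_l2 by auto
    show "M.mtopology closure_of range rational_sequence = topspace M.mtopology"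
    proof
      show "topspace M.mtopology \<subseteq> M.mtopology closure_of range rational_sequence"
      proof
        fix x assume "x \<in> topspace M.mtopology"
        then have x: "x \<in> hcarrier l2" by simp
        have "\<exists>y\<in>range rational_sequence. y \<in> M.mball x r" if r: "r > 0" for r
        proof -
          obtain qs where "hnorm l2 (x - rational_sequence qs) < r" using rational_sequence_dense[OF x r] by blast
          then show ?thesis using x rational_sequence_l2 by (auto simp: M.in_mball hdist_def)
        qed
        then show "x \<in> M.mtopology closure_of range rational_sequence"
          using x unfolding M.metric_closure_of by blast
      qed
    qed (rule closure_of_subset_topspace)
  qed
  ultimately show ?thesis by (simp add: separable_hilbert_space_def separable_hilbert_space_axioms_def)
qed

section \<open>Eigenvalues and traces of diagonal operators\<close>

definition diagonal :: "(nat \<Rightarrow> real) \<Rightarrow> (nat \<Rightarrow> complex) \<Rightarrow> nat \<Rightarrow> complex" where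
  "diagonal d x i = complex_of_real (d i) * x i"

definition unit_sequence :: "nat \<Rightarrow> nat \<Rightarrow> complex" where
  "unit_sequence i j = (if i = j then 1 else 0)"

lemma diagonal_pow: "(diagonal d ^^ n) x = (\<lambda>i. complex_of_real (d i ^ n) * x i)"
  by (induction n) (auto simp: diagonal_def fun_eq_iff)

lemma inner_unit_sequence: "hinner l2 x (unit_sequence i) = x i"
proof -
  have "(\<Sum>\<^sub>\<infinity>j. x j * cnj (unit_sequence i j)) = (\<Sum>\<^sub>\<infinity>j\<in>{i}. x j * cnj (unit_sequence i j))"
    by (intro infsum_cong_neutral) (auto simp: unit_sequence_def)
  then show ?thesis by (simp add: l2_simps unit_sequence_def)
qed

lemma unit_sequence_l2: "unit_sequence i \<in> hcarrier l2"
proof -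
  have "(\<lambda>j. (cmod (unit_sequence i j))\<^sup>2) summable_on {i}" by simp
  moreover have "(\<lambda>j. (cmod (unit_sequence i j))\<^sup>2) summable_on {i} \<longleftrightarrow>
      (\<lambda>j. (cmod (unit_sequence i j))\<^sup>2) summable_on UNIV"
    by (intro summable_on_cong_neutral) (auto simp: unit_sequence_def)
  ultimately show ?thesis by (simp add: l2_simps)
qed

lemma inj_unit_sequence: "inj unit_sequence"
  by (rule injI) (metis unit_sequence_def zero_neq_one)

lemma unit_sequence_basis: "orthonormal_basis l2 (range unit_sequence)"
  unfolding orthonormal_basis_def
proof (intro conjI ballI impI)
  show "range unit_sequence \<subseteq> hcarrier l2" using unit_sequence_l2 by auto
  show "hinner l2 e f = (if e = f then 1 else 0)"
    if "e \<in> range unit_sequence" "f \<in> range unit_sequence" for e f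
    using that injD[OF inj_unit_sequence] by (auto simp: inner_unit_sequence) (auto simp: unit_sequence_def)
  show "x = 0" if "\<forall>e\<in>range unit_sequence. hinner l2 x e = 0" for x
    using that by (auto simp: inner_unit_sequence)
qed

lemma diagonal_selfadjoint:
  assumes d: "\<And>i. \<bar>d i\<bar> \<le> B"
  shows "selfadjoint l2 (diagonal d)"
proof -
  have b: "diagonal d x \<in> hcarrier l2" "hnorm l2 (diagonal d x) \<le> B * hnorm l2 x" if "x \<in> hcarrier l2" for x
    using l2_bounded_mult[of "\<lambda>i. complex_of_real (d i)" B x] d that by (simp_all add: diagonal_def[abs_def])
  have "bounded_operator l2 (diagonal d)"
    unfolding bounded_operator_def using b
    by (auto simp: diagonal_def fun_eq_iff l2_simps(2) algebra_simps)
  moreover have "hinner l2 (diagonal d x) y = hinner l2 x (diagonal d y)" for x y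
    unfolding l2_simps diagonal_def by (intro infsum_cong) simp
  ultimately show ?thesis by (simp add: selfadjoint_def is_adjoint_def)
qed

locale diagonal_operator =
  fixes d :: "nat \<Rightarrow> real" and p :: nat
  assumes p: "p > 0" "even p" and summable: "(\<lambda>i. \<bar>d i\<bar> ^ p) summable_on UNIV"
begin

lemma bounded: "\<exists>B. \<forall>i. \<bar>d i\<bar> \<le> B"
proof -
  have "\<bar>d i\<bar> \<le> max 1 (\<Sum>\<^sub>\<infinity>i. \<bar>d i\<bar> ^ p)" for i
  proof (cases "\<bar>d i\<bar> \<le> 1")
    case False
    have "\<bar>d i\<bar> ^ 1 \<le> \<bar>d i\<bar> ^ p" using False p by (intro power_increasing) auto
    also have "\<dots> = (\<Sum>i\<in>{i}. \<bar>d i\<bar> ^ p)" by simp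
    also have "\<dots> \<le> (\<Sum>\<^sub>\<infinity>i. \<bar>d i\<bar> ^ p)" by (intro finite_sum_le_infsum summable) auto
    finally show ?thesis by simp
  qed simp
  then show ?thesis by blast
qed

sublocale selfadjoint_operator l2 "diagonal d"
proof unfold_locales
  obtain B where "\<And>i. \<bar>d i\<bar> \<le> B" using bounded by blast
  then show "selfadjoint l2 (diagonal d)" by (rule diagonal_selfadjoint)
qed

text \<open>Eigenvalues as a function of the basis vector, the form that
  \<open>has_trace_pow\<close> and \<open>eigenvalue_plus_eq\<close> expect.\<close>

definition eigenvalue :: "(nat \<Rightarrow> complex) \<Rightarrow> real" where
  "eigenvalue f = d (inv unit_sequence f)"

lemma eigenvalue_unit_sequence [simp]: "eigenvalue (unit_sequence i) = d i"
  by (simp add: eigenvalue_def inv_f_f inj_unit_sequence)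

lemma eigenvector: "f \<in> range unit_sequence \<Longrightarrow> diagonal d f = hscale l2 (complex_of_real (eigenvalue f)) f"
  by (auto simp: l2_simps diagonal_def fun_eq_iff unit_sequence_def)

lemma eigenvalue_summable: "(\<lambda>f. \<bar>eigenvalue f\<bar> ^ p) summable_on range unit_sequence"
  using summable by (subst summable_on_reindex[OF inj_unit_sequence]) (simp add: o_def)

lemma trace_pow:
  assumes n: "n \<ge> p"
  shows "has_trace l2 (diagonal d ^^ n) (complex_of_real (\<Sum>\<^sub>\<infinity>f\<in>range unit_sequence. eigenvalue f ^ n))"
proof (rule has_trace_pow[OF unit_sequence_basis eigenvector])
  show "(\<lambda>f. \<bar>eigenvalue f\<bar> ^ n) summable_on range unit_sequence"
    by (rule abs_power_summable_mono[OF eigenvalue_summable n p(1)])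
  fix x :: "nat \<Rightarrow> complex" assume x: "x \<in> hcarrier l2"
  have y: "(diagonal d ^^ n) x \<in> hcarrier l2" using x by simp
  have "hinner l2 (unit_sequence i) x = cnj (x i)" for i
    using l2.inner_commute[OF unit_sequence_l2 x] by (simp add: inner_unit_sequence)
  then have "(\<lambda>f. hinner l2 ((diagonal d ^^ n) x) f * hinner l2 f x) \<circ> unit_sequence =
      (\<lambda>i. (diagonal d ^^ n) x i * cnj (x i))"
    by (simp add: o_def inner_unit_sequence)
  moreover have "((\<lambda>i. (diagonal d ^^ n) x i * cnj (x i)) has_sum hinner l2 ((diagonal d ^^ n) x) x) UNIV"
    unfolding l2_simps(3) by (intro has_sum_infsum l2_inner_summable y x)
  ultimately show "((\<lambda>f. hinner l2 ((diagonal d ^^ n) x) f * hinner l2 f x) has_sum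
      hinner l2 ((diagonal d ^^ n) x) x) (range unit_sequence)"
    by (subst has_sum_reindex[OF inj_unit_sequence]) simp
next
  fix E f assume E: "orthonormal_basis l2 E" and f: "f \<in> range unit_sequence"
  have "hnorm l2 f = 1" using f by (auto simp: hnorm_def inner_unit_sequence) (simp add: unit_sequence_def)
  moreover have "f \<in> hcarrier l2" using f unit_sequence_l2 by auto
  ultimately show "((\<lambda>e. (cmod (hinner l2 f e))\<^sup>2) has_sum 1) E"
    using l2.Parseval_complete[OF l2_complete E, of f] by simp
qed

lemma schatten: "diagonal d \<in> schatten_class l2 p"
proof -
  \<comment> \<open>The absolute value is again diagonal, and for even \<open>p\<close> its p-th
    power is that of the operator itself.\<close>
  let ?P = "diagonal (\<lambda>i. \<bar>d i\<bar>)"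
  obtain B where B: "\<And>i. \<bar>d i\<bar> \<le> B" using bounded by blast
  have sa: "selfadjoint l2 ?P" by (rule diagonal_selfadjoint[of _ B]) (use B in simp)
  have "hinner l2 (?P x) x \<in> \<real>\<^sub>\<ge>\<^sub>0" for x
  proof -
    have "hinner l2 (?P x) x = (\<Sum>\<^sub>\<infinity>i. complex_of_real (\<bar>d i\<bar> * (cmod (x i))\<^sup>2))"
      unfolding l2_simps diagonal_def
      by (intro infsum_cong) (simp add: complex_norm_square mult.assoc del: of_real_power)
    then show ?thesis unfolding infsum_of_real_complex by (simp add: infsum_nonneg)
  qed
  moreover have "bounded_operator l2 ?P" using sa by (simp add: selfadjoint_def is_adjoint_def)
  ultimately have "positive_operator l2 ?P" by (simp add: positive_operator_def)
  moreover have "?P (?P x) = diagonal d (diagonal d x)" for x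
    by (auto simp: diagonal_def fun_eq_iff simp flip: of_real_mult mult.assoc)
  ultimately have "is_absolute_value l2 (diagonal d) ?P"
    using selfadjoint by (auto simp: is_absolute_value_def selfadjoint_def)
  moreover have "?P ^^ p = diagonal d ^^ p"
    using p(2) by (intro ext) (simp add: diagonal_pow power_even_abs)
  then have "has_trace l2 (?P ^^ p) (complex_of_real (\<Sum>\<^sub>\<infinity>f\<in>range unit_sequence. eigenvalue f ^ p))"
    using trace_pow[of p] by simp
  moreover have "bounded_operator l2 (diagonal d)"
    using selfadjoint by (simp add: selfadjoint_def is_adjoint_def)
  ultimately show ?thesis unfolding schatten_class_def by blast
qed

end

lemma eigenvalue_list_of_decseq:
  assumes "decseq l" "\<And>i. l i \<ge> 0" "summable (\<lambda>i. l i ^ p)" "p > 0"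
  shows "eigenvalue_list (\<lambda>t. card {i. l i = t}) l"
proof -
  have "finite {i. l i = t}" if "t > 0" for t
  proof -
    have "(\<lambda>i. l i ^ p) summable_on UNIV"
      using assms(2,3) by (subst summable_on_UNIV_nonneg_real_iff) auto
    then have "finite {i \<in> UNIV. l i ^ p \<ge> t ^ p}" using assms(2) that by (intro finite_superlevel) auto
    then show ?thesis by (rule finite_subset[rotated]) auto
  qed
  then show ?thesis using assms(1,2) by (simp add: eigenvalue_list_def)
qed

text \<open>Both lists may have infinitely many nonzero entries, so they are interleaved along even
  and odd positions. Zeros in them only enlarge the kernel, of which the eigenvalue lists keep no
  count.\<close>

lemma diagonal_realization:
  assumes l: "decseq l" "\<And>i. l i \<ge> 0" "summable (\<lambda>i. l i ^ p)"
    and l': "decseq l'" "\<And>i. l' i \<ge> 0" "summable (\<lambda>i. l' i ^ p)"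
    and p: "p > 0" "even p"
  defines "d \<equiv> \<lambda>i. if even i then l (i div 2) else - l' (i div 2)"
  shows "selfadjoint l2 (diagonal d)" "diagonal d \<in> schatten_class l2 p"
    "eigenvalue_plus l2 (diagonal d) = l" "eigenvalue_minus l2 (diagonal d) = (\<lambda>i. - l' i)"
    "\<And>n. n \<ge> p \<Longrightarrow> operator_trace l2 (diagonal d ^^ n) =
      complex_of_real ((\<Sum>i. l i ^ n) + (- 1) ^ n * (\<Sum>i. l' i ^ n))"
proof -
  let ?U = "range unit_sequence"
  have d_even: "d (2 * i) = l i" and d_odd: "d (2 * i + 1) = - l' i" for i by (simp_all add: d_def)
  have "(\<lambda>i. \<bar>d i\<bar> ^ p) summable_on range (\<lambda>i. 2 * i)"
    using l(2,3) by (subst summable_on_reindex)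
      (auto simp: inj_on_def o_def d_even summable_on_UNIV_nonneg_real_iff)
  moreover have "(\<lambda>i. \<bar>d i\<bar> ^ p) summable_on range (\<lambda>i. 2 * i + 1)"
    using l'(2,3) by (subst summable_on_reindex)
      (auto simp: inj_on_def o_def d_odd[simplified] summable_on_UNIV_nonneg_real_iff)
  ultimately have "(\<lambda>i. \<bar>d i\<bar> ^ p) summable_on range (\<lambda>i. 2 * i) \<union> range (\<lambda>i. 2 * i + 1)"
    by (rule summable_on_Un_disjoint) (use double_not_eq_Suc_double in auto)
  moreover have "range (\<lambda>i. 2 * i) \<union> range (\<lambda>i. 2 * i + 1) = (UNIV :: nat set)"
  proof (intro equalityI subset_UNIV subsetI)
    show "i \<in> range (\<lambda>i. 2 * i) \<union> range (\<lambda>i. 2 * i + 1)" for i :: nat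
      by (cases "even i") (blast elim: evenE oddE)+
  qed
  ultimately have "(\<lambda>i. \<bar>d i\<bar> ^ p) summable_on UNIV" by simp
  then interpret diagonal_operator d p using p by unfold_locales
  show "selfadjoint l2 (diagonal d)" by (rule selfadjoint)
  show "diagonal d \<in> schatten_class l2 p" by (rule schatten)
  have "{f \<in> ?U. eigenvalue f = t} = (\<lambda>i. unit_sequence (2 * i)) ` {i. l i = t}" if t: "t > 0" for t
  proof
    show "{f \<in> ?U. eigenvalue f = t} \<subseteq> (\<lambda>i. unit_sequence (2 * i)) ` {i. l i = t}"
    proof
      fix f assume "f \<in> {f \<in> ?U. eigenvalue f = t}"
      then obtain i where i: "f = unit_sequence i" "d i = t" by auto
      have "even i" using i(2) t l'(2)[of "i div 2"] by (auto simp: d_def split: if_splits)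
      then obtain j where "i = 2 * j" by (rule evenE)
      then show "f \<in> (\<lambda>i. unit_sequence (2 * i)) ` {i. l i = t}" using i d_even by auto
    qed
  qed (auto simp: d_even)
  moreover have "inj (\<lambda>i. unit_sequence (2 * i))"
    by (rule injI) (auto dest: injD[OF inj_unit_sequence])
  then have "card ((\<lambda>i. unit_sequence (2 * i)) ` {i. l i = t}) = card {i. l i = t}" for t
    by (rule card_image[OF inj_on_subset]) simp
  ultimately have card_plus: "card {f \<in> ?U. eigenvalue f = t} = card {i. l i = t}" if "t > 0" for t
    using that by simp
  have "{f \<in> ?U. - eigenvalue f = t} = (\<lambda>i. unit_sequence (2 * i + 1)) ` {i. l' i = t}" if t: "t > 0" for t
  proof
    show "{f \<in> ?U. - eigenvalue f = t} \<subseteq> (\<lambda>i. unit_sequence (2 * i + 1)) ` {i. l' i = t}"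
    proof
      fix f assume "f \<in> {f \<in> ?U. - eigenvalue f = t}"
      then obtain i where i: "f = unit_sequence i" "- d i = t" by auto
      have "odd i" using i(2) t l(2)[of "i div 2"] by (auto simp: d_def split: if_splits)
      then obtain j where j: "i = 2 * j + 1" by (rule oddE)
      then have "l' j = t" using i(2) d_odd[of j] by (simp only: minus_minus)
      then show "f \<in> (\<lambda>i. unit_sequence (2 * i + 1)) ` {i. l' i = t}" using i(1) j by blast
    qed
    show "(\<lambda>i. unit_sequence (2 * i + 1)) ` {i. l' i = t} \<subseteq> {f \<in> ?U. - eigenvalue f = t}"
    proof
      fix f assume "f \<in> (\<lambda>i. unit_sequence (2 * i + 1)) ` {i. l' i = t}"
      then obtain i where "f = unit_sequence (2 * i + 1)" "l' i = t" by blast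
      then show "f \<in> {f \<in> ?U. - eigenvalue f = t}" using d_odd[of i] by simp
    qed
  qed
  moreover have "inj (\<lambda>i. unit_sequence (2 * i + 1))"
    by (rule injI) (auto dest: injD[OF inj_unit_sequence])
  then have "card ((\<lambda>i. unit_sequence (2 * i + 1)) ` {i. l' i = t}) = card {i. l' i = t}" for t
    by (rule card_image[OF inj_on_subset]) simp
  ultimately have card_minus: "card {f \<in> ?U. - eigenvalue f = t} = card {i. l' i = t}" if "t > 0" for t
    using that by simp
  have L: "eigenvalue_list (\<lambda>t. card {f \<in> ?U. eigenvalue f = t}) l"
    using eigenvalue_list_of_decseq[OF l p(1)] card_plus unfolding eigenvalue_list_def by simp
  have L': "eigenvalue_list (\<lambda>t. card {f \<in> ?U. - eigenvalue f = t}) l'"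
    using eigenvalue_list_of_decseq[OF l' p(1)] card_minus unfolding eigenvalue_list_def by simp
  note fin = finite_eigenvalues_ge[OF unit_sequence_basis eigenvector p(1) eigenvalue_summable]
  show "eigenvalue_plus l2 (diagonal d) = l"
    by (rule eigenvalue_plus_eq[OF unit_sequence_basis eigenvector p(1) eigenvalue_summable L])
  show "eigenvalue_minus l2 (diagonal d) = (\<lambda>i. - l' i)"
    by (rule eigenvalue_minus_eq[OF unit_sequence_basis eigenvector p(1) eigenvalue_summable L'])
  fix n assume n: "n \<ge> p"
  have s: "(\<lambda>f. \<bar>eigenvalue f\<bar> ^ n) summable_on ?U"
    by (rule abs_power_summable_mono[OF eigenvalue_summable n p(1)])
  have n0: "n > 0" using n p(1) by simp
  have "(\<Sum>\<^sub>\<infinity>f\<in>?U. eigenvalue f ^ n) = (\<Sum>i. l i ^ n) + (- 1) ^ n * (\<Sum>i. l' i ^ n)"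
    by (intro eigenvalue_lists_power_sum(3)[OF L L' _ _ n0 s] fin; assumption)
  then show "operator_trace l2 (diagonal d ^^ n) =
      complex_of_real ((\<Sum>i. l i ^ n) + (- 1) ^ n * (\<Sum>i. l' i ^ n))"
    using l2.operator_trace_eq[OF trace_pow[OF n]] by simp
qed

section \<open>Existence of the limit operator\<close>

theorem proposition2p10:
  fixes p :: nat
    and H :: "nat \<Rightarrow> ('a::ab_group_add) hspace"
    and a :: "nat \<Rightarrow> 'a \<Rightarrow> 'a"
    and \<alpha> :: "nat \<Rightarrow> real"
  assumes "even p" and "p > 0"
    and "\<And>k. separable_hilbert_space (H k)"
    and "\<And>k. a k \<in> schatten_class (H k) p"
    and "\<And>k. selfadjoint (H k) (a k)"
    and "\<And>n. n \<ge> p \<Longrightarrow>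
           (\<lambda>k. operator_trace (H k) (a k ^^ n)) \<longlonglongrightarrow> complex_of_real (\<alpha> n)"
  shows "\<exists>(K :: (nat \<Rightarrow> complex) hspace) (b :: (nat \<Rightarrow> complex) \<Rightarrow> (nat \<Rightarrow> complex)).
           separable_hilbert_space K \<and> b \<in> schatten_class K p \<and> selfadjoint K b \<and>
           converges_in_eigenvalues H a K b \<and>
           (\<forall>n\<ge>p + 1. complex_of_real (\<alpha> n) = operator_trace K (b ^^ n))"
proof -
  obtain m where m: "p = 2 * m" using assms(1) by (rule evenE)
  have m0: "m > 0" using assms(2) m by simp
  \<comment> \<open>One predicate for the pair, so that \<open>P\<close> and \<open>Q\<close> are
    chosen for all \<open>k\<close> at once.\<close>
  define lists where "lists k P Q \<longleftrightarrow>
    eigenvalue_plus (H k) (a k) = P \<and> eigenvalue_minus (H k) (a k) = (\<lambda>i. - Q i) \<and>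
    decseq P \<and> decseq Q \<and> (\<forall>i. P i \<ge> 0) \<and> (\<forall>i. Q i \<ge> 0) \<and>
    (\<forall>n\<ge>p. summable (\<lambda>i. P i ^ n) \<and> summable (\<lambda>i. Q i ^ n) \<and> operator_trace (H k) (a k ^^ n) =
      complex_of_real ((\<Sum>i. P i ^ n) + (- 1) ^ n * (\<Sum>i. Q i ^ n)))" for k P Q
  have "\<exists>P Q. lists k P Q" for k
  proof -
    interpret h: separable_hilbert_space "H k" by (rule assms(3))
    interpret selfadjoint_operator "H k" "a k"
      using h.subspace_carrier h.inner_commute h.inner_add_left h.inner_scale_left h.inner_nonneg
        h.inner_definite h.vector_space_axioms assms(5)
      by (intro selfadjoint_operator.intro inner_product_space.intro inner_product_space_axioms.intro
          selfadjoint_operator_axioms.intro)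
    obtain t where t: "has_trace (H k) (a k ^^ (2 * m)) t"
      using schatten_class_has_trace assms(4) unfolding m by blast
    interpret finite_trace_operator "H k" "a k" m t by unfold_locales (rule t)
    from m0 show ?thesis
    proof (rule eigenvalue_lists)
      fix P Q
      assume "eigenvalue_plus (H k) (a k) = P" "eigenvalue_minus (H k) (a k) = (\<lambda>i. - Q i)"
        "decseq P" "decseq Q" "\<And>i. P i \<ge> 0" "\<And>i. Q i \<ge> 0"
        "\<And>n. n \<ge> 2 * m \<Longrightarrow> summable (\<lambda>i. P i ^ n)" "\<And>n. n \<ge> 2 * m \<Longrightarrow> summable (\<lambda>i. Q i ^ n)"
        "\<And>n. n \<ge> 2 * m \<Longrightarrow> operator_trace (H k) (a k ^^ n) =
          complex_of_real ((\<Sum>i. P i ^ n) + (- 1) ^ n * (\<Sum>i. Q i ^ n))"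
      then have "lists k P Q" unfolding lists_def m by blast
      then show ?thesis by blast
    qed
  qed
  then obtain P Q where "\<And>k. lists k (P k) (Q k)" by metis
  note lists = this[unfolded lists_def]
  have PQ: "eigenvalue_plus (H k) (a k) = P k" "eigenvalue_minus (H k) (a k) = (\<lambda>i. - Q k i)" for k
    using lists[of k] by blast+
  have dec: "decseq (P k)" "decseq (Q k)" for k using lists[of k] by blast+
  have nonneg: "P k i \<ge> 0" "Q k i \<ge> 0" for k i using lists[of k] by blast+
  have summ: "summable (\<lambda>i. P k i ^ n)" "summable (\<lambda>i. Q k i ^ n)" if "n \<ge> p" for k n
    using lists[of k] that by blast+
  have tr: "operator_trace (H k) (a k ^^ n) =
      complex_of_real ((\<Sum>i. P k i ^ n) + (- 1) ^ n * (\<Sum>i. Q k i ^ n))" if "n \<ge> p" for k n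
    using lists[of k] that by blast
  have ps: "power_sums P Q p \<alpha>"
  proof
    fix n assume n: "n \<ge> p"
    have "(\<Sum>i. P k i ^ n + (- Q k i) ^ n) = (\<Sum>i. P k i ^ n) + (- 1) ^ n * (\<Sum>i. Q k i ^ n)" for k
    proof -
      have "(\<lambda>i. P k i ^ n + (- Q k i) ^ n) = (\<lambda>i. P k i ^ n + (- 1) ^ n * Q k i ^ n)"
        by (simp flip: power_mult_distrib)
      then show ?thesis
        using summ[OF n, of k] by (simp add: suminf_mult summable_mult flip: suminf_add)
    qed
    then have "(\<lambda>k. complex_of_real (\<Sum>i. P k i ^ n + (- Q k i) ^ n)) \<longlonglongrightarrow> complex_of_real (\<alpha> n)"
      using assms(6)[OF n] by (simp only: tr[OF n])
    then show "(\<lambda>k. \<Sum>i. P k i ^ n + (- Q k i) ^ n) \<longlonglongrightarrow> \<alpha> n"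
      by (simp only: tendsto_of_real_iff)
  qed (rule assms(1,2) dec nonneg summ order_refl)+
  obtain l l' where
    l: "\<And>i. (\<lambda>k. P k i) \<longlonglongrightarrow> l i" "decseq l" "\<And>i. l i \<ge> 0" "summable (\<lambda>i. l i ^ p)"
    and l': "\<And>i. (\<lambda>k. Q k i) \<longlonglongrightarrow> l' i" "decseq l'" "\<And>i. l' i \<ge> 0" "summable (\<lambda>i. l' i ^ p)"
    and \<alpha>: "\<And>n. n > p \<Longrightarrow> \<alpha> n = (\<Sum>i. l i ^ n) + (- 1) ^ n * (\<Sum>i. l' i ^ n)"
    by (rule power_sums_limit[OF ps]) (rule that)
  define b where "b = diagonal (\<lambda>i. if even i then l (i div 2) else - l' (i div 2))"
  note b = diagonal_realization[OF l(2-4) l'(2-4) assms(2,1), folded b_def]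
  have "converges_in_eigenvalues H a l2 b"
    unfolding converges_in_eigenvalues_def b(3,4) PQ by (intro conjI allI tendsto_minus l(1) l'(1))
  moreover have "complex_of_real (\<alpha> n) = operator_trace l2 (b ^^ n)" if "n \<ge> p + 1" for n
    using b(5)[of n] \<alpha>[of n] that by simp
  ultimately show ?thesis
    using l2_separable_hilbert_space b(1,2) by blast
qed

end
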